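(* Let $X$ be a Banach space and let $L$ be a set. Suppose that there exist a linear homeomorphic embedding $S:X\to\ell_\infty(L)$ and a bounded linear operator $T:X\to c_0(L)$ with the property that $(S(x),T(x))\in U(L)$ whenever $x$ is a non-zero element of $X$. Then $X$ admits an equivalent $\mathcal C^\infty$ norm. Moreover, for every $k\in\mathbb N\cup\{\infty\}$ ($k\geq 1$), whenever a Banach space $E$ admits an equivalent $\mathcal C^k$ norm, so does the injective tensor product $X\otimes_\epsilon E$.
   Context: All Banach spaces are real. $\ell_\infty(L)$ is the space of bounded real functions on $L$ with the supremum norm $\|\cdot\|_\infty$, and $c_0(L)$ is its closed subspace of those $x$ such that $\{t\in L:|x_t|\ge\epsilon\}$ is finite for every $\epsilon>0$. $U(L)$ is the set of all pairs $(f,x)\in\ell_\infty(L)\oplus c_0(L)$ such that $\|f\|_\infty$ and $\|x\|_\infty$ are both strictly less than $\bigl\||f|+\tfrac12|x|\bigr\|_\infty$, where $|\cdot|$ is the coordinatewise absolute value. A norm on a Banach space $X$ is said to be of class $\mathcal C^k$ if the function $x\mapsto\|x\|$ is of class $\mathcal C^k$ (in the Fréchet sense) on $X\setminus\{0\}$. The injective tensor product $X\otimes_\epsilon E$ is the completion of the algebraic tensor product $X\odot E$ for the norm $\|z\|_\epsilon=\sup\{|\langle\xi\otimes\eta,z\rangle|:\xi\in\operatorname{ball}X^*,\ \eta\in\operatorname{ball}E^*\}$, where $\langle\xi\otimes\eta,\sum_j x_j\otimes e_j\rangle=\sum_j\langle\xi,x_j\rangle\langle\eta,e_j\rangle$ and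 $\operatorname{ball}$ denotes the closed unit ball. *)

theory Defs
  imports
    "HOL-Analysis.Analysis"
    "HOL-Library.Extended_Nat"
    "HOL-Probability.Discrete_Topology"
begin

section \<open>Functions of class $C^k$ in the Frechet sense\<close>

text \<open>The derivative of order \<open>j\<close> takes its values in the \<open>j\<close>-fold iterated space of bounded linear
  maps, a type that depends on \<open>j\<close>.  It is represented by a bounded \<open>j\<close>-linear map on lists of
  length \<open>j\<close> (values on other lists are irrelevant), and all \<open>\<epsilon>\<close>-conditions are uniform over lists of
  vectors of norm at most 1, i.e. they refer to the operator norm.  The most recent direction of
  differentiation is the head of the list.  The set \<open>S\<close> is meant to be open.  The lemmas
  \<open>C_on_0\<close> and \<open>C_on_Suc\<close> below give the usual recursive characterisation.\<close>

definition bounded_multilinear ::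
  "nat \<Rightarrow> ('a::real_normed_vector list \<Rightarrow> 'b::real_normed_vector) \<Rightarrow> bool" where
  "bounded_multilinear n m \<longleftrightarrow>
     (\<forall>us ws. length us + 1 + length ws = n \<longrightarrow> linear (\<lambda>v. m (us @ v # ws))) \<and>
     (\<exists>K. \<forall>vs. length vs = n \<longrightarrow> norm (m vs) \<le> K * prod_list (map norm vs))"

definition unit_lists :: "nat \<Rightarrow> 'a::real_normed_vector list set" where
  "unit_lists n = {vs. length vs = n \<and> (\<forall>v\<in>set vs. norm v \<le> 1)}"

definition derivatives_upto ::
  "nat \<Rightarrow> 'a::real_normed_vector set \<Rightarrow> ('a \<Rightarrow> 'b::real_normed_vector) \<Rightarrow>
   (nat \<Rightarrow> 'a \<Rightarrow> 'a list \<Rightarrow> 'b) \<Rightarrow> bool" where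
  "derivatives_upto k S f D \<longleftrightarrow>
     (\<forall>x\<in>S. D 0 x [] = f x) \<and>
     (\<forall>j\<le>k. \<forall>x\<in>S. bounded_multilinear j (D j x)) \<and>
     (\<forall>j<k. \<forall>x\<in>S. \<forall>\<epsilon>>0. \<forall>\<^sub>F y in at x within S. \<forall>vs\<in>unit_lists j.
        norm (D j y vs - D j x vs - D (Suc j) x ((y - x) # vs)) \<le> \<epsilon> * norm (y - x)) \<and>
     (\<forall>x\<in>S. \<forall>\<epsilon>>0. \<forall>\<^sub>F y in at x within S. \<forall>vs\<in>unit_lists k. norm (D k y vs - D k x vs) \<le> \<epsilon>)"

definition C_on ::
  "nat \<Rightarrow> 'a::real_normed_vector set \<Rightarrow> ('a \<Rightarrow> 'b::real_normed_vector) \<Rightarrow> bool" where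
  "C_on k S f \<longleftrightarrow> (\<exists>D. derivatives_upto k S f D)"

definition C_class_on ::
  "enat \<Rightarrow> 'a::real_normed_vector set \<Rightarrow> ('a \<Rightarrow> 'b::real_normed_vector) \<Rightarrow> bool" where
  "C_class_on k S f \<longleftrightarrow> (\<forall>n. enat n \<le> k \<longrightarrow> C_on n S f)"

lemma derivatives_uptoD:
  assumes "derivatives_upto k S f D" and "x \<in> S"
  shows "D 0 x [] = f x"
    and "j \<le> k \<Longrightarrow> bounded_multilinear j (D j x)"
    and "j < k \<Longrightarrow> \<epsilon> > 0 \<Longrightarrow> \<forall>\<^sub>F y in at x within S. \<forall>vs\<in>unit_lists j.
        norm (D j y vs - D j x vs - D (Suc j) x ((y - x) # vs)) \<le> \<epsilon> * norm (y - x)"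
    and "\<epsilon> > 0 \<Longrightarrow> \<forall>\<^sub>F y in at x within S. \<forall>vs\<in>unit_lists k. norm (D k y vs - D k x vs) \<le> \<epsilon>"
  using assms unfolding derivatives_upto_def by simp_all

lemma eventually_at_within_self: "\<forall>\<^sub>F y in at x within S. y \<in> S"
  by (simp add: eventually_at_filter)

lemma unit_lists_0 [simp]: "unit_lists 0 = {[]}"
  by (auto simp: unit_lists_def)

lemma length_unit_lists: "vs \<in> unit_lists n \<Longrightarrow> length vs = n"
  by (simp add: unit_lists_def)

lemma unit_lists_snoc: "vs @ [w] \<in> unit_lists (Suc n) \<longleftrightarrow> vs \<in> unit_lists n \<and> norm w \<le> 1"
  by (auto simp: unit_lists_def)

lemma unit_lists_Suc_cases:
  assumes "vs \<in> unit_lists (Suc n)"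
  obtains us w where "vs = us @ [w]" "us \<in> unit_lists n" "norm w \<le> 1"
proof (cases vs rule: rev_cases)
  case Nil
  then show ?thesis using assms by (simp add: unit_lists_def)
next
  case (snoc us w)
  then show ?thesis using assms that unit_lists_snoc by blast
qed

lemma norm_blinfun_le_unit:
  fixes A :: "'a::real_normed_vector \<Rightarrow>\<^sub>L 'b::real_normed_vector"
  assumes "0 \<le> b" "\<And>w. norm w \<le> 1 \<Longrightarrow> norm (blinfun_apply A w) \<le> b"
  shows "norm A \<le> b"
proof (rule norm_blinfun_bound)
  fix v :: 'a
  show "norm (blinfun_apply A v) \<le> b * norm v"
  proof (cases "v = 0")
    case False
    have "norm (blinfun_apply A (v /\<^sub>R norm v)) \<le> b"
      by (rule assms(2)) (simp add: False)
    then have "norm (blinfun_apply A v) / norm v \<le> b"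
      by (simp add: blinfun.scaleR_right divide_inverse_commute)
    then show ?thesis using False by (simp add: pos_divide_le_eq)
  qed (simp add: blinfun.zero_right)
qed (rule assms(1))

lemma C_on_0: "C_on 0 S f \<longleftrightarrow> continuous_on S f"
proof
  assume "C_on 0 S f"
  then obtain D where D: "derivatives_upto 0 S f D" by (auto simp: C_on_def)
  show "continuous_on S f"
    unfolding continuous_on_def
  proof (intro ballI tendstoI)
    fix x :: 'a and \<epsilon> :: real assume x: "x \<in> S" and "\<epsilon> > 0"
    then have "\<epsilon> / 2 > 0" by simp
    from derivatives_uptoD(4)[OF D x this] eventually_at_within_self[of S x]
    show "\<forall>\<^sub>F y in at x within S. dist (f y) (f x) < \<epsilon>"
      by eventually_elim (use \<open>\<epsilon> > 0\<close> x in \<open>simp add: dist_norm derivatives_uptoD(1)[OF D]\<close>)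
  qed
next
  assume f: "continuous_on S f"
  have "\<forall>\<^sub>F y in at x within S. norm (f y - f x) \<le> \<epsilon>" if "x \<in> S" "\<epsilon> > 0" for x \<epsilon>
  proof -
    have "(f \<longlongrightarrow> f x) (at x within S)" using f \<open>x \<in> S\<close> by (simp add: continuous_on_def)
    from tendstoD[OF this \<open>\<epsilon> > 0\<close>] show ?thesis
      by eventually_elim (simp add: dist_norm)
  qed
  then show "C_on 0 S f"
    unfolding C_on_def derivatives_upto_def
    by (intro exI[of _ "\<lambda>j x vs. f x"]) (auto simp: bounded_multilinear_def)
qed

lemma C_on_SucD:
  fixes f :: "'a::real_normed_vector \<Rightarrow> 'b::real_normed_vector"
  assumes "C_on (Suc k) S f"
  shows "\<exists>f' :: 'a \<Rightarrow> ('a \<Rightarrow>\<^sub>L 'b).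
    (\<forall>x\<in>S. (f has_derivative blinfun_apply (f' x)) (at x within S)) \<and> C_on k S f'"
proof -
  obtain D where "derivatives_upto (Suc k) S f D"
    using assms by (auto simp: C_on_def)
  note D = derivatives_uptoD[OF this]
  define E where "E j x vs = Blinfun (\<lambda>v. D (Suc j) x (vs @ [v]))" for j x vs
  have bound: "\<exists>K\<ge>0. \<forall>vs. length vs = Suc j \<longrightarrow> norm (D (Suc j) x vs) \<le> K * prod_list (map norm vs)"
    if j: "j \<le> k" and x: "x \<in> S" for j x
  proof -
    obtain K where K: "\<And>vs. length vs = Suc j \<Longrightarrow> norm (D (Suc j) x vs) \<le> K * prod_list (map norm vs)"
      using D(2)[of x "Suc j"] j x unfolding bounded_multilinear_def by auto
    have "norm (D (Suc j) x vs) \<le> \<bar>K\<bar> * prod_list (map norm vs)" if "length vs = Suc j" for vs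
    proof -
      have "K * prod_list (map norm vs) \<le> \<bar>K\<bar> * prod_list (map norm vs)"
        by (intro mult_right_mono prod_list_nonneg) auto
      then show ?thesis using K[OF that] by simp
    qed
    then show ?thesis by (intro exI[of _ "\<bar>K\<bar>"]) auto
  qed
  have E: "blinfun_apply (E j x vs) v = D (Suc j) x (vs @ [v])"
    if j: "j \<le> k" and x: "x \<in> S" and vs: "length vs = j" for j x vs v
  proof -
    have lin: "linear (\<lambda>v. D (Suc j) x (vs @ [v]))"
      using D(2)[of x "Suc j"] j x vs unfolding bounded_multilinear_def by force
    obtain K where "\<And>vs. length vs = Suc j \<Longrightarrow> norm (D (Suc j) x vs) \<le> K * prod_list (map norm vs)"
      using bound[OF j x] by blast
    from this[of "vs @ [v]" for v]
    have "norm (D (Suc j) x (vs @ [v])) \<le> norm v * (K * prod_list (map norm vs))" for v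
      using vs by (simp add: mult_ac)
    then have "bounded_linear (\<lambda>v. D (Suc j) x (vs @ [v]))"
      by (intro bounded_linear_intro linear_add[OF lin] linear_scale[OF lin])
    then show ?thesis by (simp add: E_def bounded_linear_Blinfun_apply)
  qed
  have "(f has_derivative blinfun_apply (E 0 x [])) (at x within S)" if x: "x \<in> S" for x
    unfolding has_derivative_within_alt2
  proof (intro conjI allI impI)
    fix \<epsilon> :: real assume "\<epsilon> > 0"
    from D(3)[OF x zero_less_Suc this] eventually_at_within_self[of S x]
    show "\<forall>\<^sub>F y in at x within S. norm (f y - f x - blinfun_apply (E 0 x []) (y - x)) \<le> \<epsilon> * norm (y - x)"
      by eventually_elim (simp add: E x D(1))
  qed (rule blinfun.bounded_linear_right)
  moreover have "C_on k S (\<lambda>x. E 0 x [])"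
    unfolding C_on_def derivatives_upto_def
  proof (intro exI[of _ E] conjI ballI allI impI)
    fix j x assume j: "j \<le> k" and x: "x \<in> S"
    show "bounded_multilinear j (E j x)"
      unfolding bounded_multilinear_def
    proof (intro conjI allI impI)
      fix us ws :: "'a list" assume len: "length us + 1 + length ws = j"
      have lin: "linear (\<lambda>v. D (Suc j) x (us @ v # ws @ [w]))" for w
        using D(2)[of x "Suc j"] j x len unfolding bounded_multilinear_def by force
      show "linear (\<lambda>v. E j x (us @ v # ws))"
        by (rule linearI; rule blinfun_eqI)
          (use len linear_add[OF lin] linear_scale[OF lin] in
            \<open>simp_all add: E[OF j x] blinfun.add_left blinfun.scaleR_left\<close>)
    next
      obtain K where K: "K \<ge> 0"
        "\<And>vs. length vs = Suc j \<Longrightarrow> norm (D (Suc j) x vs) \<le> K * prod_list (map norm vs)"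
        using bound[OF j x] by blast
      have "norm (E j x vs) \<le> K * prod_list (map norm vs)" if "length vs = j" for vs
      proof (rule norm_blinfun_bound)
        show "0 \<le> K * prod_list (map norm vs)"
          using K(1) by (auto intro!: mult_nonneg_nonneg prod_list_nonneg)
        show "norm (blinfun_apply (E j x vs) v) \<le> K * prod_list (map norm vs) * norm v" for v
          using K(2)[of "vs @ [v]"] that by (simp add: E[OF j x] mult.assoc)
      qed
      then show "\<exists>K. \<forall>vs. length vs = j \<longrightarrow> norm (E j x vs) \<le> K * prod_list (map norm vs)"
        by blast
    qed
  next
    fix j x and \<epsilon> :: real assume j: "j < k" and x: "x \<in> S" and "\<epsilon> > 0"
    then have "\<forall>\<^sub>F y in at x within S. \<forall>vs\<in>unit_lists (Suc j).
        norm (D (Suc j) y vs - D (Suc j) x vs - D (Suc (Suc j)) x ((y - x) # vs)) \<le> \<epsilon> * norm (y - x)"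
      by (intro D(3)) auto
    with eventually_at_within_self[of S x]
    show "\<forall>\<^sub>F y in at x within S. \<forall>vs\<in>unit_lists j.
        norm (E j y vs - E j x vs - E (Suc j) x ((y - x) # vs)) \<le> \<epsilon> * norm (y - x)"
    proof eventually_elim
      case (elim y)
      show ?case
      proof (intro ballI norm_blinfun_le_unit)
        fix vs :: "'a list" and w :: 'a assume "vs \<in> unit_lists j" "norm w \<le> 1"
        then show "norm (blinfun_apply (E j y vs - E j x vs - E (Suc j) x ((y - x) # vs)) w)
            \<le> \<epsilon> * norm (y - x)"
          using bspec[OF elim(2), of "vs @ [w]"] elim(1) j x
          by (simp add: blinfun.diff_left E unit_lists_snoc length_unit_lists)
      qed (use \<open>\<epsilon> > 0\<close> in auto)
    qed
  next
    fix x and \<epsilon> :: real assume x: "x \<in> S" and "\<epsilon> > 0"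
    then have "\<forall>\<^sub>F y in at x within S. \<forall>vs\<in>unit_lists (Suc k). norm (D (Suc k) y vs - D (Suc k) x vs) \<le> \<epsilon>"
      by (rule D(4))
    with eventually_at_within_self[of S x]
    show "\<forall>\<^sub>F y in at x within S. \<forall>vs\<in>unit_lists k. norm (E k y vs - E k x vs) \<le> \<epsilon>"
    proof eventually_elim
      case (elim y)
      show ?case
      proof (intro ballI norm_blinfun_le_unit)
        fix vs :: "'a list" and w :: 'a assume "vs \<in> unit_lists k" "norm w \<le> 1"
        then show "norm (blinfun_apply (E k y vs - E k x vs) w) \<le> \<epsilon>"
          using bspec[OF elim(2), of "vs @ [w]"] elim(1) x
          by (simp add: blinfun.diff_left E unit_lists_snoc length_unit_lists)
      qed (use \<open>\<epsilon> > 0\<close> in auto)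
    qed
  qed simp
  ultimately show ?thesis by (intro exI[of _ "\<lambda>x. E 0 x []"]) simp
qed

lemma C_on_SucI:
  fixes f :: "'a::real_normed_vector \<Rightarrow> 'b::real_normed_vector" and f' :: "'a \<Rightarrow> ('a \<Rightarrow>\<^sub>L 'b)"
  assumes f': "\<And>x. x \<in> S \<Longrightarrow> (f has_derivative blinfun_apply (f' x)) (at x within S)"
    and "C_on k S f'"
  shows "C_on (Suc k) S f"
proof -
  obtain E where "derivatives_upto k S f' E"
    using assms(2) by (auto simp: C_on_def)
  note E = derivatives_uptoD[OF this]
  define D where "D j x vs =
    (case j of 0 \<Rightarrow> f x | Suc i \<Rightarrow> blinfun_apply (E i x (butlast vs)) (last vs))" for j x vs
  have D0 [simp]: "D 0 x vs = f x" for x vs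
    by (simp add: D_def)
  have D_Suc [simp]: "D (Suc i) x (vs @ [v]) = blinfun_apply (E i x vs) v" for i x vs v
    by (simp add: D_def)
  have D_Suc2 [simp]: "D (Suc i) x (u # vs @ [v]) = blinfun_apply (E i x (u # vs)) v" for i x u vs v
    using D_Suc[of i x "u # vs" v] by simp
  have D_Suc3 [simp]: "D (Suc i) x [v] = blinfun_apply (E i x []) v" for i x v
    using D_Suc[of i x "[]" v] by simp
  have le: "norm (blinfun_apply A w) \<le> b" if "norm A \<le> b" "norm w \<le> 1"
    for A :: "'a \<Rightarrow>\<^sub>L 'b" and w b
    using norm_blinfun[of A w] mult_left_mono[OF that(2) norm_ge_zero[of A]] that(1) by simp
  show ?thesis
    unfolding C_on_def derivatives_upto_def
  proof (intro exI[of _ D] conjI ballI allI impI)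
    fix j x assume j: "j \<le> Suc k" and x: "x \<in> S"
    show "bounded_multilinear j (D j x)"
    proof (cases j)
      case 0
      then show ?thesis by (auto simp: bounded_multilinear_def)
    next
      case (Suc i)
      then have mult: "bounded_multilinear i (E i x)" using E(2) j x by simp
      show ?thesis
        unfolding bounded_multilinear_def
      proof (intro conjI allI impI)
        fix us ws :: "'a list" assume len: "length us + 1 + length ws = j"
        show "linear (\<lambda>v. D j x (us @ v # ws))"
        proof (cases ws rule: rev_cases)
          case Nil
          then show ?thesis
            by (simp add: Suc blinfun.bounded_linear_right bounded_linear.linear)
        next
          case (snoc ws' w)
          have lin: "linear (\<lambda>v. E i x (us @ v # ws'))"
            using mult len Suc snoc unfolding bounded_multilinear_def by force
          have "D j x (us @ v # ws) = blinfun_apply (E i x (us @ v # ws')) w" for v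
            using D_Suc[of i x "us @ v # ws'" w] by (simp add: Suc snoc)
          then show ?thesis
            by (intro linearI)
              (simp_all add: linear_add[OF lin] linear_scale[OF lin] blinfun.add_left blinfun.scaleR_left)
        qed
      next
        obtain K where K: "\<And>vs. length vs = i \<Longrightarrow> norm (E i x vs) \<le> K * prod_list (map norm vs)"
          using mult unfolding bounded_multilinear_def by blast
        have "norm (D j x vs) \<le> K * prod_list (map norm vs)" if len: "length vs = j" for vs
        proof (cases vs rule: rev_cases)
          case Nil
          then show ?thesis using len Suc by simp
        next
          case (snoc us w)
          have "norm (D j x vs) \<le> norm (E i x us) * norm w"
            by (simp add: Suc snoc norm_blinfun)
          also have "\<dots> \<le> (K * prod_list (map norm us)) * norm w"
            using len Suc snoc by (intro mult_right_mono K) auto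
          finally show ?thesis by (simp add: snoc mult.assoc)
        qed
        then show "\<exists>K. \<forall>vs. length vs = j \<longrightarrow> norm (D j x vs) \<le> K * prod_list (map norm vs)"
          by blast
      qed
    qed
  next
    fix j x and \<epsilon> :: real assume j: "j < Suc k" and x: "x \<in> S" and \<epsilon>: "\<epsilon> > 0"
    show "\<forall>\<^sub>F y in at x within S. \<forall>vs\<in>unit_lists j.
        norm (D j y vs - D j x vs - D (Suc j) x ((y - x) # vs)) \<le> \<epsilon> * norm (y - x)"
    proof (cases j)
      case 0
      then show ?thesis
        using f'[OF x] \<epsilon> by (simp add: has_derivative_within_alt2 E(1)[OF x])
    next
      case (Suc i)
      with j have "i < k" by simp
      from E(3)[OF x this \<epsilon>] show ?thesis
      proof eventually_elim
        case (elim y)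
        show ?case
        proof
          fix vs :: "'a list" assume "vs \<in> unit_lists j"
          then obtain us w where vs: "vs = us @ [w]" "us \<in> unit_lists i" "norm w \<le> 1"
            unfolding Suc by (rule unit_lists_Suc_cases)
          from le[OF bspec[OF elim vs(2)] vs(3)]
          show "norm (D j y vs - D j x vs - D (Suc j) x ((y - x) # vs)) \<le> \<epsilon> * norm (y - x)"
            by (simp add: Suc vs(1) blinfun.diff_left)
        qed
      qed
    qed
  next
    fix x and \<epsilon> :: real assume x: "x \<in> S" and \<epsilon>: "\<epsilon> > 0"
    from E(4)[OF this]
    show "\<forall>\<^sub>F y in at x within S. \<forall>vs\<in>unit_lists (Suc k). norm (D (Suc k) y vs - D (Suc k) x vs) \<le> \<epsilon>"
    proof eventually_elim
      case (elim y)
      show ?case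
      proof
        fix vs :: "'a list" assume "vs \<in> unit_lists (Suc k)"
        then obtain us w where vs: "vs = us @ [w]" "us \<in> unit_lists k" "norm w \<le> 1"
          by (rule unit_lists_Suc_cases)
        from le[OF bspec[OF elim vs(2)] vs(3)]
        show "norm (D (Suc k) y vs - D (Suc k) x vs) \<le> \<epsilon>"
          by (simp add: vs(1) blinfun.diff_left)
      qed
    qed
  qed simp
qed

lemma C_on_Suc:
  fixes f :: "'a::real_normed_vector \<Rightarrow> 'b::real_normed_vector"
  shows "C_on (Suc k) S f \<longleftrightarrow>
    (\<exists>f' :: 'a \<Rightarrow> ('a \<Rightarrow>\<^sub>L 'b).
       (\<forall>x\<in>S. (f has_derivative blinfun_apply (f' x)) (at x within S)) \<and> C_on k S f')"
proof
  assume "\<exists>f' :: 'a \<Rightarrow> ('a \<Rightarrow>\<^sub>L 'b).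
    (\<forall>x\<in>S. (f has_derivative blinfun_apply (f' x)) (at x within S)) \<and> C_on k S f'"
  then show "C_on (Suc k) S f" by (elim exE conjE, intro C_on_SucI) simp_all
qed (rule C_on_SucD)


section \<open>Equivalent norms\<close>

definition equivalent_norm :: "('a::real_normed_vector \<Rightarrow> real) \<Rightarrow> bool" where
  "equivalent_norm N \<longleftrightarrow>
     (\<forall>x. N x = 0 \<longleftrightarrow> x = 0) \<and>
     (\<forall>x y. N (x + y) \<le> N x + N y) \<and>
     (\<forall>c x. N (c *\<^sub>R x) = \<bar>c\<bar> * N x) \<and>
     (\<exists>a>0. \<exists>b>0. \<forall>x. a * norm x \<le> N x \<and> N x \<le> b * norm x)"

definition admits_C_norm :: "enat \<Rightarrow> 'a::real_normed_vector itself \<Rightarrow> bool" where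
  "admits_C_norm k _ \<longleftrightarrow>
     (\<exists>N :: 'a \<Rightarrow> real. equivalent_norm N \<and> C_class_on k (UNIV - {0}) N)"


section \<open>The spaces of bounded functions and of null functions on a set\<close>

text \<open>On a discrete space every function is continuous.  The space of bounded functions on a subset
  \<open>L\<close> (possibly empty) of a type is the closed subspace of functions vanishing off \<open>L\<close>.\<close>

type_synonym 'l bfun = "'l discrete \<Rightarrow>\<^sub>C real"

definition ell_infty :: "'l set \<Rightarrow> 'l bfun set" where
  "ell_infty L = {f. \<forall>t. t \<notin> L \<longrightarrow> apply_bcontfun f (discrete t) = 0}"

definition c_zero :: "'l set \<Rightarrow> 'l bfun set" where
  "c_zero L = {x \<in> ell_infty L. \<forall>\<epsilon>>0. finite {t\<in>L. \<bar>apply_bcontfun x (discrete t)\<bar> \<ge> \<epsilon>}}"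

definition abs_bfun :: "'l bfun \<Rightarrow> 'l bfun" where
  "abs_bfun f = Bcontfun (\<lambda>t. \<bar>apply_bcontfun f t\<bar>)"

lemma apply_abs_bfun [simp]: "apply_bcontfun (abs_bfun f) t = \<bar>apply_bcontfun f t\<bar>"
proof -
  have "(\<lambda>t. \<bar>apply_bcontfun f t\<bar>) \<in> bcontfun"
    by (rule bcontfun_normI[where b = "norm f"])
      (use norm_bounded[of f] in \<open>simp_all add: continuous_on_rabs\<close>)
  then show ?thesis
    by (simp add: abs_bfun_def Bcontfun_inverse)
qed

definition U_set :: "'l set \<Rightarrow> ('l bfun \<times> 'l bfun) set" where
  "U_set L = {(f, x). f \<in> ell_infty L \<and> x \<in> c_zero L \<and>
     norm f < norm (abs_bfun f + (1/2) *\<^sub>R abs_bfun x) \<and>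
     norm x < norm (abs_bfun f + (1/2) *\<^sub>R abs_bfun x)}"

definition linear_homeomorphic_embedding ::
  "('a::real_normed_vector \<Rightarrow> 'b::real_normed_vector) \<Rightarrow> bool" where
  "linear_homeomorphic_embedding S \<longleftrightarrow> linear S \<and> (\<exists>g. homeomorphism UNIV (range S) S g)"


section \<open>The algebraic tensor product\<close>

text \<open>Formal finite sums of elementary tensors, modulo the congruence generated by commutativity of
  addition and the bilinearity relations.\<close>

inductive tensor_eq ::
  "('a::real_vector \<times> 'b::real_vector) list \<Rightarrow> ('a \<times> 'b) list \<Rightarrow> bool" where
  refl: "tensor_eq z z"
| sym: "tensor_eq z w \<Longrightarrow> tensor_eq w z"
| trans: "tensor_eq z w \<Longrightarrow> tensor_eq w v \<Longrightarrow> tensor_eq z v"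
| cong: "tensor_eq z z' \<Longrightarrow> tensor_eq w w' \<Longrightarrow> tensor_eq (z @ w) (z' @ w')"
| comm: "tensor_eq (z @ w) (w @ z)"
| zero: "tensor_eq [(0, e)] []"
| add_left: "tensor_eq [(x + y, e)] [(x, e), (y, e)]"
| add_right: "tensor_eq [(x, e + d)] [(x, e), (x, d)]"
| scale: "tensor_eq [(c *\<^sub>R x, e)] [(x, c *\<^sub>R e)]"

quotient_type (overloaded) ('a, 'b) alg_tensor =
  "('a::real_vector \<times> 'b::real_vector) list" / tensor_eq
  by (intro equivpI reflpI sympI transpI) (blast intro: tensor_eq.intros)+

abbreviation tensor_scale ::
  "real \<Rightarrow> ('a::real_vector \<times> 'b::real_vector) list \<Rightarrow> ('a \<times> 'b) list" where
  "tensor_scale c \<equiv> map (\<lambda>(x, e). (c *\<^sub>R x, e))"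

lemma tensor_eq_scale: "tensor_eq z w \<Longrightarrow> tensor_eq (tensor_scale c z) (tensor_scale c w)"
proof (induction rule: tensor_eq.induct)
  case (scale d x e)
  have "tensor_eq [(d *\<^sub>R (c *\<^sub>R x), e)] [(c *\<^sub>R x, d *\<^sub>R e)]"
    by (rule tensor_eq.scale)
  then show ?case by (simp add: mult.commute)
next
  case (trans z w v)
  then show ?case by (blast intro: tensor_eq.trans)
qed (auto simp: scaleR_add_right intro: tensor_eq.intros)

lemma tensor_eq_zero: "tensor_eq (tensor_scale 0 z) []"
proof (induction z)
  case (Cons p z)
  then show ?case
    using tensor_eq.cong[OF tensor_eq.zero[of "snd p"] Cons.IH] by (cases p) simp
qed (auto intro: tensor_eq.refl)

lemma tensor_eq_scale_add:
  "tensor_eq (tensor_scale (a + b) z) (tensor_scale a z @ tensor_scale b z)"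
proof (induction z)
  case (Cons p z)
  obtain x e where p: "p = (x, e)" by (cases p)
  let ?a = "tensor_scale a z" and ?b = "tensor_scale b z"
  have "tensor_eq ([((a + b) *\<^sub>R x, e)] @ tensor_scale (a + b) z)
      ([(a *\<^sub>R x, e), (b *\<^sub>R x, e)] @ (?a @ ?b))"
    by (intro tensor_eq.cong Cons.IH) (simp add: scaleR_add_left tensor_eq.add_left)
  also have "tensor_eq \<dots> ([(a *\<^sub>R x, e)] @ (?a @ [(b *\<^sub>R x, e)]) @ ?b)"
    using tensor_eq.cong[OF tensor_eq.refl[of "[(a *\<^sub>R x, e)]"]
        tensor_eq.cong[OF tensor_eq.comm[of "[(b *\<^sub>R x, e)]" ?a] tensor_eq.refl[of ?b]]]
    by simp
  finally (tensor_eq.trans) show ?case by (simp add: p)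
qed (auto intro: tensor_eq.refl)

instantiation alg_tensor :: (real_vector, real_vector) real_vector
begin

lift_definition zero_alg_tensor :: "('a, 'b) alg_tensor" is "[]" .

lift_definition plus_alg_tensor ::
  "('a, 'b) alg_tensor \<Rightarrow> ('a, 'b) alg_tensor \<Rightarrow> ('a, 'b) alg_tensor" is "(@)"
  by (rule tensor_eq.cong)

lift_definition scaleR_alg_tensor :: "real \<Rightarrow> ('a, 'b) alg_tensor \<Rightarrow> ('a, 'b) alg_tensor"
  is tensor_scale
  by (rule tensor_eq_scale)

definition "uminus_alg_tensor (z :: ('a, 'b) alg_tensor) = (-1) *\<^sub>R z"

definition "minus_alg_tensor (z :: ('a, 'b) alg_tensor) w = z + (- w)"

instance
proof
  fix z w v :: "('a, 'b) alg_tensor" and a b :: real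
  show "z + w + v = z + (w + v)"
    by transfer (simp add: tensor_eq.refl)
  show "z + w = w + z"
    by transfer (rule tensor_eq.comm)
  show "0 + z = z"
    by transfer (simp add: tensor_eq.refl)
  show add: "(a + b) *\<^sub>R z = a *\<^sub>R z + b *\<^sub>R z" for a b
    by transfer (rule tensor_eq_scale_add)
  show one: "1 *\<^sub>R z = z"
    by transfer (simp add: tensor_eq.refl)
  have "0 *\<^sub>R z = 0"
    by transfer (rule tensor_eq_zero)
  then show "- z + z = 0"
    using add[of "-1" 1] one by (simp add: uminus_alg_tensor_def)
  show "z - w = z + - w"
    by (simp add: minus_alg_tensor_def)
  show "a *\<^sub>R (z + w) = a *\<^sub>R z + a *\<^sub>R w"
    by transfer (simp add: tensor_eq.refl)
  show "a *\<^sub>R b *\<^sub>R z = (a * b) *\<^sub>R z"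
    by transfer (simp add: tensor_eq.refl comp_def split_def)
qed

end

lift_definition tensor :: "'a::real_vector \<Rightarrow> 'b::real_vector \<Rightarrow> ('a, 'b) alg_tensor"
  is "\<lambda>x e. [(x, e)]" .

lemma tensor_add_left: "tensor (x + y) e = tensor x e + tensor y e"
  by transfer (simp add: tensor_eq.add_left)

lemma tensor_add_right: "tensor x (e + d) = tensor x e + tensor x d"
  by transfer (simp add: tensor_eq.add_right)

lemma tensor_scaleR_left: "tensor (c *\<^sub>R x) e = c *\<^sub>R tensor x e"
  by transfer (simp add: tensor_eq.refl)

lemma tensor_scaleR_right: "tensor x (c *\<^sub>R e) = c *\<^sub>R tensor x e"
  by transfer (simp add: tensor_eq.scale tensor_eq.sym)

lemma alg_tensor_induct [case_names zero add]:
  assumes "P 0" and "\<And>x e z. P z \<Longrightarrow> P (tensor x e + z)"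
  shows "P z"
proof -
  have "P (abs_alg_tensor zs)" for zs
  proof (induction zs)
    case Nil
    then show ?case using assms(1) by (simp add: zero_alg_tensor_def)
  next
    case (Cons p zs)
    have "abs_alg_tensor (p # zs) = tensor (fst p) (snd p) + abs_alg_tensor zs"
      by (simp add: tensor.abs_eq plus_alg_tensor.abs_eq)
    then show ?case using assms(2) Cons by simp
  qed
  then show ?thesis
    using Quotient3_abs_rep[OF Quotient3_alg_tensor, of z] by metis
qed


section \<open>The injective tensor norm\<close>

lift_definition tensor_pairing ::
  "('a::real_normed_vector \<Rightarrow>\<^sub>L real) \<Rightarrow> ('b::real_normed_vector \<Rightarrow>\<^sub>L real) \<Rightarrow>
   ('a, 'b) alg_tensor \<Rightarrow> real"
  is "\<lambda>\<xi> \<eta> z. \<Sum>(x, e)\<leftarrow>z. blinfun_apply \<xi> x * blinfun_apply \<eta> e"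
proof -
  fix \<xi> :: "'a \<Rightarrow>\<^sub>L real" and \<eta> :: "'b \<Rightarrow>\<^sub>L real" and z w :: "('a \<times> 'b) list"
  assume "tensor_eq z w"
  then show "(\<Sum>(x, e)\<leftarrow>z. blinfun_apply \<xi> x * blinfun_apply \<eta> e) =
      (\<Sum>(x, e)\<leftarrow>w. blinfun_apply \<xi> x * blinfun_apply \<eta> e)"
    by (induction rule: tensor_eq.induct)
      (auto simp: blinfun.bilinear_simps algebra_simps)
qed

definition injective_norm ::
  "('a::real_normed_vector, 'b::real_normed_vector) alg_tensor \<Rightarrow> real" where
  "injective_norm z = (SUP (\<xi>, \<eta>)\<in>cball 0 1 \<times> cball 0 1. \<bar>tensor_pairing \<xi> \<eta> z\<bar>)"

lemma tensor_pairing_tensor [simp]: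
  "tensor_pairing \<xi> \<eta> (tensor x e) = blinfun_apply \<xi> x * blinfun_apply \<eta> e"
  by (simp add: tensor.abs_eq tensor_pairing.abs_eq)

lemma tensor_pairing_zero [simp]: "tensor_pairing \<xi> \<eta> 0 = 0"
  by (simp add: zero_alg_tensor_def tensor_pairing.abs_eq)

lemma tensor_pairing_add [simp]:
  "tensor_pairing \<xi> \<eta> (z + w) = tensor_pairing \<xi> \<eta> z + tensor_pairing \<xi> \<eta> w"
  by (induct z rule: alg_tensor.abs_induct, induct w rule: alg_tensor.abs_induct)
    (simp add: plus_alg_tensor.abs_eq tensor_pairing.abs_eq)

lemma tensor_pairing_scaleR [simp]:
  "tensor_pairing \<xi> \<eta> (c *\<^sub>R z) = c * tensor_pairing \<xi> \<eta> z"
  by (induction z rule: alg_tensor_induct)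
    (simp_all add: algebra_simps flip: tensor_scaleR_left add: blinfun.bilinear_simps)

lemma tensor_pairing_bounded:
  "\<exists>B. \<forall>\<xi>\<in>cball 0 1. \<forall>\<eta>\<in>cball 0 1. \<bar>tensor_pairing \<xi> \<eta> z\<bar> \<le> B"
proof (induction z rule: alg_tensor_induct)
  case zero
  then show ?case by (intro exI[of _ 0]) simp
next
  case (add x e z)
  then obtain B where B:
    "\<And>\<xi> \<eta>. \<xi> \<in> cball 0 1 \<Longrightarrow> \<eta> \<in> cball 0 1 \<Longrightarrow> \<bar>tensor_pairing \<xi> \<eta> z\<bar> \<le> B"
    by blast
  have "\<bar>tensor_pairing \<xi> \<eta> (tensor x e + z)\<bar> \<le> norm x * norm e + B"
    if "\<xi> \<in> cball 0 1" "\<eta> \<in> cball 0 1" for \<xi> \<eta>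
  proof -
    have "\<bar>blinfun_apply \<xi> x\<bar> \<le> norm x"
      using norm_blinfun[of \<xi> x] mult_right_mono[of "norm \<xi>" 1 "norm x"] that by simp
    moreover have "\<bar>blinfun_apply \<eta> e\<bar> \<le> norm e"
      using norm_blinfun[of \<eta> e] mult_right_mono[of "norm \<eta>" 1 "norm e"] that by simp
    ultimately have "\<bar>blinfun_apply \<xi> x * blinfun_apply \<eta> e\<bar> \<le> norm x * norm e"
      by (simp add: abs_mult mult_mono)
    then show ?thesis using B[OF that] by simp
  qed
  then show ?case by blast
qed

lemma injective_norm_upper:
  assumes "norm \<xi> \<le> 1" "norm \<eta> \<le> 1"
  shows "\<bar>tensor_pairing \<xi> \<eta> z\<bar> \<le> injective_norm z"
proof -
  have "bdd_above ((\<lambda>(\<xi>, \<eta>). \<bar>tensor_pairing \<xi> \<eta> z\<bar>) ` (cball 0 1 \<times> cball 0 1))"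
    using tensor_pairing_bounded[of z] by (auto simp: bdd_above_def)
  from cSUP_upper[OF _ this, of "(\<xi>, \<eta>)"] assms show ?thesis
    by (simp add: injective_norm_def)
qed

lemma injective_norm_least:
  assumes "\<And>\<xi> \<eta>. norm \<xi> \<le> 1 \<Longrightarrow> norm \<eta> \<le> 1 \<Longrightarrow> \<bar>tensor_pairing \<xi> \<eta> z\<bar> \<le> B"
  shows "injective_norm z \<le> B"
  unfolding injective_norm_def by (rule cSUP_least) (use assms in auto)

lemma injective_norm_nonneg [simp]: "0 \<le> injective_norm z"
  using injective_norm_upper[of 0 0 z] by simp

lemma injective_norm_zero [simp]: "injective_norm 0 = 0"
  by (rule order_antisym[OF injective_norm_least]) simp_all

lemma injective_norm_triangle:
  fixes z w :: "('a::real_normed_vector, 'b::real_normed_vector) alg_tensor"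
  shows "injective_norm (z + w) \<le> injective_norm z + injective_norm w"
proof (rule injective_norm_least)
  fix \<xi> :: "'a \<Rightarrow>\<^sub>L real" and \<eta> :: "'b \<Rightarrow>\<^sub>L real"
  assume n: "norm \<xi> \<le> 1" "norm \<eta> \<le> 1"
  show "\<bar>tensor_pairing \<xi> \<eta> (z + w)\<bar> \<le> injective_norm z + injective_norm w"
    using injective_norm_upper[OF n, of z] injective_norm_upper[OF n, of w] by simp
qed

lemma injective_norm_scaleR_le:
  fixes z :: "('a::real_normed_vector, 'b::real_normed_vector) alg_tensor"
  shows "injective_norm (c *\<^sub>R z) \<le> \<bar>c\<bar> * injective_norm z"
proof (rule injective_norm_least)
  fix \<xi> :: "'a \<Rightarrow>\<^sub>L real" and \<eta> :: "'b \<Rightarrow>\<^sub>L real"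
  assume n: "norm \<xi> \<le> 1" "norm \<eta> \<le> 1"
  show "\<bar>tensor_pairing \<xi> \<eta> (c *\<^sub>R z)\<bar> \<le> \<bar>c\<bar> * injective_norm z"
    using injective_norm_upper[OF n, of z] by (simp add: abs_mult mult_left_mono)
qed

lemma injective_norm_scaleR: "injective_norm (c *\<^sub>R z) = \<bar>c\<bar> * injective_norm z"
proof (cases "c = 0")
  case False
  then have "\<bar>c\<bar> * injective_norm z = \<bar>c\<bar> * injective_norm (inverse c *\<^sub>R (c *\<^sub>R z))"
    by simp
  also have "\<dots> \<le> \<bar>c\<bar> * (\<bar>inverse c\<bar> * injective_norm (c *\<^sub>R z))"
    by (intro mult_left_mono injective_norm_scaleR_le) simp
  also have "\<dots> = injective_norm (c *\<^sub>R z)"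
    using False by (simp add: abs_inverse)
  finally show ?thesis using injective_norm_scaleR_le[of c z] by simp
qed simp

lemma injective_norm_minus: "injective_norm (- z) = injective_norm z"
  using injective_norm_scaleR[of "-1" z] by simp

lemma injective_norm_commute: "injective_norm (z - w) = injective_norm (w - z)"
  using injective_norm_minus[of "z - w"] by simp

lemma injective_norm_triangle3:
  "injective_norm (z - w) \<le> injective_norm (z - v) + injective_norm (v - w)"
  using injective_norm_triangle[of "z - v" "v - w"] by simp

lemma injective_norm_diff: "\<bar>injective_norm z - injective_norm w\<bar> \<le> injective_norm (z - w)"
  using injective_norm_triangle[of "z - w" w] injective_norm_triangle[of "w - z" z]
    injective_norm_commute[of z w] by simp


section \<open>The injective tensor product\<close>

text \<open>The completion of the algebraic tensor product for \<open>injective_norm\<close>: Cauchy sequences modulo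
  null sequences.  That \<open>injective_norm\<close> vanishes only at 0 (Hahn-Banach) is not needed for the
  construction.  The completion is described by \<open>linear_of_alg_tensor\<close>, \<open>norm_of_alg_tensor\<close>
  and \<open>dense_of_alg_tensor\<close> below.\<close>

definition inj_Cauchy ::
  "(nat \<Rightarrow> ('a::real_normed_vector, 'b::real_normed_vector) alg_tensor) \<Rightarrow> bool" where
  "inj_Cauchy s \<longleftrightarrow> (\<forall>\<epsilon>>0. \<exists>M. \<forall>m\<ge>M. \<forall>n\<ge>M. injective_norm (s m - s n) < \<epsilon>)"

definition inj_Cauchy_eq ::
  "(nat \<Rightarrow> ('a::real_normed_vector, 'b::real_normed_vector) alg_tensor) \<Rightarrow>
   (nat \<Rightarrow> ('a, 'b) alg_tensor) \<Rightarrow> bool" where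
  "inj_Cauchy_eq s t \<longleftrightarrow>
     inj_Cauchy s \<and> inj_Cauchy t \<and> (\<lambda>n. injective_norm (s n - t n)) \<longlonglongrightarrow> 0"

lemma tendsto_0_le:
  fixes f g :: "nat \<Rightarrow> real"
  assumes "g \<longlonglongrightarrow> 0" "\<And>n. 0 \<le> f n" "\<And>n. f n \<le> g n"
  shows "f \<longlonglongrightarrow> 0"
  using tendsto_sandwich[of "\<lambda>_. 0" f sequentially g 0] assms by auto

lemma inj_Cauchy_const [simp]: "inj_Cauchy (\<lambda>_. z)"
  by (auto simp: inj_Cauchy_def)

lemma inj_Cauchy_dominated:
  assumes "inj_Cauchy s" "inj_Cauchy t"
    and "\<And>m n. injective_norm (r m - r n) \<le>
      B * (injective_norm (s m - s n) + injective_norm (t m - t n))"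
  shows "inj_Cauchy r"
  unfolding inj_Cauchy_def
proof (intro allI impI)
  fix \<epsilon> :: real assume "\<epsilon> > 0"
  define \<delta> where "\<delta> = \<epsilon> / (2 * (\<bar>B\<bar> + 1))"
  have "\<delta> > 0" using \<open>\<epsilon> > 0\<close> by (simp add: \<delta>_def)
  obtain M1 where M1: "\<And>m n. m \<ge> M1 \<Longrightarrow> n \<ge> M1 \<Longrightarrow> injective_norm (s m - s n) < \<delta>"
    using assms(1) \<open>\<delta> > 0\<close> unfolding inj_Cauchy_def by blast
  obtain M2 where M2: "\<And>m n. m \<ge> M2 \<Longrightarrow> n \<ge> M2 \<Longrightarrow> injective_norm (t m - t n) < \<delta>"
    using assms(2) \<open>\<delta> > 0\<close> unfolding inj_Cauchy_def by blast
  have "injective_norm (r m - r n) < \<epsilon>" if "m \<ge> max M1 M2" "n \<ge> max M1 M2" for m n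
  proof -
    let ?h = "injective_norm (s m - s n) + injective_norm (t m - t n)"
    have h: "?h < 2 * \<delta>" using M1[of m n] M2[of m n] that by simp
    have "injective_norm (r m - r n) \<le> B * ?h" by (rule assms(3))
    also have "\<dots> \<le> (\<bar>B\<bar> + 1) * ?h" by (intro mult_right_mono) auto
    also have "\<dots> < (\<bar>B\<bar> + 1) * (2 * \<delta>)" using h by (intro mult_strict_left_mono) auto
    also have "\<dots> = \<epsilon>" by (simp add: \<delta>_def field_simps)
    finally show ?thesis .
  qed
  then show "\<exists>M. \<forall>m\<ge>M. \<forall>n\<ge>M. injective_norm (r m - r n) < \<epsilon>" by blast
qed

lemma inj_Cauchy_add: "inj_Cauchy s \<Longrightarrow> inj_Cauchy t \<Longrightarrow> inj_Cauchy (\<lambda>n. s n + t n)"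
proof (rule inj_Cauchy_dominated[of s t _ 1])
  fix m n
  show "injective_norm (s m + t m - (s n + t n)) \<le>
      1 * (injective_norm (s m - s n) + injective_norm (t m - t n))"
    using injective_norm_triangle[of "s m - s n" "t m - t n"] by (simp add: algebra_simps)
qed

lemma inj_Cauchy_scaleR: "inj_Cauchy s \<Longrightarrow> inj_Cauchy (\<lambda>n. c *\<^sub>R s n)"
  by (rule inj_Cauchy_dominated[of s s _ "\<bar>c\<bar>"])
    (auto simp: injective_norm_scaleR mult_left_mono simp flip: scaleR_diff_right)

lemma inj_Cauchy_norm_convergent:
  assumes "inj_Cauchy s" shows "convergent (\<lambda>n. injective_norm (s n))"
proof -
  have "Cauchy (\<lambda>n. injective_norm (s n))"
    unfolding Cauchy_def dist_real_def
  proof (intro allI impI)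
    fix \<epsilon> :: real assume "\<epsilon> > 0"
    then obtain M where "\<forall>m\<ge>M. \<forall>n\<ge>M. injective_norm (s m - s n) < \<epsilon>"
      using assms unfolding inj_Cauchy_def by blast
    then show "\<exists>M. \<forall>m\<ge>M. \<forall>n\<ge>M. \<bar>injective_norm (s m) - injective_norm (s n)\<bar> < \<epsilon>"
      using injective_norm_diff order_le_less_trans by blast
  qed
  then show ?thesis by (rule Cauchy_convergent)
qed

lemma inj_Cauchy_eq_lim:
  assumes "inj_Cauchy_eq s t"
  shows "lim (\<lambda>n. injective_norm (s n)) = lim (\<lambda>n. injective_norm (t n))"
proof -
  have *: "(\<lambda>n. injective_norm (s n)) \<longlonglongrightarrow> lim (\<lambda>n. injective_norm (s n))"
    "(\<lambda>n. injective_norm (t n)) \<longlonglongrightarrow> lim (\<lambda>n. injective_norm (t n))"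
    using assms inj_Cauchy_norm_convergent by (auto simp: inj_Cauchy_eq_def convergent_LIMSEQ_iff)
  have "(\<lambda>n. \<bar>injective_norm (s n) - injective_norm (t n)\<bar>) \<longlonglongrightarrow> 0"
    by (rule tendsto_0_le[of "\<lambda>n. injective_norm (s n - t n)"])
      (use assms injective_norm_diff in \<open>auto simp: inj_Cauchy_eq_def\<close>)
  then have "(\<lambda>n. injective_norm (s n) - injective_norm (t n)) \<longlonglongrightarrow> 0"
    by (simp add: tendsto_rabs_zero_iff)
  from LIMSEQ_unique[OF tendsto_diff[OF *] this] show ?thesis by simp
qed

quotient_type (overloaded) ('a, 'b) inj_tensor =
  "nat \<Rightarrow> ('a::real_normed_vector, 'b::real_normed_vector) alg_tensor" / partial: inj_Cauchy_eq
proof (rule part_equivpI)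
  show "\<exists>s :: nat \<Rightarrow> ('a, 'b) alg_tensor. inj_Cauchy_eq s s"
    by (intro exI[of _ "\<lambda>_. 0"]) (simp add: inj_Cauchy_eq_def)
  show "symp (inj_Cauchy_eq :: (nat \<Rightarrow> ('a, 'b) alg_tensor) \<Rightarrow> _)"
    by (rule sympI) (simp add: inj_Cauchy_eq_def injective_norm_commute)
  show "transp (inj_Cauchy_eq :: (nat \<Rightarrow> ('a, 'b) alg_tensor) \<Rightarrow> _)"
  proof (rule transpI)
    fix s t r :: "nat \<Rightarrow> ('a, 'b) alg_tensor"
    assume st: "inj_Cauchy_eq s t" and tr: "inj_Cauchy_eq t r"
    have "(\<lambda>n. injective_norm (s n - t n) + injective_norm (t n - r n)) \<longlonglongrightarrow> 0"
      using st tr tendsto_add[of _ 0 sequentially _ 0] by (auto simp: inj_Cauchy_eq_def)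
    then have "(\<lambda>n. injective_norm (s n - r n)) \<longlonglongrightarrow> 0"
      by (rule tendsto_0_le) (auto intro: injective_norm_triangle3)
    then show "inj_Cauchy_eq s r" using st tr by (simp add: inj_Cauchy_eq_def)
  qed
qed

instantiation inj_tensor :: (real_normed_vector, real_normed_vector) real_normed_vector
begin

lift_definition zero_inj_tensor :: "('a, 'b) inj_tensor" is "\<lambda>_. 0"
  by (simp add: inj_Cauchy_eq_def)

lift_definition plus_inj_tensor ::
  "('a, 'b) inj_tensor \<Rightarrow> ('a, 'b) inj_tensor \<Rightarrow> ('a, 'b) inj_tensor"
  is "\<lambda>s t n. s n + t n"
proof -
  fix s s' t t' :: "nat \<Rightarrow> ('a, 'b) alg_tensor"
  assume s: "inj_Cauchy_eq s s'" and t: "inj_Cauchy_eq t t'"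
  have le: "injective_norm (s n + t n - (s' n + t' n)) \<le>
      injective_norm (s n - s' n) + injective_norm (t n - t' n)" for n
    using injective_norm_triangle[of "s n - s' n" "t n - t' n"] by (simp add: algebra_simps)
  have "(\<lambda>n. injective_norm (s n - s' n) + injective_norm (t n - t' n)) \<longlonglongrightarrow> 0"
    using s t tendsto_add[of _ 0 sequentially _ 0] by (auto simp: inj_Cauchy_eq_def)
  then have "(\<lambda>n. injective_norm (s n + t n - (s' n + t' n))) \<longlonglongrightarrow> 0"
    by (rule tendsto_0_le) (use le in auto)
  then show "inj_Cauchy_eq (\<lambda>n. s n + t n) (\<lambda>n. s' n + t' n)"
    using s t by (simp add: inj_Cauchy_eq_def inj_Cauchy_add)
qed

lift_definition scaleR_inj_tensor :: "real \<Rightarrow> ('a, 'b) inj_tensor \<Rightarrow> ('a, 'b) inj_tensor"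
  is "\<lambda>c s n. c *\<^sub>R s n"
  by (auto simp: inj_Cauchy_eq_def inj_Cauchy_scaleR injective_norm_scaleR
      simp flip: scaleR_diff_right intro!: tendsto_mult_right_zero)

lift_definition norm_inj_tensor :: "('a, 'b) inj_tensor \<Rightarrow> real"
  is "\<lambda>s. lim (\<lambda>n. injective_norm (s n))"
  by (rule inj_Cauchy_eq_lim)

definition "uminus_inj_tensor (z :: ('a, 'b) inj_tensor) = (-1) *\<^sub>R z"

definition "minus_inj_tensor (z :: ('a, 'b) inj_tensor) w = z + (- w)"

definition "dist_inj_tensor (z :: ('a, 'b) inj_tensor) w = norm (z - w)"

definition "sgn_inj_tensor (z :: ('a, 'b) inj_tensor) = inverse (norm z) *\<^sub>R z"

definition "(uniformity :: (('a, 'b) inj_tensor \<times> ('a, 'b) inj_tensor) filter) =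
  (INF \<epsilon>\<in>{0<..}. principal {(z, w). dist z w < \<epsilon>})"

definition "open_inj_tensor (A :: ('a, 'b) inj_tensor set) \<longleftrightarrow>
  (\<forall>z\<in>A. \<forall>\<^sub>F (z', w) in uniformity. z' = z \<longrightarrow> w \<in> A)"

instance
proof
  fix z w v :: "('a, 'b) inj_tensor" and a b :: real and A :: "('a, 'b) inj_tensor set"
  show "z + w + v = z + (w + v)"
    by transfer (simp add: inj_Cauchy_eq_def inj_Cauchy_add add.assoc)
  show "z + w = w + z"
    by transfer (simp add: inj_Cauchy_eq_def inj_Cauchy_add add.commute)
  show "0 + z = z"
    by transfer (simp add: inj_Cauchy_eq_def)
  show "- z + z = 0"
    unfolding uminus_inj_tensor_def by transfer (simp add: inj_Cauchy_eq_def)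
  show "z - w = z + - w"
    by (simp add: minus_inj_tensor_def)
  show "a *\<^sub>R (z + w) = a *\<^sub>R z + a *\<^sub>R w"
    by transfer (simp add: inj_Cauchy_eq_def inj_Cauchy_add inj_Cauchy_scaleR scaleR_add_right)
  show "(a + b) *\<^sub>R z = a *\<^sub>R z + b *\<^sub>R z"
    by transfer (simp add: inj_Cauchy_eq_def inj_Cauchy_add inj_Cauchy_scaleR scaleR_add_left)
  show "a *\<^sub>R b *\<^sub>R z = (a * b) *\<^sub>R z"
    by transfer (simp add: inj_Cauchy_eq_def inj_Cauchy_scaleR)
  show "1 *\<^sub>R z = z"
    by transfer (simp add: inj_Cauchy_eq_def)
  show "dist z w = norm (z - w)"
    by (simp add: dist_inj_tensor_def)
  show "sgn z = inverse (norm z) *\<^sub>R z"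
    by (simp add: sgn_inj_tensor_def)
  show "(uniformity :: (('a, 'b) inj_tensor \<times> ('a, 'b) inj_tensor) filter) =
      (INF \<epsilon>\<in>{0<..}. principal {(z, w). dist z w < \<epsilon>})"
    by (rule uniformity_inj_tensor_def)
  show "open A \<longleftrightarrow> (\<forall>z\<in>A. \<forall>\<^sub>F (z', w) in uniformity. z' = z \<longrightarrow> w \<in> A)"
    by (rule open_inj_tensor_def)
  have lim: "(\<lambda>n. injective_norm (s n)) \<longlonglongrightarrow> lim (\<lambda>n. injective_norm (s n))"
    if "inj_Cauchy s" for s :: "nat \<Rightarrow> ('a, 'b) alg_tensor"
    using inj_Cauchy_norm_convergent[OF that] by (simp add: convergent_LIMSEQ_iff)
  show "norm z = 0 \<longleftrightarrow> z = 0"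
  proof transfer
    fix s :: "nat \<Rightarrow> ('a, 'b) alg_tensor"
    assume "inj_Cauchy_eq s s"
    then have s: "inj_Cauchy s" by (simp add: inj_Cauchy_eq_def)
    show "lim (\<lambda>n. injective_norm (s n)) = 0 \<longleftrightarrow> inj_Cauchy_eq s (\<lambda>_. 0)"
    proof
      assume "lim (\<lambda>n. injective_norm (s n)) = 0"
      with lim[OF s] have "(\<lambda>n. injective_norm (s n)) \<longlonglongrightarrow> 0" by metis
      with s show "inj_Cauchy_eq s (\<lambda>_. 0)" by (simp add: inj_Cauchy_eq_def)
    next
      assume "inj_Cauchy_eq s (\<lambda>_. 0)"
      then show "lim (\<lambda>n. injective_norm (s n)) = 0"
        by (intro limI) (simp add: inj_Cauchy_eq_def)
    qed
  qed
  show "norm (z + w) \<le> norm z + norm w"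
  proof transfer
    fix s t :: "nat \<Rightarrow> ('a, 'b) alg_tensor"
    assume "inj_Cauchy_eq s s" "inj_Cauchy_eq t t"
    then have st: "inj_Cauchy s" "inj_Cauchy t" by (simp_all add: inj_Cauchy_eq_def)
    show "lim (\<lambda>n. injective_norm (s n + t n)) \<le>
        lim (\<lambda>n. injective_norm (s n)) + lim (\<lambda>n. injective_norm (t n))"
      by (rule LIMSEQ_le[OF lim[OF inj_Cauchy_add[OF st]] tendsto_add[OF lim[OF st(1)] lim[OF st(2)]]])
        (auto intro: injective_norm_triangle)
  qed
  show "norm (a *\<^sub>R z) = \<bar>a\<bar> * norm z"
  proof transfer
    fix a :: real and s :: "nat \<Rightarrow> ('a, 'b) alg_tensor"
    assume "inj_Cauchy_eq s s"
    then have s: "inj_Cauchy s" by (simp add: inj_Cauchy_eq_def)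
    show "lim (\<lambda>n. injective_norm (a *\<^sub>R s n)) = \<bar>a\<bar> * lim (\<lambda>n. injective_norm (s n))"
      unfolding injective_norm_scaleR by (rule limI) (intro tendsto_intros lim[OF s])
  qed
qed

end

definition of_alg_tensor ::
  "('a::real_normed_vector, 'b::real_normed_vector) alg_tensor \<Rightarrow> ('a, 'b) inj_tensor" where
  "of_alg_tensor z = abs_inj_tensor (\<lambda>_. z)"

lemma inj_Cauchy_eq_refl [simp]: "inj_Cauchy_eq s s \<longleftrightarrow> inj_Cauchy s"
  by (simp add: inj_Cauchy_eq_def)

lemma norm_abs_inj_tensor:
  "inj_Cauchy s \<Longrightarrow> norm (abs_inj_tensor s) = lim (\<lambda>n. injective_norm (s n))"
  by (simp add: norm_inj_tensor.abs_eq)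

lemma linear_of_alg_tensor: "linear of_alg_tensor"
  by (rule linearI) (simp_all add: of_alg_tensor_def plus_inj_tensor.abs_eq scaleR_inj_tensor.abs_eq)

lemma norm_of_alg_tensor: "norm (of_alg_tensor z) = injective_norm z"
  by (simp add: of_alg_tensor_def norm_abs_inj_tensor limI)

lemma norm_abs_inj_tensor_diff:
  assumes "inj_Cauchy s"
  shows "(\<lambda>n. injective_norm (s n - v)) \<longlonglongrightarrow> norm (abs_inj_tensor s - of_alg_tensor v)"
proof -
  have eq: "abs_inj_tensor s - of_alg_tensor v = abs_inj_tensor (\<lambda>n. s n - v)"
  proof -
    have "abs_inj_tensor s + of_alg_tensor (- v) = abs_inj_tensor (\<lambda>n. s n - v)"
      using assms by (simp add: of_alg_tensor_def plus_inj_tensor.abs_eq)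
    then show ?thesis by (simp add: linear_neg[OF linear_of_alg_tensor])
  qed
  have "inj_Cauchy (\<lambda>n. s n - v)"
    using inj_Cauchy_add[OF assms inj_Cauchy_const, of "- v"] by simp
  from inj_Cauchy_norm_convergent[OF this] norm_abs_inj_tensor[OF this] show ?thesis
    by (simp add: eq convergent_LIMSEQ_iff)
qed

lemma of_alg_tensor_tendsto:
  assumes "inj_Cauchy s" shows "(\<lambda>n. of_alg_tensor (s n)) \<longlonglongrightarrow> abs_inj_tensor s"
proof (rule LIMSEQ_I)
  fix \<epsilon> :: real assume "\<epsilon> > 0"
  then obtain M where M: "\<And>m n. m \<ge> M \<Longrightarrow> n \<ge> M \<Longrightarrow> injective_norm (s m - s n) < \<epsilon> / 2"
    using assms unfolding inj_Cauchy_def by (metis half_gt_zero)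
  have "norm (of_alg_tensor (s k) - abs_inj_tensor s) < \<epsilon>" if "k \<ge> M" for k
  proof -
    have "norm (abs_inj_tensor s - of_alg_tensor (s k)) \<le> \<epsilon> / 2"
      by (rule LIMSEQ_le_const2[OF norm_abs_inj_tensor_diff[OF assms]])
        (use M that in \<open>auto intro!: exI[of _ M] less_imp_le\<close>)
    then show ?thesis using \<open>\<epsilon> > 0\<close> by (simp add: norm_minus_commute)
  qed
  then show "\<exists>no. \<forall>n\<ge>no. norm (of_alg_tensor (s n) - abs_inj_tensor s) < \<epsilon>" by blast
qed

lemma abs_inj_tensor_cases:
  obtains s where "inj_Cauchy s" "z = abs_inj_tensor s"
proof
  show "inj_Cauchy (rep_inj_tensor z)"
    using Quotient3_rep_reflp[OF Quotient3_inj_tensor, of z] by simp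
  show "z = abs_inj_tensor (rep_inj_tensor z)"
    by (rule Quotient3_abs_rep[OF Quotient3_inj_tensor, symmetric])
qed

lemma of_alg_tensor_approx:
  assumes "\<epsilon> > 0" shows "\<exists>v. norm (z - of_alg_tensor v) < \<epsilon>"
proof -
  obtain s where s: "inj_Cauchy s" "z = abs_inj_tensor s"
    by (rule abs_inj_tensor_cases)
  obtain n where "norm (of_alg_tensor (s n) - abs_inj_tensor s) < \<epsilon>"
    using LIMSEQ_D[OF of_alg_tensor_tendsto[OF s(1)] assms] by blast
  then show ?thesis using s(2) by (auto simp: norm_minus_commute)
qed

lemma dense_of_alg_tensor: "closure (range of_alg_tensor) = UNIV"
  using of_alg_tensor_approx
  by (auto simp: closure_approachable dist_norm norm_minus_commute)

instance inj_tensor :: (real_normed_vector, real_normed_vector) banach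
proof
  fix X :: "nat \<Rightarrow> ('a, 'b) inj_tensor"
  assume X: "Cauchy X"
  have "\<exists>v. norm (X n - of_alg_tensor v) < inverse (real (Suc n))" for n
    by (rule of_alg_tensor_approx) simp
  then obtain s where s: "\<And>n. norm (X n - of_alg_tensor (s n)) < inverse (real (Suc n))"
    by metis
  have "(\<lambda>n. X n - of_alg_tensor (s n)) \<longlonglongrightarrow> 0"
    by (rule Lim_null_comparison[OF _ LIMSEQ_inverse_real_of_nat])
      (use s in \<open>auto intro: always_eventually less_imp_le\<close>)
  then have diff: "(\<lambda>n. of_alg_tensor (s n) - X n) \<longlonglongrightarrow> 0"
    using tendsto_minus by fastforce
  have "inj_Cauchy s"
    unfolding inj_Cauchy_def
  proof (intro allI impI)
    fix \<epsilon> :: real assume "\<epsilon> > 0"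
    then have \<epsilon>: "\<epsilon> / 3 > 0" by simp
    obtain M1 where M1: "\<And>m n. m \<ge> M1 \<Longrightarrow> n \<ge> M1 \<Longrightarrow> norm (X m - X n) < \<epsilon> / 3"
      using CauchyD[OF X \<epsilon>] by blast
    obtain M2 where M2: "\<And>n. n \<ge> M2 \<Longrightarrow> norm (of_alg_tensor (s n) - X n) < \<epsilon> / 3"
      using LIMSEQ_D[OF diff \<epsilon>] by auto
    have "injective_norm (s m - s n) < \<epsilon>" if "m \<ge> max M1 M2" "n \<ge> max M1 M2" for m n
    proof -
      have "of_alg_tensor (s m - s n) =
          (of_alg_tensor (s m) - X m) + (X m - X n) - (of_alg_tensor (s n) - X n)"
        by (simp add: linear_diff[OF linear_of_alg_tensor])
      also have "norm \<dots> \<le>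
          norm (of_alg_tensor (s m) - X m) + norm (X m - X n) + norm (of_alg_tensor (s n) - X n)"
        by (rule order_trans[OF norm_triangle_ineq4 add_right_mono[OF norm_triangle_ineq]])
      also have "\<dots> < \<epsilon>" using M1[of m n] M2[of m] M2[of n] that by simp
      finally show ?thesis by (simp add: norm_of_alg_tensor)
    qed
    then show "\<exists>M. \<forall>m\<ge>M. \<forall>n\<ge>M. injective_norm (s m - s n) < \<epsilon>" by blast
  qed
  from tendsto_diff[OF of_alg_tensor_tendsto[OF this] diff] show "convergent X"
    by (auto simp: convergent_def)
qed

end

theory Submission
  imports Defs
begin

text \<open>Both assertions reduce to one renorming statement about two families of seminorms
\<open>A\<^sub>t\<close>, \<open>B\<^sub>t\<close> on a Banach space \<open>W\<close>: on \<open>X\<close> they are \<open>|S x t|\<close> and \<open>|T x t|\<close>, and on the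
tensor product they are \<open>N ((\<sigma>\<^sub>t \<otimes> id) w)\<close> and \<open>N ((\<tau>\<^sub>t \<otimes> id) w)\<close>, where \<open>N\<close> is the given norm of
\<open>E\<close> and \<open>\<sigma>\<^sub>t\<close>, \<open>\<tau>\<^sub>t\<close> are the coordinate functionals of \<open>S\<close> and \<open>T\<close>.  What is used about them
(locale \<open>seminorm_pair\<close>): they are bounded by a common multiple of the norm, the \<open>A\<^sub>t\<close> together dominate
the norm, \<open>B\<^sub>t w\<close> tends to 0 along \<open>t\<close>, and for \<open>w \<noteq> 0\<close> some \<open>A\<^sub>t w + B\<^sub>t w / 2\<close>
exceeds all \<open>A\<^sub>j w\<close> and all \<open>B\<^sub>j w\<close> by a fixed amount.

\<^bold>\<open>The norm.\<close>  Let \<open>P\<close> be the perspective \<open>P(l, \<mu>) = \<mu> G(l / \<mu>)\<close> of the convex smooth function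
\<open>G\<close> with \<open>G(z) = z\<^sup>2 exp(- 1 / z)\<close> for \<open>z > 0\<close> and \<open>G(z) = 0\<close> for \<open>z \<le> 0\<close>, and put

  \<open>\<Psi>(w, \<tau>) = (\<Sum>t. P(3 A\<^sub>t w + 2 B\<^sub>t w - 3 \<tau>, \<tau> - A\<^sub>t w - B\<^sub>t w / 2))\<close>.

\<open>\<Psi>\<close> is subadditive and positively homogeneous in \<open>(w, \<tau>)\<close> and nonincreasing in \<open>\<tau>\<close>, so the solution
\<open>\<tau> = \<nu>(w)\<close> of \<open>\<Psi>(w, \<tau>) = \<tau>\<close> is a norm.  The two linear forms are
chosen for the following reasons.  The second one makes the summand explode when \<open>\<tau>\<close> decreases to
\<open>max (A\<^sub>t w + B\<^sub>t w / 2)\<close>: the maximum is attained at an index with \<open>B\<^sub>t w > 0\<close>, where the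
first form stays positive.  Hence a solution \<open>\<tau>\<close> exists and is larger than this maximum.  The first form
is positive only if \<open>B\<^sub>t w / 2 > 3/4 (\<tau> - A\<^sub>t w)\<close>.  As \<open>\<tau> - A\<^sub>t w\<close> is bounded away from 0, this
concerns finitely many \<open>t\<close>, the same ones near a given point.  And it excludes \<open>A\<^sub>t w = 0\<close> and
\<open>B\<^sub>t w = 0\<close>, since \<open>B\<^sub>t w < \<tau>\<close> and \<open>A\<^sub>t w < \<tau>\<close>; so only points enter where the
seminorms are as smooth as the norm of \<open>E\<close>.  Since \<open>\<Psi>(w, \<tau>) - \<tau>\<close> has slope at most \<open>-1\<close> in \<open>\<tau>\<close>, the
implicit function theorem gives the smoothness of \<open>\<nu>\<close>
(\<open>barrier_root\<close>, \<open>equi_C_barrier\<close>, \<open>equi_C_implicit\<close>, \<open>C_on_smooth_norm\<close>).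

\<^bold>\<open>The tensor product.\<close>  A differentiable norm \<open>N\<close> is attained at \<open>e\<close> by its derivative there, so
\<open>N((\<sigma>\<^sub>t \<otimes> id) w)\<close> is the maximum of \<open>|S(w\<^sub>\<eta>) t|\<close> over the functionals \<open>\<eta>\<close> with \<open>|\<eta>| \<le> N\<close>, where
\<open>w\<^sub>\<eta> = (id \<otimes> \<eta>) w\<close> lies in \<open>X\<close>.  The set of all \<open>w\<^sub>\<eta>\<close> is relatively compact.  The required gap for \<open>w\<close> therefore
follows from \<open>(S u, T u) \<in> U(L)\<close> for a point \<open>u\<close> of its closure at which \<open>\<parallel>S u\<parallel>\<close> is maximal, and
similarly for \<open>T\<close> (\<open>compact_closure_left_ops\<close>, \<open>slice_norm_maximiser\<close>, \<open>slice_norm_gap\<close>).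

\<^bold>\<open>The calculus.\<close>  Derivatives of order \<open>k\<close> live in spaces that change with \<open>k\<close>, which prevents an
induction on \<open>k\<close> over a fixed type.  A function and all its directional derivatives in unit directions
are instead viewed as a set of real functions on \<open>W\<close>, and \<open>C\<^sup>k\<close> is required uniformly over such a set
(\<open>equi_C\<close>).  The product, chain and implicit function rules are then inductions on \<open>k\<close> at one type, and
\<open>equi_C_if_C_on\<close> and \<open>C_on_if_equi_C\<close> translate to and from \<open>C_on\<close>.\<close>

section \<open>Uniformly differentiable sets of functions\<close>

definition equi_bounded :: "'a set \<Rightarrow> ('a \<Rightarrow> real) set \<Rightarrow> bool" where
  "equi_bounded S F \<longleftrightarrow> (\<forall>x\<in>S. \<exists>B. \<forall>f\<in>F. \<bar>f x\<bar> \<le> B)"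

definition equi_continuous :: "'a::real_normed_vector set \<Rightarrow> ('a \<Rightarrow> real) set \<Rightarrow> bool" where
  "equi_continuous S F \<longleftrightarrow>
     (\<forall>x\<in>S. \<forall>\<epsilon>>0. \<forall>\<^sub>F y in at x within S. \<forall>f\<in>F. \<bar>f y - f x\<bar> \<le> \<epsilon>)"

definition equi_derivative ::
  "'a::real_normed_vector set \<Rightarrow> ('a \<Rightarrow> real) set \<Rightarrow> (('a \<Rightarrow> real) \<Rightarrow> 'a \<Rightarrow> 'a \<Rightarrow> real) \<Rightarrow> bool" where
  "equi_derivative S F d \<longleftrightarrow>
     (\<forall>f\<in>F. \<forall>x\<in>S. linear (d f x)) \<and>
     (\<forall>x\<in>S. \<forall>\<epsilon>>0. \<forall>\<^sub>F y in at x within S. \<forall>f\<in>F.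
        \<bar>f y - f x - d f x (y - x)\<bar> \<le> \<epsilon> * norm (y - x))"

definition partials ::
  "(('a \<Rightarrow> real) \<Rightarrow> 'a \<Rightarrow> 'a::real_normed_vector \<Rightarrow> real) \<Rightarrow> ('a \<Rightarrow> real) set \<Rightarrow> ('a \<Rightarrow> real) set" where
  "partials d F = {\<lambda>x. d f x v | f v. f \<in> F \<and> norm v \<le> 1}"

text \<open>Uniformity over \<open>F\<close> at each step replaces operator norms: the directional derivatives in all unit directions
form again a set of real functions, so the type of \<open>F\<close> does not grow with \<open>k\<close>.  The
derivative \<open>d\<close> is existentially quantified because it is unique only on open sets; this lets the
closure properties below be proved by exhibiting a convenient \<open>d\<close>.\<close>

primrec equi_C :: "nat \<Rightarrow> 'a::real_normed_vector set \<Rightarrow> ('a \<Rightarrow> real) set \<Rightarrow> bool" where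
  "equi_C 0 S F \<longleftrightarrow> equi_bounded S F \<and> equi_continuous S F"
| "equi_C (Suc k) S F \<longleftrightarrow> equi_bounded S F \<and>
     (\<exists>d. equi_derivative S F d \<and> equi_C k S (partials d F))"

lemma partialsI: "f \<in> F \<Longrightarrow> norm v \<le> 1 \<Longrightarrow> (\<lambda>x. d f x v) \<in> partials d F"
  by (auto simp: partials_def)

lemma partialsE:
  assumes "p \<in> partials d F"
  obtains f v where "f \<in> F" "norm v \<le> 1" "p = (\<lambda>x. d f x v)"
  using assms by (auto simp: partials_def)

lemma equi_continuousD:
  "equi_continuous S F \<Longrightarrow> x \<in> S \<Longrightarrow> \<epsilon> > 0 \<Longrightarrow>
    \<forall>\<^sub>F y in at x within S. \<forall>f\<in>F. \<bar>f y - f x\<bar> \<le> \<epsilon>"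
  by (simp add: equi_continuous_def)

lemma equi_derivativeD:
  assumes "equi_derivative S F d" "x \<in> S"
  shows "f \<in> F \<Longrightarrow> linear (d f x)"
    and "\<epsilon> > 0 \<Longrightarrow> \<forall>\<^sub>F y in at x within S. \<forall>f\<in>F. \<bar>f y - f x - d f x (y - x)\<bar> \<le> \<epsilon> * norm (y - x)"
  using assms by (auto simp: equi_derivative_def)

lemma equi_C_imp_bounded: "equi_C k S F \<Longrightarrow> equi_bounded S F"
  by (cases k) auto

lemma eventually_norm_diff_less:
  fixes x :: "'a::real_normed_vector"
  assumes "r > 0" shows "\<forall>\<^sub>F y in at x within S. norm (y - x) < r"
  unfolding eventually_at using assms by (auto simp: dist_norm)

text \<open>Boundedness over unit directions is boundedness of the operators \<open>d f x\<close>, uniformly in \<open>f\<close>; this is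
why \<open>equi_C\<close> demands linearity of \<open>d f x\<close> only.\<close>

lemma equi_derivative_bound:
  assumes d: "equi_derivative S F d" and b: "equi_bounded S (partials d F)" and x: "x \<in> S"
  obtains B where "B \<ge> 0" "\<And>f v. f \<in> F \<Longrightarrow> \<bar>d f x v\<bar> \<le> B * norm v"
proof -
  obtain B where B: "\<And>p. p \<in> partials d F \<Longrightarrow> \<bar>p x\<bar> \<le> B"
    using b x unfolding equi_bounded_def by blast
  show thesis
  proof
    show "max B 0 \<ge> 0" by simp
    fix f v assume f: "f \<in> F"
    note lin = equi_derivativeD(1)[OF d x f]
    show "\<bar>d f x v\<bar> \<le> max B 0 * norm v"
    proof (cases "v = 0")
      case True
      then show ?thesis by (simp add: linear_0[OF lin])
    next
      case False
      have "d f x v = norm v * d f x (v /\<^sub>R norm v)"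
        using linear_scale[OF lin, of "norm v" "v /\<^sub>R norm v"] False by simp
      moreover have "\<bar>d f x (v /\<^sub>R norm v)\<bar> \<le> B"
        using B[OF partialsI[OF f, of "v /\<^sub>R norm v" d]] False by simp
      ultimately show ?thesis
        by (simp add: abs_mult mult.commute[of "norm v"] mult_right_mono)
    qed
  qed
qed

lemma equi_derivative_imp_continuous:
  assumes d: "equi_derivative S F d" and b: "equi_bounded S (partials d F)"
  shows "equi_continuous S F"
  unfolding equi_continuous_def
proof (intro ballI allI impI)
  fix x :: 'a and \<epsilon> :: real assume x: "x \<in> S" and \<epsilon>: "\<epsilon> > 0"
  obtain B where B: "B \<ge> 0" "\<And>f v. f \<in> F \<Longrightarrow> \<bar>d f x v\<bar> \<le> B * norm v"
    using equi_derivative_bound[OF d b x] by blast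
  have "\<epsilon> / (B + 1) > 0" using \<epsilon> B(1) by simp
  from equi_derivativeD(2)[OF d x zero_less_one] eventually_norm_diff_less[OF this]
  show "\<forall>\<^sub>F y in at x within S. \<forall>f\<in>F. \<bar>f y - f x\<bar> \<le> \<epsilon>"
  proof eventually_elim
    case (elim y)
    show ?case
    proof
      fix f assume f: "f \<in> F"
      have "\<bar>f y - f x - d f x (y - x)\<bar> \<le> norm (y - x)" using elim f by simp
      with B(2)[OF f, of "y - x"] have "\<bar>f y - f x\<bar> \<le> (B + 1) * norm (y - x)"
        by (simp add: algebra_simps)
      also have "\<dots> \<le> (B + 1) * (\<epsilon> / (B + 1))"
        using elim(2) B(1) by (intro mult_left_mono) auto
      also have "\<dots> = \<epsilon>" using B(1) by simp
      finally show "\<bar>f y - f x\<bar> \<le> \<epsilon>" .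
    qed
  qed
qed

lemma equi_C_imp_continuous: "equi_C k S F \<Longrightarrow> equi_continuous S F"
  by (cases k) (auto intro: equi_derivative_imp_continuous equi_C_imp_bounded)

lemma equi_C_0I: "equi_C k S F \<Longrightarrow> equi_C 0 S F"
  by (simp add: equi_C_imp_bounded equi_C_imp_continuous)

lemma equi_C_Suc_imp: "equi_C (Suc k) S F \<Longrightarrow> equi_C k S F"
proof (induction k arbitrary: F)
  case 0
  then show ?case by (rule equi_C_0I)
next
  case (Suc k)
  then show ?case using equi_C.simps(2) by blast
qed

lemma equi_C_le: "equi_C n S F \<Longrightarrow> k \<le> n \<Longrightarrow> equi_C k S F"
  by (induction n) (auto simp: le_Suc_eq dest: equi_C_Suc_imp simp del: equi_C.simps)

text \<open>Covers subsets as well as changes of the functions off \<open>S\<close>.\<close>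

lemma equi_C_cong:
  assumes "equi_C k S F" "\<And>g. g \<in> G \<Longrightarrow> \<exists>f\<in>F. \<forall>x\<in>S. f x = g x"
  shows "equi_C k S G"
proof -
  obtain p where p: "\<And>g. g \<in> G \<Longrightarrow> p g \<in> F" "\<And>g x. g \<in> G \<Longrightarrow> x \<in> S \<Longrightarrow> p g x = g x"
    using assms(2) by metis
  have b: "equi_bounded S G" if "equi_bounded S F"
    using that p unfolding equi_bounded_def by metis
  have bmono: "equi_bounded S H' \<Longrightarrow> H \<subseteq> H' \<Longrightarrow> equi_bounded S H" for H H'
    unfolding equi_bounded_def by blast
  have mono: "equi_C k S H' \<Longrightarrow> H \<subseteq> H' \<Longrightarrow> equi_C k S H" for k H H'
  proof (induction k arbitrary: H H')
    case 0
    then have "equi_continuous S H"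
      unfolding equi_C.simps equi_continuous_def
      by (blast intro: eventually_mono[where Q = "\<lambda>y. \<forall>f\<in>H. \<bar>f y - f x\<bar> \<le> \<epsilon>" for x \<epsilon>])
    then show ?case using 0 by (auto intro: bmono)
  next
    case (Suc k)
    then obtain d where d: "equi_derivative S H' d" "equi_C k S (partials d H')" by auto
    have "equi_derivative S H d"
      using d(1) Suc.prems(2) unfolding equi_derivative_def
      by (blast intro: eventually_mono[where
            Q = "\<lambda>y. \<forall>f\<in>H. \<bar>f y - f x - d f x (y - x)\<bar> \<le> \<epsilon> * norm (y - x)" for x \<epsilon>])
    moreover have "partials d H \<subseteq> partials d H'" using Suc.prems(2) by (auto simp: partials_def)
    moreover have "equi_bounded S H" using Suc.prems bmono by auto
    ultimately show ?case using Suc.IH[OF d(2)] by auto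
  qed
  show ?thesis
  proof (cases k)
    case 0
    have "equi_continuous S G"
      unfolding equi_continuous_def
    proof (intro ballI allI impI)
      fix x :: 'a and \<epsilon> :: real assume x: "x \<in> S" and \<epsilon>: "\<epsilon> > 0"
      have "\<forall>\<^sub>F y in at x within S. \<forall>f\<in>F. \<bar>f y - f x\<bar> \<le> \<epsilon>"
        using assms(1) 0 x \<epsilon> by (simp add: equi_continuous_def)
      with eventually_at_within_self[of S x]
      show "\<forall>\<^sub>F y in at x within S. \<forall>f\<in>G. \<bar>f y - f x\<bar> \<le> \<epsilon>"
        by eventually_elim (metis p x)
    qed
    then show ?thesis using 0 assms(1) b by simp
  next
    case (Suc k')
    then obtain d where d: "equi_derivative S F d" "equi_C k' S (partials d F)"
      using assms(1) by auto
    have "equi_derivative S G (\<lambda>g. d (p g))"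
      unfolding equi_derivative_def
    proof (intro conjI ballI allI impI)
      show "linear (d (p f) x)" if "f \<in> G" "x \<in> S" for f x
        using equi_derivativeD(1)[OF d(1)] p that by blast
      fix x :: 'a and \<epsilon> :: real assume x: "x \<in> S" and \<epsilon>: "\<epsilon> > 0"
      from eventually_at_within_self[of S x] equi_derivativeD(2)[OF d(1) x \<epsilon>]
      show "\<forall>\<^sub>F y in at x within S. \<forall>f\<in>G. \<bar>f y - f x - d (p f) x (y - x)\<bar> \<le> \<epsilon> * norm (y - x)"
        by eventually_elim (metis p x)
    qed
    moreover have "partials (\<lambda>g. d (p g)) G \<subseteq> partials d F"
      using p(1) by (auto simp: partials_def)
    ultimately show ?thesis using Suc mono[OF d(2)] b assms(1) by auto
  qed
qed

lemma equi_C_subset: "equi_C k S F \<Longrightarrow> G \<subseteq> F \<Longrightarrow> equi_C k S G"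
  by (rule equi_C_cong) auto

lemma equi_C_on_subset: "equi_C k S F \<Longrightarrow> T \<subseteq> S \<Longrightarrow> equi_C k T F"
proof (induction k arbitrary: F)
  case 0
  then have "equi_continuous T F"
    unfolding equi_C.simps equi_continuous_def by (blast intro: filter_leD[OF at_le])
  then show ?case using 0 by (auto simp: equi_bounded_def)
next
  case (Suc k)
  then obtain d where d: "equi_derivative S F d" "equi_C k S (partials d F)" by auto
  have "equi_derivative T F d"
    using d(1) Suc.prems(2) unfolding equi_derivative_def by (blast intro: filter_leD[OF at_le])
  then show ?case using Suc.IH[OF d(2) Suc.prems(2)] Suc.prems
    by (auto simp: equi_bounded_def)
qed

lemma equi_C_constants: "equi_C k S {\<lambda>x. c | c. \<bar>c\<bar> \<le> R}"
proof (induction k arbitrary: R)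
  case 0
  have "equi_continuous S {\<lambda>x. c | c. \<bar>c\<bar> \<le> R}"
    unfolding equi_continuous_def by (intro ballI allI impI always_eventually) auto
  then show ?case by (auto simp: equi_bounded_def)
next
  case (Suc k)
  have "partials (\<lambda>f x v. 0) {\<lambda>x. c | c. \<bar>c\<bar> \<le> R} \<subseteq> {\<lambda>x. c | c. \<bar>c\<bar> \<le> (0::real)}"
    by (auto simp: partials_def)
  from equi_C_subset[OF Suc.IH this] show ?case
    by (auto simp: equi_bounded_def equi_derivative_def linear_iff
        intro!: exI[of _ "\<lambda>f x v. 0"] always_eventually)
qed

lemma equi_C_const: "equi_C k S {\<lambda>x. c}"
  by (rule equi_C_subset[OF equi_C_constants[of k S "\<bar>c\<bar>"]]) auto

lemma equi_C_bounded_linear: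
  assumes "bounded_linear l" shows "equi_C k S {l}"
proof (cases k)
  case 0
  have "continuous (at x within S) l" for x
    by (rule bounded_linear.continuous[OF assms continuous_ident])
  then have "\<forall>\<^sub>F y in at x within S. \<bar>l y - l x\<bar> \<le> \<epsilon>" if "\<epsilon> > 0" for x \<epsilon>
    using that tendstoD[of l "l x" "at x within S" \<epsilon>]
    by (auto simp: continuous_within dist_real_def elim: eventually_mono)
  then show ?thesis using 0 by (auto simp: equi_bounded_def equi_continuous_def)
next
  case (Suc k')
  obtain K where K: "\<And>v. norm (l v) \<le> norm v * K" "K \<ge> 0"
    using bounded_linear.nonneg_bounded[OF assms] by blast
  have "\<bar>l v\<bar> \<le> K" if "norm v \<le> 1" for v
    using K(1)[of v] mult_right_mono[OF that K(2)] by simp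
  then have "partials (\<lambda>f x. l) {l} \<subseteq> {\<lambda>x. c | c. \<bar>c\<bar> \<le> K}"
    by (auto simp: partials_def)
  from equi_C_subset[OF equi_C_constants this] show ?thesis
    using Suc bounded_linear.linear[OF assms]
    by (auto simp: equi_bounded_def equi_derivative_def linear_diff intro!: exI[of _ "\<lambda>f x. l"])
qed

abbreviation sum_set :: "('a \<Rightarrow> real) set \<Rightarrow> ('a \<Rightarrow> real) set \<Rightarrow> ('a \<Rightarrow> real) set" where
  "sum_set F G \<equiv> {\<lambda>x. f x + g x | f g. f \<in> F \<and> g \<in> G}"

abbreviation product_set :: "('a \<Rightarrow> real) set \<Rightarrow> ('a \<Rightarrow> real) set \<Rightarrow> ('a \<Rightarrow> real) set" where
  "product_set F G \<equiv> {\<lambda>x. f x * g x | f g. f \<in> F \<and> g \<in> G}"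

abbreviation multiple_set :: "real \<Rightarrow> ('a \<Rightarrow> real) set \<Rightarrow> ('a \<Rightarrow> real) set" where
  "multiple_set R F \<equiv> {\<lambda>x. c * f x | c f. \<bar>c\<bar> \<le> R \<and> f \<in> F}"

lemma pointwise_addI:
  "f \<in> F \<Longrightarrow> g \<in> G \<Longrightarrow> (\<lambda>x. f x + g x) \<in> sum_set F G"
  by blast

lemma pointwise_multI:
  "f \<in> F \<Longrightarrow> g \<in> G \<Longrightarrow> (\<lambda>x. f x * g x) \<in> product_set F G"
  by blast

lemma pointwise_scaleI:
  "\<bar>c\<bar> \<le> R \<Longrightarrow> f \<in> F \<Longrightarrow> (\<lambda>x. c * f x) \<in> multiple_set R F"
  by blast

text \<open>As \<open>h = f + g\<close> does not determine \<open>f\<close> and \<open>g\<close>, a decomposition of each \<open>h\<close> is chosen first, and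
the derivative of \<open>h\<close> is defined from it.\<close>

lemma equi_C_add:
  assumes "equi_C k S F" "equi_C k S G"
  shows "equi_C k S (sum_set F G)"
  using assms
proof (induction k arbitrary: F G)
  have bdd: "equi_bounded S (sum_set F G)" if F: "equi_bounded S F" and G: "equi_bounded S G" for F G
    unfolding equi_bounded_def
  proof
    fix x assume "x \<in> S"
    then obtain B B' where "\<And>f. f \<in> F \<Longrightarrow> \<bar>f x\<bar> \<le> B" "\<And>f. f \<in> G \<Longrightarrow> \<bar>f x\<bar> \<le> B'"
      using F G unfolding equi_bounded_def by metis
    then have "\<bar>f x + g x\<bar> \<le> B + B'" if "f \<in> F" "g \<in> G" for f g
      using that by (intro order_trans[OF abs_triangle_ineq] add_mono) auto
    then show "\<exists>B. \<forall>h\<in>sum_set F G. \<bar>h x\<bar> \<le> B" by blast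
  qed
  {
    case 0
    have "equi_continuous S (sum_set F G)"
      unfolding equi_continuous_def
    proof (intro ballI allI impI)
      fix x :: 'a and \<epsilon> :: real assume x: "x \<in> S" and "\<epsilon> > 0"
      then have \<epsilon>: "\<epsilon> / 2 > 0" by simp
      have "\<forall>\<^sub>F y in at x within S. \<forall>f\<in>F. \<bar>f y - f x\<bar> \<le> \<epsilon> / 2"
        "\<forall>\<^sub>F y in at x within S. \<forall>f\<in>G. \<bar>f y - f x\<bar> \<le> \<epsilon> / 2"
        using 0 x \<epsilon> unfolding equi_C.simps equi_continuous_def by blast+
      then show "\<forall>\<^sub>F y in at x within S. \<forall>h\<in>sum_set F G. \<bar>h y - h x\<bar> \<le> \<epsilon>"
      proof eventually_elim
        case (elim y)
        have "\<bar>f y + g y - (f x + g x)\<bar> \<le> \<epsilon>" if "f \<in> F" "g \<in> G" for f g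
          using bspec[OF elim(1) that(1)] bspec[OF elim(2) that(2)] by linarith
        then show ?case by blast
      qed
    qed
    then show ?case using bdd 0 by simp
  next
    case (Suc k)
    let ?H = "sum_set F G"
    obtain d where d: "equi_derivative S F d" "equi_C k S (partials d F)" using Suc.prems by auto
    obtain e where e: "equi_derivative S G e" "equi_C k S (partials e G)" using Suc.prems by auto
    have "\<exists>P. \<forall>h\<in>?H. fst (P h) \<in> F \<and> snd (P h) \<in> G \<and> h = (\<lambda>x. fst (P h) x + snd (P h) x)"
      by (rule bchoice) auto
    then obtain P where P: "\<And>h. h \<in> ?H \<Longrightarrow>
        fst (P h) \<in> F \<and> snd (P h) \<in> G \<and> h = (\<lambda>x. fst (P h) x + snd (P h) x)"
      by blast
    define p q where "p h = fst (P h)" and "q h = snd (P h)" for h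
    have pq: "p h \<in> F \<and> q h \<in> G \<and> h = (\<lambda>x. p h x + q h x)" if "h \<in> ?H" for h
      unfolding p_def q_def by (rule P[OF that])
    define D where "D h x v = d (p h) x v + e (q h) x v" for h x v
    have "equi_derivative S ?H D"
      unfolding equi_derivative_def
    proof (intro conjI ballI allI impI)
      show "linear (D h x)" if "h \<in> ?H" "x \<in> S" for h x
        unfolding D_def using equi_derivativeD(1)[OF d(1) that(2), of "p h"]
          equi_derivativeD(1)[OF e(1) that(2), of "q h"] pq[OF that(1)]
        by (intro linear_compose_add) auto
      fix x :: 'a and \<epsilon> :: real assume x: "x \<in> S" and "\<epsilon> > 0"
      then have \<epsilon>: "\<epsilon> / 2 > 0" by simp
      from equi_derivativeD(2)[OF d(1) x \<epsilon>] equi_derivativeD(2)[OF e(1) x \<epsilon>]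
      show "\<forall>\<^sub>F y in at x within S. \<forall>h\<in>?H. \<bar>h y - h x - D h x (y - x)\<bar> \<le> \<epsilon> * norm (y - x)"
      proof eventually_elim
        case (elim y)
        show ?case
        proof
          fix h assume "h \<in> ?H"
          let ?f = "p h" and ?g = "q h"
          have fg: "?f \<in> F" "?g \<in> G" and hz: "h z = ?f z + ?g z" for z
            using pq[OF \<open>h \<in> ?H\<close>] fun_cong[of h "\<lambda>x. ?f x + ?g x" z] by auto
          have "h y - h x - D h x (y - x) = (?f y - ?f x - d ?f x (y - x)) + (?g y - ?g x - e ?g x (y - x))"
            unfolding D_def hz[of x] hz[of y] by simp
          also have "\<bar>\<dots>\<bar> \<le> \<epsilon> / 2 * norm (y - x) + \<epsilon> / 2 * norm (y - x)"
            using elim fg(1,2) by (intro order_trans[OF abs_triangle_ineq] add_mono) auto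
          finally show "\<bar>h y - h x - D h x (y - x)\<bar> \<le> \<epsilon> * norm (y - x)" by simp
        qed
      qed
    qed
    moreover have "equi_C k S (partials D ?H)"
    proof (rule equi_C_subset[OF Suc.IH[OF d(2) e(2)]])
      show "partials D ?H \<subseteq> sum_set (partials d F) (partials e G)"
      proof
        fix r assume "r \<in> partials D ?H"
        then obtain h v where h: "h \<in> ?H" "norm v \<le> 1" and r: "r = (\<lambda>x. D h x v)"
          by (rule partialsE)
        show "r \<in> sum_set (partials d F) (partials e G)"
          unfolding r D_def
          by (rule pointwise_addI; rule partialsI[OF _ h(2)]) (use pq[OF h(1)] in blast)+
      qed
    qed
    moreover have "equi_bounded S ?H"
      by (rule bdd) (use Suc.prems in \<open>blast intro: equi_C_imp_bounded\<close>)+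
    ultimately show ?case by auto
  }
qed

text \<open>The product rule: the partial derivatives of products lie in \<open>F' G + F G'\<close>, to which the induction hypothesis
and \<open>equi_C_add\<close> apply.\<close>

lemma equi_C_mult:
  assumes "equi_C k S F" "equi_C k S G"
  shows "equi_C k S (product_set F G)"
  using assms
proof (induction k arbitrary: F G)
  have bdd: "equi_bounded S (product_set F G)"
    if F: "equi_bounded S F" and G: "equi_bounded S G" for F G
    unfolding equi_bounded_def
  proof
    fix x assume "x \<in> S"
    then obtain B B' where B: "\<And>f. f \<in> F \<Longrightarrow> \<bar>f x\<bar> \<le> B" "\<And>f. f \<in> G \<Longrightarrow> \<bar>f x\<bar> \<le> B'"
      using F G unfolding equi_bounded_def by metis
    have "\<bar>f x * g x\<bar> \<le> B * B'" if "f \<in> F" "g \<in> G" for f g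
      unfolding abs_mult by (rule mult_mono) (use B[of f] B(2)[of g] that in auto)
    then show "\<exists>B. \<forall>h\<in>product_set F G. \<bar>h x\<bar> \<le> B"
      by (intro exI[of _ "B * B'"]) auto
  qed
  {
    case 0
    have "equi_continuous S (product_set F G)"
      unfolding equi_continuous_def
    proof (intro ballI allI impI)
      fix x :: 'a and \<epsilon> :: real assume x: "x \<in> S" and "\<epsilon> > 0"
      obtain B B' where B: "\<And>f. f \<in> F \<Longrightarrow> \<bar>f x\<bar> \<le> B" "\<And>f. f \<in> G \<Longrightarrow> \<bar>f x\<bar> \<le> B'"
        using 0 x unfolding equi_C.simps equi_bounded_def by metis
      define R where "R = \<bar>B\<bar> + \<bar>B'\<bar> + 1"
      define \<delta> where "\<delta> = min 1 (\<epsilon> / (2 * R))"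
      have "R > 0" by (simp add: R_def)
      then have \<delta>: "\<delta> > 0" "\<delta> \<le> 1" "2 * R * \<delta> \<le> \<epsilon>"
        using \<open>\<epsilon> > 0\<close> by (auto simp: \<delta>_def min_def field_simps)
      have "\<forall>\<^sub>F y in at x within S. \<forall>f\<in>F. \<bar>f y - f x\<bar> \<le> \<delta>"
        "\<forall>\<^sub>F y in at x within S. \<forall>f\<in>G. \<bar>f y - f x\<bar> \<le> \<delta>"
        using 0 x \<delta>(1) unfolding equi_C.simps equi_continuous_def by blast+
      then show "\<forall>\<^sub>F y in at x within S. \<forall>h\<in>product_set F G. \<bar>h y - h x\<bar> \<le> \<epsilon>"
      proof eventually_elim
        case (elim y)
        have "\<bar>f y * g y - f x * g x\<bar> \<le> \<epsilon>" if "f \<in> F" "g \<in> G" for f g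
        proof -
          have fg: "\<bar>f y - f x\<bar> \<le> \<delta>" "\<bar>g y - g x\<bar> \<le> \<delta>" using elim that by auto
          have "f y * g y - f x * g x = (f y - f x) * g y + f x * (g y - g x)"
            by (simp add: algebra_simps)
          also have "\<bar>\<dots>\<bar> \<le> \<bar>f y - f x\<bar> * \<bar>g y\<bar> + \<bar>f x\<bar> * \<bar>g y - g x\<bar>"
            by (simp flip: abs_mult)
          also have "\<dots> \<le> \<delta> * R + R * \<delta>"
            using fg B(1)[OF that(1)] B(2)[OF that(2)] \<delta> \<open>R > 0\<close>
            by (intro add_mono mult_mono) (auto simp: R_def)
          finally show ?thesis using \<delta>(3) by (simp add: algebra_simps)
        qed
        then show ?case by blast
      qed
    qed
    then show ?case using bdd 0 by simp
  next
    case (Suc k)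
    let ?H = "product_set F G"
    obtain d where d: "equi_derivative S F d" "equi_C k S (partials d F)" using Suc.prems by auto
    obtain e where e: "equi_derivative S G e" "equi_C k S (partials e G)" using Suc.prems by auto
    have "\<exists>P. \<forall>h\<in>?H. fst (P h) \<in> F \<and> snd (P h) \<in> G \<and> h = (\<lambda>x. fst (P h) x * snd (P h) x)"
      by (rule bchoice) auto
    then obtain P where P: "\<And>h. h \<in> ?H \<Longrightarrow>
        fst (P h) \<in> F \<and> snd (P h) \<in> G \<and> h = (\<lambda>x. fst (P h) x * snd (P h) x)"
      by blast
    define p q where "p h = fst (P h)" and "q h = snd (P h)" for h
    have pq: "p h \<in> F \<and> q h \<in> G \<and> h = (\<lambda>x. p h x * q h x)" if "h \<in> ?H" for h
      unfolding p_def q_def by (rule P[OF that])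
    define D where "D h x v = d (p h) x v * q h x + p h x * e (q h) x v" for h x v
    have "equi_derivative S ?H D"
      unfolding equi_derivative_def
    proof (intro conjI ballI allI impI)
      show "linear (D h x)" if "h \<in> ?H" "x \<in> S" for h x
      proof -
        have lin: "linear (d (p h) x)" "linear (e (q h) x)"
          using equi_derivativeD(1)[OF d(1) that(2)] equi_derivativeD(1)[OF e(1) that(2)] pq[OF that(1)]
          by auto
        show ?thesis
          unfolding D_def
          by (rule linearI) (simp_all add: linear_add[OF lin(1)] linear_add[OF lin(2)]
              linear_scale[OF lin(1)] linear_scale[OF lin(2)] algebra_simps)
      qed
      fix x :: 'a and \<epsilon> :: real assume x: "x \<in> S" and "\<epsilon> > 0"
      obtain B B' where B: "\<And>f. f \<in> F \<Longrightarrow> \<bar>f x\<bar> \<le> B" "\<And>f. f \<in> G \<Longrightarrow> \<bar>f x\<bar> \<le> B'"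
        using Suc.prems[THEN equi_C_imp_bounded] x unfolding equi_bounded_def by metis
      obtain K where K: "K \<ge> 0" "\<And>f v. f \<in> F \<Longrightarrow> \<bar>d f x v\<bar> \<le> K * norm v"
        using equi_derivative_bound[OF d(1) equi_C_imp_bounded[OF d(2)] x] by blast
      define R where "R = \<bar>B\<bar> + \<bar>B'\<bar> + K + 1"
      define \<delta> where "\<delta> = min 1 (\<epsilon> / (3 * R))"
      have "R > 0" using K(1) by (simp add: R_def)
      then have \<delta>: "\<delta> > 0" "\<delta> \<le> 1" "3 * R * \<delta> \<le> \<epsilon>"
        using \<open>\<epsilon> > 0\<close> by (auto simp: \<delta>_def min_def field_simps)
      have "\<forall>\<^sub>F y in at x within S. \<forall>f\<in>G. \<bar>f y - f x\<bar> \<le> \<delta>"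
        using equi_C_imp_continuous[OF Suc.prems(2)] x \<delta>(1) unfolding equi_continuous_def by blast
      with equi_derivativeD(2)[OF d(1) x \<delta>(1)] equi_derivativeD(2)[OF e(1) x \<delta>(1)]
      show "\<forall>\<^sub>F y in at x within S. \<forall>h\<in>?H. \<bar>h y - h x - D h x (y - x)\<bar> \<le> \<epsilon> * norm (y - x)"
      proof eventually_elim
        case (elim y)
        show ?case
        proof
          fix h assume "h \<in> ?H"
          let ?f = "p h" and ?g = "q h"
          have fg: "?f \<in> F" "?g \<in> G" and hz: "h z = ?f z * ?g z" for z
            using pq[OF \<open>h \<in> ?H\<close>] fun_cong[of h "\<lambda>x. ?f x * ?g x" z] by auto
          let ?n = "norm (y - x)"
          have eq: "h y - h x - D h x (y - x) = (?f y - ?f x - d ?f x (y - x)) * ?g y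
              + ?f x * (?g y - ?g x - e ?g x (y - x)) + d ?f x (y - x) * (?g y - ?g x)"
            unfolding D_def hz[of x] hz[of y] by (simp add: algebra_simps)
          have "\<bar>h y - h x - D h x (y - x)\<bar> \<le> \<bar>?f y - ?f x - d ?f x (y - x)\<bar> * \<bar>?g y\<bar>
              + \<bar>?f x\<bar> * \<bar>?g y - ?g x - e ?g x (y - x)\<bar> + \<bar>d ?f x (y - x)\<bar> * \<bar>?g y - ?g x\<bar>"
            unfolding eq abs_mult[symmetric] by linarith
          also have "\<dots> \<le> (\<delta> * ?n) * R + R * (\<delta> * ?n) + (R * ?n) * \<delta>"
          proof (intro add_mono mult_mono)
            show "\<bar>?g y\<bar> \<le> R"
              using B(2)[OF fg(2)] bspec[OF elim(3) fg(2)] \<delta>(2) K(1) unfolding R_def by linarith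
            show "\<bar>d ?f x (y - x)\<bar> \<le> R * ?n"
              using K(2)[OF fg(1), of "y - x"] mult_right_mono[of K R ?n] by (simp add: R_def)
            show "\<bar>?f x\<bar> \<le> R" using B(1)[OF fg(1)] K(1) by (simp add: R_def)
          qed (use bspec[OF elim(1) fg(1)] bspec[OF elim(2) fg(2)] bspec[OF elim(3) fg(2)]
                \<delta>(1) \<open>R > 0\<close> in simp_all)
          also have "\<dots> = (3 * R * \<delta>) * ?n" by (simp add: algebra_simps)
          also have "\<dots> \<le> \<epsilon> * ?n" by (rule mult_right_mono[OF \<delta>(3)]) simp
          finally show "\<bar>h y - h x - D h x (y - x)\<bar> \<le> \<epsilon> * ?n" .
        qed
      qed
    qed
    moreover have "equi_C k S (partials D ?H)"
    proof (rule equi_C_subset)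
      let ?P = "product_set (partials d F) G"
        and ?Q = "product_set F (partials e G)"
      show "equi_C k S (sum_set ?P ?Q)"
        by (rule equi_C_add[OF Suc.IH[OF d(2)] Suc.IH[OF _ e(2)]])
          (use Suc.prems in \<open>blast intro: equi_C_Suc_imp\<close>)+
      show "partials D ?H \<subseteq> sum_set ?P ?Q"
      proof
        fix r assume "r \<in> partials D ?H"
        then obtain h v where h: "h \<in> ?H" "norm v \<le> 1" and r: "r = (\<lambda>x. D h x v)"
          by (rule partialsE)
        have "(\<lambda>x. d (p h) x v * q h x) \<in> ?P"
          by (rule pointwise_multI, rule partialsI[OF _ h(2)]) (use pq[OF h(1)] in blast)+
        moreover have "(\<lambda>x. p h x * e (q h) x v) \<in> ?Q"
          by (rule pointwise_multI[OF _ partialsI[OF _ h(2)]]) (use pq[OF h(1)] in blast)+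
        ultimately show "r \<in> sum_set ?P ?Q"
          unfolding r D_def by (rule pointwise_addI)
      qed
    qed
    moreover have "equi_bounded S ?H"
      by (rule bdd) (use Suc.prems in \<open>blast intro: equi_C_imp_bounded\<close>)+
    ultimately show ?case by auto
  }
qed

lemma equi_C_scale:
  assumes "equi_C k S F" shows "equi_C k S (multiple_set R F)"
proof (rule equi_C_subset[OF equi_C_mult[OF equi_C_constants[where R = R] assms]], clarify)
  fix c f assume "\<bar>c\<bar> \<le> R" "f \<in> F"
  then show "\<exists>f' g. (\<lambda>x. c * f x) = (\<lambda>x. f' x * g x) \<and> f' \<in> {\<lambda>x. c | c. \<bar>c\<bar> \<le> R} \<and> g \<in> F"
    by (intro exI[of _ "\<lambda>x. c"] exI[of _ f]) auto
qed

lemma equi_continuous_singleton: "equi_continuous S {f} \<longleftrightarrow> continuous_on S f"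
proof
  assume f: "equi_continuous S {f}"
  show "continuous_on S f"
    unfolding continuous_on_def
  proof (intro ballI tendstoI)
    fix x and \<epsilon> :: real assume x: "x \<in> S" and "\<epsilon> > 0"
    from equi_continuousD[OF f x half_gt_zero[OF \<open>\<epsilon> > 0\<close>]] show "\<forall>\<^sub>F y in at x within S. dist (f y) (f x) < \<epsilon>"
      by eventually_elim (use \<open>\<epsilon> > 0\<close> in \<open>simp add: dist_real_def\<close>)
  qed
next
  assume f: "continuous_on S f"
  show "equi_continuous S {f}"
    unfolding equi_continuous_def
  proof (intro ballI allI impI)
    fix x and \<epsilon> :: real assume x: "x \<in> S" and "\<epsilon> > 0"
    with f have "\<forall>\<^sub>F y in at x within S. dist (f y) (f x) < \<epsilon>"
      by (simp add: continuous_on_def tendstoD)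
    then show "\<forall>\<^sub>F y in at x within S. \<forall>f\<in>{f}. \<bar>f y - f x\<bar> \<le> \<epsilon>"
      by eventually_elim (simp add: dist_real_def)
  qed
qed

lemma equi_C_0_singleton: "equi_C 0 S {f} \<longleftrightarrow> continuous_on S f"
  by (auto simp: equi_continuous_singleton equi_bounded_def)

lemma equi_C_continuous_on: "equi_C k S {f} \<Longrightarrow> continuous_on S f"
  using equi_C_0I equi_C_0_singleton by blast

lemma equi_C_add2: "equi_C k S {f} \<Longrightarrow> equi_C k S {g} \<Longrightarrow> equi_C k S {\<lambda>x. f x + g x}"
  using equi_C_add[of k S "{f}" "{g}"] by (simp del: equi_C.simps)

lemma equi_C_mult2: "equi_C k S {f} \<Longrightarrow> equi_C k S {g} \<Longrightarrow> equi_C k S {\<lambda>x. f x * g x}"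
  using equi_C_mult[of k S "{f}" "{g}"] by (simp del: equi_C.simps)

lemma equi_C_diff2: "equi_C k S {f} \<Longrightarrow> equi_C k S {g} \<Longrightarrow> equi_C k S {\<lambda>x. f x - g x}"
  using equi_C_add2[OF _ equi_C_mult2[OF equi_C_const[of k S "-1"]], of f g]
  by (simp del: equi_C.simps)

lemma equi_C_sum:
  assumes "\<And>i. i \<in> I \<Longrightarrow> equi_C k S {f i}" shows "equi_C k S {\<lambda>x. \<Sum>i\<in>I. f i x}"
  using assms
proof (induction I rule: infinite_finite_induct)
  case (insert i I)
  then show ?case using equi_C_add2[of k S "f i"] by (simp del: equi_C.simps)
qed (simp_all add: equi_C_const del: equi_C.simps)

lemma eventually_within_compose:
  assumes "\<forall>\<^sub>F z in at (h x) within V. P z" "P (h x)" "continuous (at x within S) h" "h ` S \<subseteq> V"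
  shows "\<forall>\<^sub>F y in at x within S. P (h y)"
proof -
  obtain U where U: "open U" "h x \<in> U" "\<And>z. z \<in> U \<Longrightarrow> z \<in> V \<Longrightarrow> P z"
  proof -
    from assms(1) obtain U where "open U" "h x \<in> U" "\<forall>z\<in>U. z \<noteq> h x \<longrightarrow> z \<in> V \<longrightarrow> P z"
      unfolding eventually_at_topological by blast
    with assms(2) show ?thesis by (intro that[of U]) auto
  qed
  have "\<forall>\<^sub>F y in at x within S. h y \<in> U"
    using assms(3) U(1,2) by (simp add: continuous_within topological_tendstoD)
  with eventually_at_within_self[of S x] show ?thesis
    by eventually_elim (use U(3) assms(4) in blast)
qed

text \<open>A chain rule for inner maps \<open>x \<mapsto> \<Lambda> x + \<rho>(x) z\<close> with a single scalar nonlinearity.  This form has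
a scalar product rule for its derivatives, and it covers everything needed: linear substitutions
(\<open>z = 0\<close>), composition with a function of a real variable (\<open>\<Lambda> = 0\<close>), and restriction to a graph
\<open>x \<mapsto> (x, \<rho>(x))\<close>.\<close>

lemma equi_C_comp:
  fixes \<Lambda> :: "'a::real_normed_vector \<Rightarrow> 'b::real_normed_vector"
  assumes \<Lambda>: "bounded_linear \<Lambda>" and \<rho>: "equi_C k S {\<rho>}" and F: "equi_C k V F"
    and V: "\<And>x. x \<in> S \<Longrightarrow> \<Lambda> x + \<rho> x *\<^sub>R z \<in> V"
  shows "equi_C k S {\<lambda>x. f (\<Lambda> x + \<rho> x *\<^sub>R z) | f. f \<in> F}"
proof -
  define \<psi> where "\<psi> x = \<Lambda> x + \<rho> x *\<^sub>R z" for x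
  have V: "\<psi> ` S \<subseteq> V" using V by (auto simp: \<psi>_def)
  have "continuous_on S \<psi>"
    unfolding \<psi>_def using equi_C_continuous_on[OF \<rho>]
    by (intro continuous_intros linear_continuous_on[OF \<Lambda>]) auto
  then have cont: "continuous (at x within S) \<psi>" if "x \<in> S" for x
    using that by (simp add: continuous_on_eq_continuous_within)
  have bdd: "equi_bounded S {\<lambda>x. f (\<psi> x) | f. f \<in> F}" if F: "equi_bounded V F" for F
    unfolding equi_bounded_def
  proof
    fix x assume "x \<in> S"
    then obtain B where "\<And>f. f \<in> F \<Longrightarrow> \<bar>f (\<psi> x)\<bar> \<le> B"
      using F V unfolding equi_bounded_def by blast
    then show "\<exists>B. \<forall>h\<in>{\<lambda>x. f (\<psi> x) | f. f \<in> F}. \<bar>h x\<bar> \<le> B" by auto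
  qed
  have "equi_C k S {\<lambda>x. f (\<psi> x) | f. f \<in> F}"
    using \<rho> F
  proof (induction k arbitrary: F)
    case 0
    have "equi_continuous S {\<lambda>x. f (\<psi> x) | f. f \<in> F}"
      unfolding equi_continuous_def
    proof (intro ballI allI impI)
      fix x and \<epsilon> :: real assume x: "x \<in> S" and \<epsilon>: "\<epsilon> > 0"
      have cF: "equi_continuous V F" and \<psi>x: "\<psi> x \<in> V" using 0(2) V x by auto
      from equi_continuousD[OF cF \<psi>x \<epsilon>] have "\<forall>\<^sub>F y in at x within S. \<forall>f\<in>F. \<bar>f (\<psi> y) - f (\<psi> x)\<bar> \<le> \<epsilon>"
        by (rule eventually_within_compose[where P = "\<lambda>z. \<forall>f\<in>F. \<bar>f z - f (\<psi> x)\<bar> \<le> \<epsilon>",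
              OF _ _ cont[OF x] V]) (use \<epsilon> in auto)
      then show "\<forall>\<^sub>F y in at x within S. \<forall>h\<in>{\<lambda>x. f (\<psi> x) | f. f \<in> F}. \<bar>h y - h x\<bar> \<le> \<epsilon>"
        by eventually_elim auto
    qed
    then show ?case using 0 bdd by simp
  next
    case (Suc k)
    let ?H = "{\<lambda>x. f (\<psi> x) | f. f \<in> F}"
    obtain d where d: "equi_derivative V F d" "equi_C k V (partials d F)" using Suc.prems by auto
    obtain e where e: "equi_derivative S {\<rho>} e" "equi_C k S (partials e {\<rho>})" using Suc.prems by auto
    have \<rho>k: "equi_C k S {\<rho>}" using Suc.prems(1) by (rule equi_C_Suc_imp)
    obtain K where K: "K > 0" "\<And>v. norm (\<Lambda> v) \<le> norm v * K"
      using bounded_linear.pos_bounded[OF \<Lambda>] by blast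
    have "\<exists>p. \<forall>h\<in>?H. p h \<in> F \<and> h = (\<lambda>x. p h (\<psi> x))" by (rule bchoice) auto
    then obtain p where p: "\<And>h. h \<in> ?H \<Longrightarrow> p h \<in> F" "\<And>h. h \<in> ?H \<Longrightarrow> h = (\<lambda>x. p h (\<psi> x))"
      by blast
    define r where "r = e \<rho>"
    define D where "D h x v = d (p h) (\<psi> x) (\<Lambda> v + r x v *\<^sub>R z)" for h x v
    have "equi_derivative S ?H D"
      unfolding equi_derivative_def
    proof (intro conjI ballI allI impI)
      fix h x assume "h \<in> ?H" and x: "x \<in> S"
      have "linear (\<lambda>v. \<Lambda> v + r x v *\<^sub>R z)"
        unfolding r_def using equi_derivativeD(1)[OF e(1) x, of \<rho>] bounded_linear.linear[OF \<Lambda>]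
        by (intro linearI) (auto simp: linear_add linear_scale algebra_simps)
      moreover have "linear (d (p h) (\<psi> x))"
        using equi_derivativeD(1)[OF d(1)] p(1)[OF \<open>h \<in> ?H\<close>] V x by blast
      ultimately show "linear (D h x)"
        unfolding D_def using linear_compose[of "\<lambda>v. \<Lambda> v + r x v *\<^sub>R z" "d (p h) (\<psi> x)"]
        by (simp add: o_def)
    next
      fix x :: 'a and \<epsilon> :: real assume x: "x \<in> S" and "\<epsilon> > 0"
      then have \<psi>x: "\<psi> x \<in> V" using V by blast
      obtain B where B: "B \<ge> 0" "\<And>f v. f \<in> F \<Longrightarrow> \<bar>d f (\<psi> x) v\<bar> \<le> B * norm v"
        by (rule equi_derivative_bound[OF d(1) equi_C_imp_bounded[OF d(2)] \<psi>x]) (rule that)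
      obtain C where C0: "C \<ge> 0" "\<And>h v. h \<in> {\<rho>} \<Longrightarrow> \<bar>e h x v\<bar> \<le> C * norm v"
        by (rule equi_derivative_bound[OF e(1) equi_C_imp_bounded[OF e(2)] x]) (rule that)
      then have C: "C \<ge> 0" "\<And>v. \<bar>r x v\<bar> \<le> C * norm v" by (auto simp: r_def)
      define M where "M = K + (C + 1) * norm z"
      have M: "M > 0" "M + B * norm z > 0" using K B C by (auto simp: M_def intro!: add_pos_nonneg)
      \<comment> \<open>The error is at most \<open>\<delta> M\<close> from the outer function, as \<open>M\<close> is a local Lipschitz constant of the inner map
        at \<open>x\<close>, and \<open>\<delta> B norm z\<close> from the error of \<open>\<rho>\<close>.\<close>
      obtain \<delta> where \<delta>: "\<delta> > 0" "\<delta> \<le> 1" "\<delta> * (M + B * norm z) \<le> \<epsilon>"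
      proof
        show "min 1 (\<epsilon> / (M + B * norm z)) * (M + B * norm z) \<le> \<epsilon>"
          using M(2) \<open>\<epsilon> > 0\<close> by (simp add: min_mult_distrib_right)
      qed (use M(2) \<open>\<epsilon> > 0\<close> in auto)
      have "\<forall>\<^sub>F y in at x within S. \<forall>f\<in>F.
          \<bar>f (\<psi> y) - f (\<psi> x) - d f (\<psi> x) (\<psi> y - \<psi> x)\<bar> \<le> \<delta> * norm (\<psi> y - \<psi> x)"
        using equi_derivativeD(2)[OF d(1) \<psi>x \<delta>(1)] equi_derivativeD(1)[OF d(1) \<psi>x, THEN linear_0]
        by (intro eventually_within_compose[where P = "\<lambda>z. \<forall>f\<in>F.
              \<bar>f z - f (\<psi> x) - d f (\<psi> x) (z - \<psi> x)\<bar> \<le> \<delta> * norm (z - \<psi> x)", OF _ _ cont[OF x] V]) auto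
      with equi_derivativeD(2)[OF e(1) x \<delta>(1)]
      show "\<forall>\<^sub>F y in at x within S. \<forall>h\<in>?H. \<bar>h y - h x - D h x (y - x)\<bar> \<le> \<epsilon> * norm (y - x)"
      proof eventually_elim
        case (elim y)
        let ?n = "norm (y - x)"
        have \<rho>y: "\<bar>\<rho> y - \<rho> x - r x (y - x)\<bar> \<le> \<delta> * ?n" using elim(1) by (simp add: r_def)
        have \<psi>y: "\<psi> y - \<psi> x = \<Lambda> (y - x) + (\<rho> y - \<rho> x) *\<^sub>R z"
          by (simp add: \<psi>_def linear_diff[OF bounded_linear.linear[OF \<Lambda>]] algebra_simps)
        have "\<bar>\<rho> y - \<rho> x\<bar> \<le> \<delta> * ?n + C * ?n" using \<rho>y C(2)[of "y - x"] by linarith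
        also have "\<dots> \<le> (C + 1) * ?n"
          using mult_right_mono[OF \<delta>(2), of ?n] by (simp add: algebra_simps)
        finally have "norm ((\<rho> y - \<rho> x) *\<^sub>R z) \<le> (C + 1) * ?n * norm z"
          by (simp add: mult_right_mono)
        then have \<psi>n: "norm (\<psi> y - \<psi> x) \<le> M * ?n"
          unfolding \<psi>y M_def using K(2)[of "y - x"]
          by (intro order_trans[OF norm_triangle_ineq]) (simp add: algebra_simps)
        show ?case
        proof
          fix h assume h: "h \<in> ?H"
          let ?f = "p h"
          have f: "?f \<in> F" by (rule p(1)[OF h])
          have hz: "h w = ?f (\<psi> w)" for w using fun_cong[OF p(2)[OF h]] by auto
          have lin: "linear (d ?f (\<psi> x))" by (rule equi_derivativeD(1)[OF d(1) \<psi>x f])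
          have "\<Lambda> (y - x) + r x (y - x) *\<^sub>R z = (\<psi> y - \<psi> x) - (\<rho> y - \<rho> x - r x (y - x)) *\<^sub>R z"
            unfolding \<psi>y by (simp add: algebra_simps)
          then have eq: "h y - h x - D h x (y - x) =
              (?f (\<psi> y) - ?f (\<psi> x) - d ?f (\<psi> x) (\<psi> y - \<psi> x))
              + (\<rho> y - \<rho> x - r x (y - x)) * d ?f (\<psi> x) z"
            unfolding D_def hz[of x] hz[of y] by (simp add: linear_diff[OF lin] linear_scale[OF lin])
          have "\<bar>h y - h x - D h x (y - x)\<bar> \<le> \<delta> * (M * ?n) + (\<delta> * ?n) * (B * norm z)"
            unfolding eq
          proof (intro order_trans[OF abs_triangle_ineq] add_mono)
            show "\<bar>?f (\<psi> y) - ?f (\<psi> x) - d ?f (\<psi> x) (\<psi> y - \<psi> x)\<bar> \<le> \<delta> * (M * ?n)"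
              using bspec[OF elim(2) f] mult_left_mono[OF \<psi>n, of \<delta>] \<delta>(1) by linarith
            show "\<bar>(\<rho> y - \<rho> x - r x (y - x)) * d ?f (\<psi> x) z\<bar> \<le> (\<delta> * ?n) * (B * norm z)"
              unfolding abs_mult by (intro mult_mono \<rho>y B(2)[OF f]) (use \<delta>(1) in auto)
          qed
          also have "\<dots> = (\<delta> * (M + B * norm z)) * ?n" by (simp add: algebra_simps)
          also have "\<dots> \<le> \<epsilon> * ?n" by (rule mult_right_mono[OF \<delta>(3)]) simp
          finally show "\<bar>h y - h x - D h x (y - x)\<bar> \<le> \<epsilon> * ?n" .
        qed
      qed
    qed
    moreover have "equi_C k S (partials D ?H)"
    proof (rule equi_C_cong)
      \<comment> \<open>The directions \<open>\<Lambda> v\<close> and \<open>z\<close> need not be unit vectors; normalising them costs bounded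
        scalar factors.\<close>
      let ?Q = "{\<lambda>x. f (\<psi> x) | f. f \<in> partials d F}"
      let ?P1 = "multiple_set K ?Q"
        and ?P2 = "multiple_set (norm z + 1) ?Q"
      let ?P3 = "product_set (partials e {\<rho>}) ?P2"
      have Q: "equi_C k S ?Q" by (rule Suc.IH[OF \<rho>k d(2)])
      show "equi_C k S (sum_set ?P1 ?P3)"
        by (rule equi_C_add[OF equi_C_scale[OF Q] equi_C_mult[OF e(2) equi_C_scale[OF Q]]])
      show "\<exists>g\<in>sum_set ?P1 ?P3. \<forall>x\<in>S. g x = q x"
        if "q \<in> partials D ?H" for q
      proof -
        from that obtain h v where h: "h \<in> ?H" and v: "norm v \<le> 1" and q: "q = (\<lambda>x. D h x v)"
          by (rule partialsE)
        let ?f = "p h"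
        have f: "?f \<in> F" by (rule p(1)[OF h])
        have cQ: "(\<lambda>x. c * d ?f (\<psi> x) (w /\<^sub>R c)) \<in> multiple_set C ?Q"
          if "norm w \<le> c" "c > 0" "c \<le> C" for w c C
        proof (rule pointwise_scaleI)
          have "norm (w /\<^sub>R c) \<le> 1" using that by (simp add: field_simps)
          from partialsI[OF f this, of d] show "(\<lambda>x. d ?f (\<psi> x) (w /\<^sub>R c)) \<in> ?Q" by auto
        qed (use that in simp)
        have "norm (\<Lambda> v) \<le> K" using K(2)[of v] v K(1) mult_right_mono[OF v, of K] by linarith
        from cQ[OF this K(1) order_refl] have a: "(\<lambda>x. K * d ?f (\<psi> x) (\<Lambda> v /\<^sub>R K)) \<in> ?P1" .
        have "norm z + 1 > 0" by (simp add: add_nonneg_pos)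
        from cQ[OF _ this order_refl, of z]
        have "(\<lambda>x. (norm z + 1) * d ?f (\<psi> x) (z /\<^sub>R (norm z + 1))) \<in> ?P2" by simp
        then have b: "(\<lambda>x. r x v * ((norm z + 1) * d ?f (\<psi> x) (z /\<^sub>R (norm z + 1)))) \<in> ?P3"
          unfolding r_def by (rule pointwise_multI[OF partialsI[OF singletonI v]])
        show ?thesis
        proof (rule bexI[OF _ pointwise_addI[OF a b]], rule ballI)
          fix x assume "x \<in> S"
          then have lin: "linear (d ?f (\<psi> x))" using equi_derivativeD(1)[OF d(1) _ f] V by blast
          have cancel: "c * (inverse c * t) = t" if "c > 0" for c t :: real
            using that by (simp add: field_simps)
          show "K * d ?f (\<psi> x) (\<Lambda> v /\<^sub>R K) + r x v * ((norm z + 1) * d ?f (\<psi> x) (z /\<^sub>R (norm z + 1))) = q x"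
            by (simp only: q D_def linear_add[OF lin] linear_scale[OF lin] real_scaleR_def
                cancel[OF K(1)] cancel[OF \<open>norm z + 1 > 0\<close>])
        qed

      qed
    qed
    moreover have "equi_bounded S ?H" using bdd Suc.prems(2) by auto
    ultimately show ?case by auto
  qed
  then show ?thesis by (simp add: \<psi>_def)
qed

text \<open>The derivative \<open>- f' / f\<^sup>2\<close> is a product of functions that are \<open>C\<^sup>k\<close> by the induction hypothesis.\<close>

lemma equi_C_inverse:
  assumes f: "equi_C k S {f}" and nz: "\<And>x. x \<in> S \<Longrightarrow> f x \<noteq> 0"
  shows "equi_C k S {\<lambda>x. inverse (f x)}"
  using f
proof (induction k)
  case 0
  then show ?case unfolding equi_C_0_singleton using nz by (auto intro: continuous_on_inverse)
next
  case (Suc k)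
  let ?g = "\<lambda>x. inverse (f x)"
  obtain d where d: "equi_derivative S {f} d" "equi_C k S (partials d {f})" using Suc.prems by auto
  have fk: "equi_C k S {f}" using Suc.prems by (rule equi_C_Suc_imp)
  define D where "D h x v = - 1 * (d f x v * (?g x * ?g x))" for h :: "'a \<Rightarrow> real" and x v
  have "equi_derivative S {?g} D"
    unfolding equi_derivative_def
  proof (intro conjI ballI allI impI)
    fix h x assume "x \<in> S"
    then have lin: "linear (d f x)" using equi_derivativeD(1)[OF d(1)] by blast
    show "linear (D h x)"
      unfolding D_def by (rule linearI) (simp_all add: linear_add[OF lin] linear_scale[OF lin] algebra_simps)
  next
    fix x and \<epsilon> :: real assume x: "x \<in> S" and "\<epsilon> > 0"
    obtain K where K0: "K \<ge> 0" "\<And>h v. h \<in> {f} \<Longrightarrow> \<bar>d h x v\<bar> \<le> K * norm v"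
      by (rule equi_derivative_bound[OF d(1) equi_C_imp_bounded[OF d(2)] x]) (rule that)
    note K = K0(1) K0(2)[OF singletonI]
    define R where "R = \<bar>?g x\<bar>"
    define M where "M = R * (R + 1) + K * R + 1"
    define \<delta> where "\<delta> = min 1 (\<epsilon> / M)"
    have "R \<ge> 0" by (simp add: R_def)
    then have "M > 0" using K(1) by (auto simp: M_def intro!: add_nonneg_pos)
    then have \<delta>: "\<delta> > 0" "\<delta> \<le> 1" "\<delta> * M \<le> \<epsilon>"
      using \<open>\<epsilon> > 0\<close> by (auto simp: \<delta>_def min_def field_simps)
    have "equi_continuous S {?g}"
      using equi_C_continuous_on[OF fk] nz
      by (auto simp: equi_continuous_singleton intro: continuous_on_inverse)
    then have "\<forall>\<^sub>F y in at x within S. \<forall>h\<in>{?g}. \<bar>h y - h x\<bar> \<le> \<delta>"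
      using x \<delta>(1) by (rule equi_continuousD)
    with equi_derivativeD(2)[OF d(1) x \<delta>(1)] eventually_at_within_self[of S x]
    show "\<forall>\<^sub>F y in at x within S. \<forall>h\<in>{?g}. \<bar>h y - h x - D h x (y - x)\<bar> \<le> \<epsilon> * norm (y - x)"
    proof eventually_elim
      case (elim y)
      let ?n = "norm (y - x)"
      have gy: "\<bar>?g y - ?g x\<bar> \<le> \<delta>" using elim(3) by simp
      have "?g y - ?g x = - ((f y - f x) * (?g x * ?g y))"
        using nz[OF x] nz[OF elim(2)] by (simp add: field_simps)
      then have eq: "?g y - ?g x - D ?g x (y - x) = - ((f y - f x - d f x (y - x)) * (?g x * ?g y))
          - d f x (y - x) * ?g x * (?g y - ?g x)"
        unfolding D_def by (simp add: algebra_simps)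
      have "\<bar>?g y - ?g x - D ?g x (y - x)\<bar> \<le> \<bar>f y - f x - d f x (y - x)\<bar> * (\<bar>?g x\<bar> * \<bar>?g y\<bar>)
          + \<bar>d f x (y - x)\<bar> * \<bar>?g x\<bar> * \<bar>?g y - ?g x\<bar>"
        unfolding eq abs_mult[symmetric] by linarith
      also have "\<dots> \<le> (\<delta> * ?n) * (R * (R + 1)) + (K * ?n) * R * \<delta>"
      proof (intro add_mono mult_mono)
        show "\<bar>?g y\<bar> \<le> R + 1" using gy \<delta>(2) unfolding R_def by linarith
      qed (use elim(1) K gy \<delta>(1) \<open>R \<ge> 0\<close> in \<open>simp_all add: R_def\<close>)
      also have "\<dots> = \<delta> * (R * (R + 1) + K * R) * ?n" by (simp add: algebra_simps)
      also have "\<dots> \<le> \<delta> * M * ?n" using \<delta>(1) by (intro mult_right_mono mult_left_mono) (auto simp: M_def)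
      also have "\<dots> \<le> \<epsilon> * ?n" by (rule mult_right_mono[OF \<delta>(3)]) simp
      finally show ?case by simp
    qed
  qed
  moreover have "equi_C k S (partials D {?g})"
  proof (rule equi_C_cong[OF equi_C_scale[where R = 1], OF equi_C_mult[OF d(2)]])
    show gg: "equi_C k S {\<lambda>x. ?g x * ?g x}"
      by (rule equi_C_mult2; rule Suc.IH[OF fk])
    fix q assume "q \<in> partials D {?g}"
    then obtain v where v: "norm v \<le> 1" and q: "q = (\<lambda>x. D ?g x v)"
      by (auto elim: partialsE)
    have "(\<lambda>x. d f x v * (?g x * ?g x)) \<in>
        product_set (partials d {f}) {\<lambda>x. ?g x * ?g x}"
      by (rule pointwise_multI[OF partialsI[OF singletonI v] singletonI])
    then show "\<exists>h\<in>multiple_set 1 (product_set (partials d {f}) {\<lambda>x. ?g x * ?g x}).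
        \<forall>x\<in>S. h x = q x"
      by (intro bexI[of _ "\<lambda>x. - 1 * (d f x v * (?g x * ?g x))"] CollectI
          exI[of _ "- 1 :: real"] exI[of _ "\<lambda>x. d f x v * (?g x * ?g x)"]) (auto simp: q D_def)
  qed
  ultimately show ?case by (auto simp: equi_bounded_def)
qed

section \<open>Canonical derivatives and locality\<close>

lemma equi_derivative_has_derivative:
  assumes d: "equi_derivative S F d" and b: "equi_bounded S (partials d F)"
    and S: "open S" and x: "x \<in> S" and f: "f \<in> F"
  shows "(f has_derivative d f x) (at x)"
proof -
  obtain K where K: "K \<ge> 0" "\<And>h v. h \<in> F \<Longrightarrow> \<bar>d h x v\<bar> \<le> K * norm v"
    by (rule equi_derivative_bound[OF d b x]) (rule that)
  have lin: "linear (d f x)" by (rule equi_derivativeD(1)[OF d x f])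
  have "bounded_linear (d f x)"
    by (rule bounded_linear_intro[where K = K])
      (use K(2)[OF f] in \<open>simp_all add: linear_add[OF lin] linear_scale[OF lin] mult.commute\<close>)
  moreover have "\<forall>\<^sub>F y in at x within S. norm (f y - f x - d f x (y - x)) \<le> \<epsilon> * norm (y - x)"
    if "\<epsilon> > 0" for \<epsilon>
    using equi_derivativeD(2)[OF d x that] by eventually_elim (use f in auto)
  ultimately have "(f has_derivative d f x) (at x within S)"
    by (simp add: has_derivative_within_alt2)
  then show ?thesis by (simp only: at_within_open[OF x S])
qed

abbreviation frechet :: "('a::real_normed_vector \<Rightarrow> real) \<Rightarrow> 'a \<Rightarrow> 'a \<Rightarrow> real" where
  "frechet f x \<equiv> frechet_derivative f (at x)"

text \<open>On open sets the derivative is unique, so a globally defined one may be used.  This is what makes the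
notion local: pieces of it on different open sets need no glueing.\<close>

lemma equi_C_Suc_open:
  assumes S: "open S"
  shows "equi_C (Suc k) S F \<longleftrightarrow>
    equi_bounded S F \<and> equi_derivative S F frechet \<and> equi_C k S (partials frechet F)"
proof
  assume "equi_C (Suc k) S F"
  then obtain d where b: "equi_bounded S F" and d: "equi_derivative S F d" "equi_C k S (partials d F)"
    by auto
  have eq: "d f x = frechet f x" if "f \<in> F" "x \<in> S" for f x
    by (rule frechet_derivative_at)
      (rule equi_derivative_has_derivative[OF d(1) equi_C_imp_bounded[OF d(2)] S that(2,1)])
  have "equi_derivative S F frechet"
    using d(1) unfolding equi_derivative_def by (simp add: eq cong: ball_cong)
  moreover have "equi_C k S (partials frechet F)"
  proof (rule equi_C_cong[OF d(2)])
    fix g assume "g \<in> partials frechet F"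
    then obtain f v where f: "f \<in> F" "norm v \<le> 1" and g: "g = (\<lambda>x. frechet f x v)"
      by (rule partialsE)
    show "\<exists>h\<in>partials d F. \<forall>x\<in>S. h x = g x"
      by (rule bexI[OF _ partialsI[OF f]]) (simp add: g eq[OF f(1)])
  qed
  ultimately show "equi_bounded S F \<and> equi_derivative S F frechet \<and> equi_C k S (partials frechet F)"
    using b by (intro conjI)
next
  assume "equi_bounded S F \<and> equi_derivative S F frechet \<and> equi_C k S (partials frechet F)"
  then show "equi_C (Suc k) S F"
    unfolding equi_C.simps by (elim conjE) (intro conjI exI[of _ frechet])
qed

lemma equi_C_local:
  assumes S: "open S"
    and loc: "\<And>x. x \<in> S \<Longrightarrow> \<exists>U. open U \<and> x \<in> U \<and> U \<subseteq> S \<and> equi_C k U F"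
  shows "equi_C k S F"
  using loc
proof (induction k arbitrary: F)
  case 0
  have "equi_bounded S F"
    unfolding equi_bounded_def
  proof
    fix x assume "x \<in> S"
    from 0[OF this] obtain U where "x \<in> U" "equi_bounded U F" by auto
    then show "\<exists>B. \<forall>f\<in>F. \<bar>f x\<bar> \<le> B" unfolding equi_bounded_def by simp
  qed
  moreover have "equi_continuous S F"
    unfolding equi_continuous_def
  proof (intro ballI allI impI)
    fix x and \<epsilon> :: real assume x: "x \<in> S" and \<epsilon>: "\<epsilon> > 0"
    obtain U where U: "open U" "x \<in> U" "U \<subseteq> S" "equi_C 0 U F"
      using 0[OF x] by (elim exE conjE)
    from equi_continuousD[OF equi_C_imp_continuous[OF U(4)] U(2) \<epsilon>]
    show "\<forall>\<^sub>F y in at x within S. \<forall>f\<in>F. \<bar>f y - f x\<bar> \<le> \<epsilon>"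
      by (simp add: at_within_open[OF U(2,1)] at_within_open[OF x S])
  qed
  ultimately show ?case by simp
next
  case (Suc k)
  have *: "\<exists>U. open U \<and> x \<in> U \<and> U \<subseteq> S \<and> equi_bounded U F \<and> equi_derivative U F frechet \<and>
      equi_C k U (partials frechet F)" if "x \<in> S" for x
  proof -
    from Suc.prems[OF that] obtain U where U: "open U" "x \<in> U" "U \<subseteq> S" "equi_C (Suc k) U F"
      by (elim exE conjE)
    from U(4)[unfolded equi_C_Suc_open[OF U(1)]] U(1-3) show ?thesis by (intro exI[of _ U]) simp
  qed
  have "equi_bounded S F"
    unfolding equi_bounded_def
  proof
    fix x assume "x \<in> S"
    from *[OF this] obtain U where "x \<in> U" "equi_bounded U F" by (elim exE conjE)
    then show "\<exists>B. \<forall>f\<in>F. \<bar>f x\<bar> \<le> B" unfolding equi_bounded_def by simp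
  qed
  moreover have "equi_derivative S F frechet"
    unfolding equi_derivative_def
  proof (intro conjI ballI allI impI)
    show "linear (frechet f x)" if "f \<in> F" "x \<in> S" for f x
    proof -
      from *[OF that(2)] obtain U where "x \<in> U" "equi_derivative U F frechet" by (elim exE conjE)
      from equi_derivativeD(1)[OF this(2,1) that(1)] show ?thesis .
    qed
    fix x and \<epsilon> :: real assume x: "x \<in> S" and \<epsilon>: "\<epsilon> > 0"
    obtain U where U: "open U" "x \<in> U" "U \<subseteq> S" "equi_derivative U F frechet"
      using *[OF x] by (elim exE conjE)
    from equi_derivativeD(2)[OF U(4) U(2) \<epsilon>]
    show "\<forall>\<^sub>F y in at x within S. \<forall>f\<in>F. \<bar>f y - f x - frechet f x (y - x)\<bar> \<le> \<epsilon> * norm (y - x)"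
      by (simp add: at_within_open[OF U(2,1)] at_within_open[OF x S])
  qed
  moreover have "equi_C k S (partials frechet F)"
  proof (rule Suc.IH)
    fix x assume "x \<in> S"
    from *[OF this] show "\<exists>U. open U \<and> x \<in> U \<and> U \<subseteq> S \<and> equi_C k U (partials frechet F)"
      by (elim exE conjE) (intro exI conjI)
  qed
  ultimately show ?case unfolding equi_C_Suc_open[OF S] by (intro conjI)
qed

section \<open>Comparison with the Frechet notion\<close>

text \<open>With the derivatives given as multilinear maps on lists, the set at stage \<open>j\<close> consists of the \<open>j\<close>-th
derivative in all lists of unit vectors; a further direction is put at the head of the list.\<close>

lemma equi_C_if_derivatives_upto:
  assumes D: "derivatives_upto k S f D" and "j \<le> k"
  shows "equi_C (k - j) S {\<lambda>x. D j x vs | vs. vs \<in> unit_lists j}"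
proof -
  note DD = derivatives_uptoD[OF D]
  have bdd: "equi_bounded S {\<lambda>x. D j x vs | vs. vs \<in> unit_lists j}" if "j \<le> k" for j
    unfolding equi_bounded_def
  proof
    fix x assume x: "x \<in> S"
    from DD(2)[OF x \<open>j \<le> k\<close>, unfolded bounded_multilinear_def]
    obtain K where K: "\<forall>vs. length vs = j \<longrightarrow> norm (D j x vs) \<le> K * prod_list (map norm vs)"
      by (elim conjE exE)
    have "\<bar>D j x vs\<bar> \<le> \<bar>K\<bar>" if vs: "vs \<in> unit_lists j" for vs
    proof -
      have "prod_list (map norm vs) \<le> 1" if "\<forall>v\<in>set vs. norm v \<le> 1" for vs :: "'a list"
        using that by (induction vs) (auto intro!: mult_le_one prod_list_nonneg)
      then have le: "prod_list (map norm vs) \<le> 1" using vs by (simp add: unit_lists_def)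
      have "0 \<le> prod_list (map norm vs)" by (rule prod_list_nonneg) auto
      then have "K * prod_list (map norm vs) \<le> \<bar>K\<bar> * 1"
        using le by (intro mult_mono) auto
      then show ?thesis using K length_unit_lists[OF vs] by fastforce
    qed
    then show "\<exists>B. \<forall>h\<in>{\<lambda>x. D j x vs | vs. vs \<in> unit_lists j}. \<bar>h x\<bar> \<le> B" by auto
  qed
  show ?thesis
    using \<open>j \<le> k\<close>
  proof (induction "k - j" arbitrary: j)
    case 0
    then have j: "j = k" by simp
    have "equi_continuous S {\<lambda>x. D j x vs | vs. vs \<in> unit_lists j}"
      unfolding equi_continuous_def
    proof (intro ballI allI impI)
      fix x and \<epsilon> :: real assume x: "x \<in> S" and \<epsilon>: "\<epsilon> > 0"
      from DD(4)[OF x \<epsilon>]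
      show "\<forall>\<^sub>F y in at x within S. \<forall>h\<in>{\<lambda>x. D j x vs | vs. vs \<in> unit_lists j}. \<bar>h y - h x\<bar> \<le> \<epsilon>"
        unfolding j by eventually_elim auto
    qed
    then show ?case using bdd[of j] j by simp
  next
    case (Suc i)
    let ?F = "{\<lambda>x. D j x vs | vs. vs \<in> unit_lists j}"
    have j: "j < k" and i: "i = k - Suc j" using Suc.hyps(2) by auto
    have "\<exists>p. \<forall>h\<in>?F. p h \<in> unit_lists j \<and> h = (\<lambda>x. D j x (p h))" by (rule bchoice) auto
    then obtain p where p: "\<And>h. h \<in> ?F \<Longrightarrow> p h \<in> unit_lists j" "\<And>h. h \<in> ?F \<Longrightarrow> h = (\<lambda>x. D j x (p h))"
      by blast
    have hz: "h z = D j z (p h)" if "h \<in> ?F" for h z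
      using fun_cong[OF p(2)[OF that]] by auto
    define d where "d h x v = D (Suc j) x (v # p h)" for h x v
    have "equi_derivative S ?F d"
      unfolding equi_derivative_def
    proof (intro conjI ballI allI impI)
      fix h x assume h: "h \<in> ?F" and x: "x \<in> S"
      have "\<And>us ws. length us + 1 + length ws = Suc j \<Longrightarrow> linear (\<lambda>v. D (Suc j) x (us @ v # ws))"
        using DD(2)[OF x, of "Suc j"] j unfolding bounded_multilinear_def by auto
      from this[of "[]" "p h", simplified] show "linear (d h x)"
        using length_unit_lists[OF p(1)[OF h]] by (simp add: d_def[abs_def])
    next
      fix x and \<epsilon> :: real assume x: "x \<in> S" and \<epsilon>: "\<epsilon> > 0"
      from DD(3)[OF x j \<epsilon>]
      show "\<forall>\<^sub>F y in at x within S. \<forall>h\<in>?F. \<bar>h y - h x - d h x (y - x)\<bar> \<le> \<epsilon> * norm (y - x)"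
      proof eventually_elim
        case (elim y)
        show ?case
        proof
          fix h assume h: "h \<in> ?F"
          show "\<bar>h y - h x - d h x (y - x)\<bar> \<le> \<epsilon> * norm (y - x)"
            unfolding hz[OF h, of y] hz[OF h, of x] d_def using bspec[OF elim p(1)[OF h]] by simp
        qed
      qed
    qed
    moreover have "equi_C i S (partials d ?F)"
    proof (rule equi_C_subset)
      show "equi_C i S {\<lambda>x. D (Suc j) x vs | vs. vs \<in> unit_lists (Suc j)}"
        using Suc.hyps(1)[OF i] j i by simp
      show "partials d ?F \<subseteq> {\<lambda>x. D (Suc j) x vs | vs. vs \<in> unit_lists (Suc j)}"
      proof
        fix q assume "q \<in> partials d ?F"
        then obtain h v where h: "h \<in> ?F" and v: "norm v \<le> 1" and q: "q = (\<lambda>x. d h x v)"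
          by (rule partialsE)
        have "v # p h \<in> unit_lists (Suc j)" using p(1)[OF h] v by (simp add: unit_lists_def)
        then show "q \<in> {\<lambda>x. D (Suc j) x vs | vs. vs \<in> unit_lists (Suc j)}"
          unfolding q d_def by blast
      qed
    qed
    ultimately show ?case
      using bdd[of j] j unfolding Suc.hyps(2)[symmetric] by auto
  qed
qed

lemma equi_C_if_C_on:
  assumes "C_on k S f" shows "equi_C k S {f}"
proof -
  obtain D where D: "derivatives_upto k S f D" using assms by (auto simp: C_on_def)
  have "equi_C k S {\<lambda>x. D 0 x vs | vs. vs \<in> unit_lists 0}"
    using equi_C_if_derivatives_upto[OF D, of 0] by simp
  then show ?thesis
    by (rule equi_C_cong) (use derivatives_uptoD(1)[OF D] in auto)
qed

text \<open>Iterated derivatives: the head of the list is the most recent direction.\<close>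

primrec iter_frechet :: "('a::real_normed_vector \<Rightarrow> real) \<Rightarrow> 'a list \<Rightarrow> 'a \<Rightarrow> real" where
  "iter_frechet f [] = f"
| "iter_frechet f (v # vs) = (\<lambda>x. frechet (iter_frechet f vs) x v)"

text \<open>Arbitrary radii \<open>R\<close> are allowed because multilinearity is about all vectors, not only unit vectors.\<close>

lemma equi_C_iter_frechet:
  assumes S: "open S" and f: "equi_C k S {f}" and "j \<le> k"
  shows "equi_C (k - j) S {iter_frechet f vs | vs. length vs = j \<and> (\<forall>v\<in>set vs. norm v \<le> R)}"
  using \<open>j \<le> k\<close>
proof (induction j)
  case 0
  then show ?case using equi_C_subset[OF f, of "{iter_frechet f vs | vs. vs = []}"]
    by (auto simp del: equi_C.simps cong: conj_cong)
next
  case (Suc j)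
  let ?F = "{iter_frechet f vs | vs. length vs = j \<and> (\<forall>v\<in>set vs. norm v \<le> R)}"
  have "k - j = Suc (k - Suc j)" using Suc.prems by simp
  then have F: "equi_derivative S ?F frechet" "equi_C (k - Suc j) S (partials frechet ?F)"
    using Suc.IH Suc.prems equi_C_Suc_open[OF S] by auto
  show ?case
  proof (rule equi_C_cong[OF equi_C_scale[OF F(2), of "max R 1"]])
    fix g assume "g \<in> {iter_frechet f vs | vs. length vs = Suc j \<and> (\<forall>v\<in>set vs. norm v \<le> R)}"
    then obtain v ws where ws: "length ws = j" "\<forall>v\<in>set ws. norm v \<le> R" "norm v \<le> R"
      and g: "g = iter_frechet f (v # ws)"
      by (auto simp: length_Suc_conv)
    define c where "c = max R 1"
    have c: "c > 0" "\<bar>c\<bar> \<le> max R 1" by (auto simp: c_def)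
    have "norm (v /\<^sub>R c) \<le> 1" using ws(3) c(1) by (simp add: c_def field_simps)
    have wsF: "iter_frechet f ws \<in> ?F" using ws by blast
    show "\<exists>h\<in>multiple_set (max R 1) (partials frechet ?F). \<forall>x\<in>S. h x = g x"
    proof (rule bexI[of _ "\<lambda>x. c * frechet (iter_frechet f ws) x (v /\<^sub>R c)"], rule ballI)
      fix x assume x: "x \<in> S"
      from equi_derivativeD(1)[OF F(1) x wsF]
      show "c * frechet (iter_frechet f ws) x (v /\<^sub>R c) = g x"
        using c(1) by (simp add: g linear_scale)
    next
      show "(\<lambda>x. c * frechet (iter_frechet f ws) x (v /\<^sub>R c)) \<in>
          multiple_set (max R 1) (partials frechet ?F)"
        by (rule pointwise_scaleI[OF c(2) partialsI[OF wsF \<open>norm (v /\<^sub>R c) \<le> 1\<close>]])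
    qed
  qed
qed

text \<open>One argument after the other is normalised.\<close>

lemma multilinear_bound:
  fixes m :: "'a::real_normed_vector list \<Rightarrow> real"
  assumes lin: "\<And>us ws. length us + 1 + length ws = n \<Longrightarrow> linear (\<lambda>v. m (us @ v # ws))"
    and B: "\<And>vs. vs \<in> unit_lists n \<Longrightarrow> \<bar>m vs\<bar> \<le> B"
    and "length vs = n"
  shows "\<bar>m vs\<bar> \<le> B * prod_list (map norm vs)"
proof -
  have "\<bar>m (us @ ws)\<bar> \<le> B * prod_list (map norm us)"
    if "length us + length ws = n" "\<forall>w\<in>set ws. norm w \<le> 1" for us ws
    using that
  proof (induction us arbitrary: ws rule: rev_induct)
    case Nil
    then show ?case using B[of ws] by (simp add: unit_lists_def)
  next
    case (snoc u us)
    have l: "linear (\<lambda>v. m (us @ v # ws))" using snoc.prems by (intro lin) auto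
    show ?case
    proof (cases "u = 0")
      case True
      then show ?thesis using linear_0[OF l] by simp
    next
      case False
      have "\<bar>m (us @ (u /\<^sub>R norm u) # ws)\<bar> \<le> B * prod_list (map norm us)"
        using snoc.prems False by (intro snoc.IH) auto
      moreover have "m (us @ u # ws) = norm u * m (us @ (u /\<^sub>R norm u) # ws)"
        using linear_scale[OF l, of "norm u" "u /\<^sub>R norm u"] False by simp
      ultimately show ?thesis
        by (simp add: abs_mult mult_left_mono mult.commute[of "norm u"] mult_right_mono flip: mult.assoc)
    qed
  qed
  from this[of vs "[]"] show ?thesis using assms(3) by simp
qed

text \<open>The iterated Frechet derivatives serve as derivatives.  Linearity in the head of the list is linearity of a derivative; in the other
arguments it is inherited, since a derivative depends linearly on the function.\<close>

lemma C_on_if_equi_C: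
  assumes S: "open S" and f: "equi_C k S {f}"
  shows "C_on k S f"
proof -
  let ?F = "\<lambda>j R. {iter_frechet f vs | vs. length vs = j \<and> (\<forall>v\<in>set vs. norm v \<le> R)}"
  have F: "equi_bounded S (?F j R)" "j < k \<Longrightarrow> equi_derivative S (?F j R) frechet"
    if "j \<le> k" for j R
  proof -
    note * = equi_C_iter_frechet[OF S f that, of R]
    show "equi_bounded S (?F j R)" by (rule equi_C_imp_bounded[OF *])
    assume "j < k"
    then have "k - j = Suc (k - Suc j)" by simp
    with * show "equi_derivative S (?F j R) frechet" using equi_C_Suc_open[OF S] by auto
  qed
  have hd: "(iter_frechet f vs has_derivative frechet (iter_frechet f vs) x) (at x)"
    if "length vs < k" "x \<in> S" for vs x
  proof -
    define R where "R = sum_list (map norm vs)"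
    have "norm v \<le> R" if "v \<in> set vs" for v
      unfolding R_def using that by (intro member_le_sum_list) auto
    then have vs: "iter_frechet f vs \<in> ?F (length vs) R" by blast
    have "k - length vs = Suc (k - Suc (length vs))" using that(1) by simp
    with equi_C_iter_frechet[OF S f, of "length vs" R] that(1)
    have "equi_derivative S (?F (length vs) R) frechet"
        "equi_C (k - Suc (length vs)) S (partials frechet (?F (length vs) R))"
      using equi_C_Suc_open[OF S] by auto
    from equi_derivative_has_derivative[OF this(1) equi_C_imp_bounded[OF this(2)] S that(2) vs]
    show ?thesis .
  qed
  have lin: "linear (\<lambda>v. iter_frechet f (us @ v # ws) x)"
    if "length us + 1 + length ws \<le> k" "x \<in> S" for us ws x
    using that
  proof (induction us arbitrary: x)
    case Nil
    then show ?case
      using has_derivative_linear[OF hd[of ws x]] by simp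
  next
    case (Cons u us)
    let ?g = "\<lambda>v. iter_frechet f (us @ v # ws)"
    have hd': "(?g v has_derivative frechet (?g v) x) (at x)" for v
      using Cons.prems by (intro hd) auto
    have IH: "linear (\<lambda>v. ?g v y)" if "y \<in> S" for y
      using Cons.prems that by (intro Cons.IH) auto
    have "frechet (?g (a + b)) x = (\<lambda>w. frechet (?g a) x w + frechet (?g b) x w)" for a b
    proof (rule frechet_derivative_at[symmetric])
      show "(?g (a + b) has_derivative (\<lambda>w. frechet (?g a) x w + frechet (?g b) x w)) (at x)"
        by (rule has_derivative_transform_within_open[OF has_derivative_add[OF hd'[of a] hd'[of b]] S])
          (use Cons.prems linear_add[OF IH] in auto)
    qed
    moreover have "frechet (?g (c *\<^sub>R a)) x = (\<lambda>w. c *\<^sub>R frechet (?g a) x w)" for c a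
    proof (rule frechet_derivative_at[symmetric])
      show "(?g (c *\<^sub>R a) has_derivative (\<lambda>w. c *\<^sub>R frechet (?g a) x w)) (at x)"
        by (rule has_derivative_transform_within_open[OF has_derivative_scaleR_right[OF hd'[of a]] S])
          (use Cons.prems linear_scale[OF IH] in auto)
    qed
    ultimately show ?case by (intro linearI) simp_all
  qed
  show ?thesis
    unfolding C_on_def derivatives_upto_def
  proof (intro exI[of _ "\<lambda>j x vs. iter_frechet f vs x"] conjI ballI allI impI)
    fix j x assume j: "j \<le> k" and x: "x \<in> S"
    obtain B where "\<And>h. h \<in> ?F j 1 \<Longrightarrow> \<bar>h x\<bar> \<le> B"
      using F(1)[OF j, of 1] x unfolding equi_bounded_def by blast
    then have B: "\<bar>iter_frechet f vs x\<bar> \<le> B" if "vs \<in> unit_lists j" for vs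
      using that unfolding unit_lists_def by blast
    show "bounded_multilinear j (\<lambda>vs. iter_frechet f vs x)"
      unfolding bounded_multilinear_def
    proof (intro conjI allI impI exI)
      show "linear (\<lambda>v. iter_frechet f (us @ v # ws) x)" if "length us + 1 + length ws = j" for us ws
        using that j x by (intro lin) auto
      then show "norm (iter_frechet f vs x) \<le> B * prod_list (map norm vs)" if "length vs = j" for vs
        unfolding real_norm_def using that B
        by (intro multilinear_bound[where m = "\<lambda>vs. iter_frechet f vs x"]) auto
    qed
  next
    fix j x and \<epsilon> :: real assume j: "j < k" and x: "x \<in> S" and \<epsilon>: "\<epsilon> > 0"
    have "equi_derivative S (?F j 1) frechet" using F(2)[of j] j by simp
    from equi_derivativeD(2)[OF this x \<epsilon>]
    show "\<forall>\<^sub>F y in at x within S. \<forall>vs\<in>unit_lists j. norm (iter_frechet f vs y - iter_frechet f vs x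
        - iter_frechet f ((y - x) # vs) x) \<le> \<epsilon> * norm (y - x)"
      by eventually_elim (auto simp: unit_lists_def)
  next
    fix x and \<epsilon> :: real assume x: "x \<in> S" and \<epsilon>: "\<epsilon> > 0"
    have "equi_continuous S (?F k 1)"
      using equi_C_imp_continuous[OF equi_C_iter_frechet[OF S f order_refl, of 1]] .
    from equi_continuousD[OF this x \<epsilon>]
    show "\<forall>\<^sub>F y in at x within S. \<forall>vs\<in>unit_lists k. norm (iter_frechet f vs y - iter_frechet f vs x) \<le> \<epsilon>"
      by eventually_elim (auto simp: unit_lists_def)
  qed simp
qed

section \<open>An implicit function theorem\<close>

lemma equi_C_SucI:
  assumes d: "\<And>x. x \<in> S \<Longrightarrow> (f has_derivative d x) (at x within S)"
    and k: "equi_C k S {\<lambda>x. d x v | v. norm v \<le> 1}"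
  shows "equi_C (Suc k) S {f}"
proof -
  have "equi_derivative S {f} (\<lambda>h. d)"
    unfolding equi_derivative_def
  proof (intro conjI ballI allI impI)
    show "linear (d x)" if "x \<in> S" for x by (rule has_derivative_linear[OF d[OF that]])
    fix x and \<epsilon> :: real assume x: "x \<in> S" and \<epsilon>: "\<epsilon> > 0"
    then have "\<forall>\<^sub>F y in at x within S. norm (f y - f x - d x (y - x)) \<le> \<epsilon> * norm (y - x)"
      using d[OF x] unfolding has_derivative_within_alt2 by blast
    then show "\<forall>\<^sub>F y in at x within S. \<forall>f\<in>{f}. \<bar>f y - f x - d x (y - x)\<bar> \<le> \<epsilon> * norm (y - x)"
      by eventually_elim simp
  qed
  moreover have "partials (\<lambda>h. d) {f} = {\<lambda>x. d x v | v. norm v \<le> 1}"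
    by (auto simp: partials_def)
  moreover have "equi_bounded S {f}" by (auto simp: equi_bounded_def)
  ultimately show ?thesis
    unfolding equi_C.simps using k by (intro conjI exI[of _ "\<lambda>h. d"]) simp_all
qed

lemma equi_C_compose_real:
  assumes \<rho>: "equi_C k S {\<rho>}" and f: "equi_C k UNIV {f}"
  shows "equi_C k S {\<lambda>x. f (\<rho> x)}"
  by (rule equi_C_cong[OF equi_C_comp[OF bounded_linear_zero \<rho> f, of 1]]) auto

lemma equi_C_compose_linear:
  assumes \<Lambda>: "bounded_linear \<Lambda>" and f: "equi_C k V {f}" and V: "\<And>x. x \<in> S \<Longrightarrow> \<Lambda> x \<in> V"
  shows "equi_C k S {\<lambda>x. f (\<Lambda> x)}"
  by (rule equi_C_cong[OF equi_C_comp[OF \<Lambda> equi_C_const[of k S 0] f, of 0]]) (use V in auto)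

text \<open>The function \<open>\<nu>\<close> is given and Lipschitz; what remains is its regularity.  Inserting the graph into the derivative of \<open>H\<close> yields
\<open>\<nu>'(w) v = - H'(w, \<nu>(w))(v, 0) / H'(w, \<nu>(w))(0, 1)\<close>, where the denominator is at most \<open>-1\<close> by
the slope condition.  The right-hand side is \<open>C\<^sup>j\<close> whenever \<open>\<nu>\<close> is, so regularity is gained step by step
up to that of \<open>H\<close>.\<close>

lemma equi_C_implicit:
  fixes H :: "'a::real_normed_vector \<times> real \<Rightarrow> real"
  assumes V: "open V" and H: "equi_C (Suc k) V {H}"
    and slope: "\<And>w s t. (w, s) \<in> V \<Longrightarrow> (w, t) \<in> V \<Longrightarrow> s \<le> t \<Longrightarrow> H (w, t) - H (w, s) \<le> - (t - s)"
    and graph: "\<And>w. w \<in> S \<Longrightarrow> (w, \<nu> w) \<in> V" and zero: "\<And>w. w \<in> S \<Longrightarrow> H (w, \<nu> w) = 0"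
    and lip: "\<And>w y. w \<in> S \<Longrightarrow> y \<in> S \<Longrightarrow> \<bar>\<nu> y - \<nu> w\<bar> \<le> C * norm (y - w)"
  shows "equi_C (Suc k) S {\<nu>}"
proof -
  obtain d where d: "equi_derivative V {H} d" "equi_C k V (partials d {H})" using H by auto
  define p where "p w = d H (w, \<nu> w)" for w
  define q where "q w = p w (0, 1)" for w
  have hd: "(H has_derivative p w) (at (w, \<nu> w))" if "w \<in> S" for w
    unfolding p_def
    by (rule equi_derivative_has_derivative[OF d(1) equi_C_imp_bounded[OF d(2)] V graph[OF that]]) simp
  have q: "q w \<le> -1" if w: "w \<in> S" for w
  \<comment> \<open>Otherwise \<open>H (w, t) + t\<close> would increase strictly to the right of \<open>t = \<nu> w\<close>.\<close>
  proof (rule ccontr)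
    assume "\<not> q w \<le> -1"
    have lin: "linear (p w)" by (rule has_derivative_linear[OF hd[OF w]])
    have "((\<lambda>s. H (w, \<nu> w + s)) has_derivative (\<lambda>s. p w (0, s))) (at 0)"
    proof (rule has_derivative_compose[where g = H and f = "\<lambda>s. (w, \<nu> w + s)"])
      show "((\<lambda>s. (w, \<nu> w + s)) has_derivative (\<lambda>s. (0, s))) (at 0)"
        by (auto intro!: derivative_eq_intros)
      show "(H has_derivative p w) (at (w, \<nu> w + 0))" using hd[OF w] by simp
    qed
    moreover have "p w (0, s) = q w * s" for s
      using linear_scale[OF lin, of s "(0, 1)"] by (simp add: q_def mult.commute)
    ultimately have "((\<lambda>s. H (w, \<nu> w + s)) has_real_derivative q w) (at 0)"
      by (simp add: has_field_derivative_def)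
    then have "((\<lambda>s. H (w, \<nu> w + s) + s) has_real_derivative (q w + 1)) (at 0)"
      by (auto intro!: derivative_eq_intros)
    from DERIV_pos_inc_right[OF this] \<open>\<not> q w \<le> -1\<close> obtain e where e: "e > 0"
      "\<And>s. s > 0 \<Longrightarrow> s < e \<Longrightarrow> H (w, \<nu> w) < H (w, \<nu> w + s) + s" by auto
    obtain A B where AB: "open A" "open B" "w \<in> A" "\<nu> w \<in> B" "A \<times> B \<subseteq> V"
      by (rule open_prod_elim[OF V graph[OF w]]) (use that in auto)
    obtain e' where e': "e' > 0" "ball (\<nu> w) e' \<subseteq> B" using AB(2,4) open_contains_ball by blast
    define s where "s = min e e' / 2"
    have s: "s > 0" "s < e" "s < e'" using e e' by (auto simp: s_def)
    have "\<nu> w + s \<in> ball (\<nu> w) e'" using s by (simp add: dist_real_def)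
    then have "(w, \<nu> w + s) \<in> V" using e'(2) AB(3,5) by blast
    from slope[OF graph[OF w] this] e(2)[OF s(1,2)] s(1) show False by simp
  qed
  define n where "n w v = - (p w (v, 0)) * inverse (q w)" for w v
  have cont: "continuous_on S \<nu>"
  proof (rule lipschitz_on_continuous_on)
    have "\<bar>\<nu> y - \<nu> w\<bar> \<le> max C 0 * norm (y - w)" if "w \<in> S" "y \<in> S" for w y
      using lip[OF that] mult_right_mono[of C "max C 0" "norm (y - w)"] by simp
    then show "(max C 0)-lipschitz_on S \<nu>"
      by (intro lipschitz_onI) (auto simp: dist_norm)
  qed
  have der: "(\<nu> has_derivative n w) (at w within S)" if w: "w \<in> S" for w
    unfolding has_derivative_within_alt2
  proof (intro conjI allI impI)
    have bl: "bounded_linear (p w)" by (rule has_derivative_bounded_linear[OF hd[OF w]])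
    have "bounded_linear (\<lambda>v. p w (v, 0))"
      by (rule bounded_linear_compose[OF bl]) (intro bounded_linear_Pair bounded_linear_ident bounded_linear_zero)
    then show "bounded_linear (n w)"
      unfolding n_def by (intro bounded_linear_mult_left[THEN bounded_linear_compose] bounded_linear_minus)
    have lin: "linear (p w)" using bl by (rule bounded_linear.linear)
    fix \<epsilon> :: real assume \<epsilon>: "\<epsilon> > 0"
    define K where "K = 1 + \<bar>C\<bar>"
    have K: "K > 0" by (simp add: K_def add_pos_nonneg)
    have "\<epsilon> / K > 0" using \<epsilon> K by simp
    from hd[OF w, unfolded has_derivative_within_alt2, THEN conjunct2, rule_format, OF this]
    have "\<forall>\<^sub>F y in at w within S. norm (H (y, \<nu> y) - H (w, \<nu> w) - p w ((y, \<nu> y) - (w, \<nu> w)))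
        \<le> \<epsilon> / K * norm ((y, \<nu> y) - (w, \<nu> w))"
    proof (intro eventually_within_compose[where V = UNIV and h = "\<lambda>y. (y, \<nu> y)" and
          P = "\<lambda>z. norm (H z - H (w, \<nu> w) - p w (z - (w, \<nu> w))) \<le> \<epsilon> / K * norm (z - (w, \<nu> w))"])
      show "continuous (at w within S) (\<lambda>y. (y, \<nu> y))"
        using cont w by (intro continuous_intros) (simp add: continuous_on_eq_continuous_within)
    qed (simp_all add: linear_0[OF lin])
    with eventually_at_within_self[of S w]
    show "\<forall>\<^sub>F y in at w within S. norm (\<nu> y - \<nu> w - n w (y - w)) \<le> \<epsilon> * norm (y - w)"
    proof eventually_elim
      case (elim y)
      let ?h = "norm (y - w)"
      have "p w ((y, \<nu> y) - (w, \<nu> w)) = p w (y - w, 0) + (\<nu> y - \<nu> w) * q w"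
        using linear_add[OF lin, of "(y - w, 0)" "(\<nu> y - \<nu> w) *\<^sub>R (0, 1)"]
          linear_scale[OF lin, of "\<nu> y - \<nu> w" "(0, 1)"] by (simp add: q_def)
      then have "\<bar>p w (y - w, 0) + (\<nu> y - \<nu> w) * q w\<bar> \<le> \<epsilon> / K * norm (y - w, \<nu> y - \<nu> w)"
        using elim zero[OF w] zero[of y] by (simp add: abs_minus_commute)
      also have "norm (y - w, \<nu> y - \<nu> w) \<le> ?h + \<bar>C\<bar> * ?h"
      proof (rule order_trans[OF norm_Pair_le add_left_mono])
        show "norm (\<nu> y - \<nu> w) \<le> \<bar>C\<bar> * ?h"
          using lip[OF w elim(1)] mult_right_mono[OF abs_ge_self[of C] norm_ge_zero[of "y - w"]]
          unfolding real_norm_def by linarith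
      qed
      then have "\<epsilon> / K * norm (y - w, \<nu> y - \<nu> w) \<le> \<epsilon> / K * (K * ?h)"
        using \<open>\<epsilon> / K > 0\<close> by (intro mult_left_mono) (auto simp: K_def algebra_simps)
      also have "\<dots> = \<epsilon> * ?h" using K by simp
      finally have 1: "\<bar>p w (y - w, 0) + (\<nu> y - \<nu> w) * q w\<bar> \<le> \<epsilon> * ?h" .
      have "1 \<le> \<bar>q w\<bar>" using q[OF w] by linarith
      then have q0: "q w \<noteq> 0" "\<bar>inverse (q w)\<bar> \<le> 1"
        by (auto simp only: abs_inverse inverse_le_1_iff)
      have "\<nu> y - \<nu> w - n w (y - w) = (p w (y - w, 0) + (\<nu> y - \<nu> w) * q w) * inverse (q w)"
        using q0(1) by (simp add: n_def field_simps)
      then have "norm (\<nu> y - \<nu> w - n w (y - w)) =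
          \<bar>p w (y - w, 0) + (\<nu> y - \<nu> w) * q w\<bar> * \<bar>inverse (q w)\<bar>"
        by (simp add: abs_mult)
      also have "\<dots> \<le> (\<epsilon> * ?h) * 1"
        by (rule mult_mono[OF 1 q0(2)]) (use \<epsilon> in auto)
      finally show ?case by simp
    qed
  qed
  have "equi_C j S {\<nu>}" if "j \<le> Suc k" for j
    using that
  proof (induction j)
    case 0
    show ?case using cont by (simp add: equi_C_0_singleton del: equi_C.simps)
  next
    case (Suc j)
    let ?F = "partials d {H}"
    let ?G = "{\<lambda>w. f ((w, 0) + \<nu> w *\<^sub>R (0, 1)) | f. f \<in> ?F}"
    have "equi_C j V ?F" using equi_C_le[OF d(2)] Suc.prems by simp
    then have G: "equi_C j S ?G"
      using Suc graph
      by (intro equi_C_comp[where V = V] bounded_linear_Pair bounded_linear_ident bounded_linear_zero) auto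
    have pG: "\<exists>g\<in>?G. \<forall>w\<in>S. g w = p w v" if "norm v \<le> 1" for v
      by (rule bexI[of _ "\<lambda>w. d H ((w, 0) + \<nu> w *\<^sub>R (0, 1)) v"])
        (use partialsI[of H "{H}" v d] that in \<open>auto simp: p_def\<close>)
    have "equi_C j S {q}"
      by (rule equi_C_cong[OF G]) (use pG[of "(0, 1)"] in \<open>auto simp: q_def norm_Pair\<close>)
    then have iq: "equi_C j S {\<lambda>w. inverse (q w)}"
      by (rule equi_C_inverse) (use q in force)
    have "equi_C j S {\<lambda>w. p w v | v. norm v \<le> 1}"
      by (rule equi_C_cong[OF G]) (use pG in auto)
    from equi_C_mult[OF this equi_C_mult2[OF equi_C_const[of j S "-1"] iq]]
    have "equi_C j S {\<lambda>w. n w v | v. norm v \<le> 1}"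
    proof (rule equi_C_cong)
      fix g assume "g \<in> {\<lambda>w. n w v | v. norm v \<le> 1}"
      then obtain v where v: "norm v \<le> 1" and g: "g = (\<lambda>w. n w v)" by auto
      have "norm (v, 0::real) \<le> 1" using v by (simp add: norm_Pair)
      then have "(\<lambda>w. p w (v, 0)) \<in> {\<lambda>w. p w v | v. norm v \<le> 1}" by blast
      note mem = pointwise_multI[OF this singletonI]
      show "\<exists>f\<in>product_set {\<lambda>w. p w v | v. norm v \<le> 1} {\<lambda>x. - 1 * inverse (q x)}. \<forall>w\<in>S. f w = g w"
        by (rule bexI[OF _ mem]) (simp add: g n_def)
    qed
    then show ?case by (rule equi_C_SucI[rotated, where d = n]) (rule der)
  qed
  then show ?thesis by blast
qed

section \<open>A smooth convex barrier\<close>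

text \<open>A family closed under differentiation up to linear combinations, \<open>\<phi>\<^sub>n' = \<phi>\<^bsub>n+2\<^esub> - n \<phi>\<^bsub>n+1\<^esub>\<close>,
which makes the smoothness of the flat function \<open>exp (- 1 / z)\<close> a simple induction.\<close>

definition flat_deriv :: "nat \<Rightarrow> real \<Rightarrow> real" where
  "flat_deriv n z = (if z > 0 then inverse z ^ n * exp (- inverse z) else 0)"

lemma flat_deriv_tendsto_0: "(flat_deriv n \<longlongrightarrow> 0) (at 0)"
proof (rule filterlim_split_at_real)
  show "(flat_deriv n \<longlongrightarrow> 0) (at_left 0)"
  proof (rule Lim_transform_eventually[OF tendsto_const])
    show "\<forall>\<^sub>F z in at_left 0. 0 = flat_deriv n z"
      by (auto simp: eventually_at_filter flat_deriv_def)
  qed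
  have "((\<lambda>z. inverse z ^ n / exp (inverse z)) \<longlongrightarrow> 0) (at_right (0::real))"
    by (rule filterlim_compose[OF tendsto_power_div_exp_0 filterlim_inverse_at_top_right])
  then show "(flat_deriv n \<longlongrightarrow> 0) (at_right 0)"
  proof (rule Lim_transform_eventually)
    show "\<forall>\<^sub>F z in at_right 0. inverse z ^ n / exp (inverse z) = flat_deriv n z"
      by (auto simp: eventually_at_filter flat_deriv_def exp_minus divide_inverse)
  qed
qed

lemma flat_deriv_has_derivative:
  "(flat_deriv n has_real_derivative flat_deriv (n + 2) z - n * flat_deriv (n + 1) z) (at z)"
proof -
  consider "z < 0" | "z = 0" | "z > 0" by linarith
  then show ?thesis
  proof cases
    case 1
    have "((\<lambda>_. 0) has_real_derivative 0) (at z)" by simp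
    from has_field_derivative_transform_within_open[OF this, of "{..<0}" "flat_deriv n"] 1
    show ?thesis by (simp add: flat_deriv_def)
  next
    case 2
    have "((\<lambda>h. (flat_deriv n (0 + h) - flat_deriv n 0) / h) \<longlongrightarrow> 0) (at 0)"
      by (rule Lim_transform_eventually[OF flat_deriv_tendsto_0[of "Suc n"]])
        (auto simp: flat_deriv_def divide_inverse intro!: always_eventually)
    then show ?thesis using 2 by (simp add: DERIV_def flat_deriv_def)
  next
    case 3
    have "((\<lambda>z. inverse z ^ n * exp (- inverse z)) has_real_derivative
        flat_deriv (n + 2) z - n * flat_deriv (n + 1) z) (at z)"
    proof (rule DERIV_cong)
      have i: "(inverse has_real_derivative - (inverse z ^ Suc (Suc 0))) (at z)"
        by (rule DERIV_inverse) (use 3 in simp)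
      show "((\<lambda>z. inverse z ^ n * exp (- inverse z)) has_real_derivative
          (of_nat n * (- (inverse z ^ Suc (Suc 0)) * inverse z ^ (n - Suc 0))) * exp (- inverse z) +
          (exp (- inverse z) * - (- (inverse z ^ Suc (Suc 0)))) * inverse z ^ n) (at z)"
        by (rule DERIV_mult[OF DERIV_power[OF i] DERIV_chain2[OF DERIV_exp DERIV_minus[OF i]]])
      show "(of_nat n * (- (inverse z ^ Suc (Suc 0)) * inverse z ^ (n - Suc 0))) * exp (- inverse z) +
          (exp (- inverse z) * - (- (inverse z ^ Suc (Suc 0)))) * inverse z ^ n =
          flat_deriv (n + 2) z - n * flat_deriv (n + 1) z"
        using 3 by (cases n) (simp_all add: flat_deriv_def algebra_simps)
    qed
    from has_field_derivative_transform_within_open[OF this, of "{0<..}" "flat_deriv n"] 3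
    show ?thesis by (simp add: flat_deriv_def)
  qed
qed

lemma equi_C_flat_deriv: "equi_C k UNIV {flat_deriv n}"
proof (induction k arbitrary: n)
  case 0
  show ?case
    unfolding equi_C_0_singleton
    by (intro continuous_at_imp_continuous_on ballI DERIV_isCont[OF flat_deriv_has_derivative])
next
  case (Suc k)
  let ?g = "\<lambda>z. flat_deriv (n + 2) z - n * flat_deriv (n + 1) z"
  have "equi_C k UNIV {?g}"
    by (intro equi_C_diff2 equi_C_mult2 equi_C_const Suc.IH)
  from equi_C_scale[OF this, of 1]
  have "equi_C k UNIV {\<lambda>z. ?g z * v | v. norm v \<le> 1}"
    by (rule equi_C_cong) (auto simp: mult.commute)
  then show ?case
    by (intro equi_C_SucI[where d = "\<lambda>z v. ?g z * v"])
      (use flat_deriv_has_derivative[of n] in \<open>simp_all add: has_field_derivative_def\<close>)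
qed

text \<open>The factor \<open>z\<^sup>2\<close> makes the function convex on the whole line, and of faster than linear growth.\<close>

definition flat :: "real \<Rightarrow> real" where
  "flat z = z * z * flat_deriv 0 z"

lemma equi_C_flat: "equi_C k UNIV {flat}"
  unfolding flat_def[abs_def]
  by (intro equi_C_mult2 equi_C_flat_deriv equi_C_bounded_linear[of "\<lambda>z. z"] bounded_linear_ident)

lemma flat_nonpos: "z \<le> 0 \<Longrightarrow> flat z = 0"
  by (simp add: flat_def flat_deriv_def)

lemma convex_flat: "convex_on UNIV flat"
proof (rule convex_on_realI)
  let ?g = "\<lambda>z. (2 * z + 1) * flat_deriv 0 z"
  show "(flat has_real_derivative ?g z) (at z)" for z
  proof -
    have "(flat has_real_derivative (2 * z) * flat_deriv 0 z + z * z * flat_deriv 2 z) (at z)"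
      unfolding flat_def[abs_def]
      using DERIV_mult[OF DERIV_mult[OF DERIV_ident DERIV_ident] flat_deriv_has_derivative[of 0 z]]
      by (simp add: algebra_simps numeral_2_eq_2)
    also have "z * z * flat_deriv 2 z = flat_deriv 0 z"
      by (simp add: flat_deriv_def power2_eq_square field_simps)
    finally show ?thesis by (simp add: algebra_simps)
  qed
  show "?g x \<le> ?g y" if "x \<le> y" for x y
  proof (cases "x > 0")
    case True
    then show ?thesis using that
      by (auto simp: flat_deriv_def intro!: mult_mono le_imp_inverse_le)
  next
    case False
    then show ?thesis by (simp add: flat_deriv_def)
  qed
qed simp

text \<open>The perspective of \<open>flat\<close>.  It inherits joint convexity, and it is positively homogeneous; together these give
subadditivity.\<close>

definition persp :: "real \<Rightarrow> real \<Rightarrow> real" where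
  "persp l \<mu> = \<mu> * flat (l / \<mu>)"

lemma persp_eq: "l > 0 \<Longrightarrow> \<mu> > 0 \<Longrightarrow> persp l \<mu> = l\<^sup>2 / \<mu> * exp (- (\<mu> / l))"
  by (simp add: persp_def flat_def flat_deriv_def power2_eq_square)

lemma persp_nonpos: "l \<le> 0 \<Longrightarrow> \<mu> > 0 \<Longrightarrow> persp l \<mu> = 0"
  by (simp add: persp_def flat_nonpos divide_nonpos_pos)

lemma persp_nonneg: "\<mu> > 0 \<Longrightarrow> 0 \<le> persp l \<mu>"
  by (cases "l > 0") (auto simp: persp_eq persp_nonpos)

lemma persp_mono:
  assumes "l' \<le> l" "0 < \<mu>" "\<mu> \<le> \<mu>'" shows "persp l' \<mu>' \<le> persp l \<mu>"
proof (cases "l' > 0")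
  case True
  have "l'\<^sup>2 / \<mu>' * exp (- (\<mu>' / l')) \<le> l\<^sup>2 / \<mu> * exp (- (\<mu> / l))"
    using assms True by (intro mult_mono frac_le power_mono) (auto intro!: frac_le)
  then show ?thesis using assms True by (simp add: persp_eq)
next
  case False
  then show ?thesis using assms persp_nonneg[of \<mu> l] by (simp add: persp_nonpos)
qed

text \<open>The quotient \<open>(l + l') / (\<mu> + \<mu>')\<close> is the convex combination of \<open>l / \<mu>\<close> and \<open>l' / \<mu>'\<close> with weights
proportional to \<open>\<mu>\<close> and \<open>\<mu>'\<close>.\<close>

lemma persp_subadditive:
  assumes "\<mu> > 0" "\<mu>' > 0"
  shows "persp (l + l') (\<mu> + \<mu>') \<le> persp l \<mu> + persp l' \<mu>'"
proof -
  define s where "s = \<mu>' / (\<mu> + \<mu>')"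
  have s: "0 \<le> s" "s \<le> 1" "(\<mu> + \<mu>') * s = \<mu>'" "(\<mu> + \<mu>') * (1 - s) = \<mu>"
    using assms by (auto simp: s_def field_simps)
  have "(l + l') / (\<mu> + \<mu>') = (1 - s) * (l / \<mu>) + s * (l' / \<mu>')"
  proof -
    have "(\<mu> + \<mu>') * ((1 - s) * (l / \<mu>) + s * (l' / \<mu>')) = \<mu> * (l / \<mu>) + \<mu>' * (l' / \<mu>')"
      using s(3,4) by (simp only: distrib_left mult.assoc[symmetric])
    also have "\<dots> = l + l'" using assms by simp
    finally show ?thesis using assms by (simp add: field_simps)
  qed
  then have "flat ((l + l') / (\<mu> + \<mu>')) \<le> (1 - s) * flat (l / \<mu>) + s * flat (l' / \<mu>')"
    using convex_onD[OF convex_flat s(1,2), of "l / \<mu>" "l' / \<mu>'"] by simp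
  then have "(\<mu> + \<mu>') * flat ((l + l') / (\<mu> + \<mu>')) \<le>
      (\<mu> + \<mu>') * ((1 - s) * flat (l / \<mu>) + s * flat (l' / \<mu>'))"
    using assms by (intro mult_left_mono) auto
  also have "\<dots> = \<mu> * flat (l / \<mu>) + \<mu>' * flat (l' / \<mu>')"
    using s(3,4) by (simp only: distrib_left mult.assoc[symmetric])
  finally show ?thesis by (simp add: persp_def)
qed

text \<open>The blow-up as \<open>\<mu>\<close> tends to 0 while \<open>l\<close> stays away from 0.  The factor 3 is a bound for \<open>exp 1\<close>.\<close>

lemma persp_lower:
  assumes "0 < \<mu>" "\<mu> \<le> l" shows "l\<^sup>2 / (3 * \<mu>) \<le> persp l \<mu>"
proof -
  have "exp (-1 :: real) \<le> exp (- (\<mu> / l))" using assms by simp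
  moreover have "1 / 3 \<le> exp (-1 :: real)" using exp_le by (simp add: exp_minus field_simps)
  ultimately have "1 / 3 \<le> exp (- (\<mu> / l))" by linarith
  then have "l\<^sup>2 / \<mu> * (1 / 3) \<le> l\<^sup>2 / \<mu> * exp (- (\<mu> / l))"
    using assms by (intro mult_left_mono) auto
  then show ?thesis using assms by (simp add: persp_eq mult.commute[of 3])
qed

lemma equi_C_persp:
  assumes l: "equi_C k S {l}" and \<mu>: "equi_C k S {\<mu>}" and pos: "\<And>x. x \<in> S \<Longrightarrow> \<mu> x > 0"
  shows "equi_C k S {\<lambda>x. persp (l x) (\<mu> x)}"
  unfolding persp_def divide_inverse
  by (intro equi_C_mult2 \<mu> equi_C_compose_real[OF _ equi_C_flat] l equi_C_inverse) (use pos in force)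

section \<open>The smooth norm of a pair of families of seminorms\<close>

locale seminorm_pair =
  fixes A B :: "'i \<Rightarrow> 'w::real_normed_vector \<Rightarrow> real" and C c :: real
  assumes A_add: "A i (x + y) \<le> A i x + A i y" and A_scale: "A i (r *\<^sub>R x) = \<bar>r\<bar> * A i x"
    and B_add: "B i (x + y) \<le> B i x + B i y" and B_scale: "B i (r *\<^sub>R x) = \<bar>r\<bar> * B i x"
    and C_pos: "C > 0" and A_le: "A i x \<le> C * norm x" and B_le: "B i x \<le> C * norm x"
    and c_pos: "c > 0" and A_lower: "\<exists>i. c * norm x \<le> A i x"
    and B_null: "\<epsilon> > 0 \<Longrightarrow> finite {i. \<epsilon> \<le> B i x}"
    and gap: "x \<noteq> 0 \<Longrightarrow> \<exists>i. \<exists>\<delta>>0. \<forall>j. A j x + \<delta> \<le> A i x + B i x / 2 \<and> B j x + \<delta> \<le> A i x + B i x / 2"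
begin

lemma A_zero [simp]: "A i 0 = 0"
  using A_scale[of i 0 0] by simp

lemma B_zero [simp]: "B i 0 = 0"
  using B_scale[of i 0 0] by simp

lemma A_nonneg: "0 \<le> A i x"
  using A_add[of i x "- x"] A_scale[of i "-1" x] by simp

lemma B_nonneg: "0 \<le> B i x"
  using B_add[of i x "- x"] B_scale[of i "-1" x] by simp

lemma A_diff: "A i x \<le> A i y + C * norm (x - y)"
  using A_add[of i "x - y" y] A_le[of i "x - y"] by simp

lemma B_diff: "B i x \<le> B i y + C * norm (x - y)"
  using B_add[of i "x - y" y] B_le[of i "x - y"] by simp

lemma continuous_on_seminorm:
  assumes "\<And>x y. f x \<le> f y + C * norm (x - y)" shows "continuous_on X (f :: 'w \<Rightarrow> real)"
proof (rule lipschitz_on_continuous_on[OF lipschitz_onI])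
  show "dist (f x) (f y) \<le> C * dist x y" for x y
    using assms[of x y] assms[of y x] by (simp add: dist_norm norm_minus_commute)
qed (use C_pos in simp)

lemmas continuous_on_A = continuous_on_seminorm[OF A_diff]
  and continuous_on_B = continuous_on_seminorm[OF B_diff]

text \<open>The pairs with \<open>\<tau>\<close> strictly above the supremum of \<open>A i w + B i w / 2\<close>.\<close>

definition admissible :: "'w \<Rightarrow> real \<Rightarrow> bool" where
  "admissible w \<tau> \<longleftrightarrow> (\<exists>\<delta>>0. \<forall>i. A i w + B i w / 2 + \<delta> \<le> \<tau>)"

text \<open>The two arguments of \<open>persp\<close>.  An index contributes if its excess is positive, which means
\<open>B i w / 2 > 3/4 (\<tau> - A i w)\<close>.\<close>

definition excess :: "'i \<Rightarrow> 'w \<Rightarrow> real \<Rightarrow> real" where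
  "excess i w \<tau> = 3 * A i w + 2 * B i w - 3 * \<tau>"

definition slack :: "'i \<Rightarrow> 'w \<Rightarrow> real \<Rightarrow> real" where
  "slack i w \<tau> = \<tau> - A i w - B i w / 2"

definition active :: "'w \<Rightarrow> real \<Rightarrow> 'i set" where
  "active w \<tau> = {i. excess i w \<tau> > 0}"

definition barrier :: "'w \<Rightarrow> real \<Rightarrow> real" where
  "barrier w \<tau> = (\<Sum>i\<in>active w \<tau>. persp (excess i w \<tau>) (slack i w \<tau>))"

lemma slack_pos: "admissible w \<tau> \<Longrightarrow> slack i w \<tau> > 0"
proof -
  assume "admissible w \<tau>"
  then obtain \<delta> where "\<delta> > 0" "A i w + B i w / 2 + \<delta> \<le> \<tau>" by (auto simp: admissible_def)
  then show ?thesis by (simp add: slack_def)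
qed

lemma admissible_pos: "admissible w \<tau> \<Longrightarrow> \<tau> > 0"
  using slack_pos[of w \<tau> i] A_nonneg[of i w] B_nonneg[of i w] by (simp add: slack_def)

lemma admissible_mono: "admissible w \<tau> \<Longrightarrow> \<tau> \<le> \<sigma> \<Longrightarrow> admissible w \<sigma>"
  unfolding admissible_def by (meson order_trans)

text \<open>The margin \<open>\<delta>\<close> is there so that the same finite set of indices serves for all nearby pairs.\<close>

lemma finite_near_active:
  assumes "\<delta> > 0" "\<And>i. A i w + B i w / 2 + \<delta> \<le> \<tau>"
  shows "finite {i. excess i w \<tau> > - \<delta>}"
proof (rule finite_subset[OF _ B_null[OF assms(1), of w]])
  show "{i. excess i w \<tau> > - \<delta>} \<subseteq> {i. \<delta> \<le> B i w}"
  proof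
    fix i assume "i \<in> {i. excess i w \<tau> > - \<delta>}"
    then show "i \<in> {i. \<delta> \<le> B i w}" using assms(2)[of i] assms(1) by (simp add: excess_def)
  qed
qed

lemma finite_active: "admissible w \<tau> \<Longrightarrow> finite (active w \<tau>)"
proof -
  assume "admissible w \<tau>"
  then obtain \<delta> where "\<delta> > 0" "\<And>i. A i w + B i w / 2 + \<delta> \<le> \<tau>" by (auto simp: admissible_def)
  then show ?thesis
    by (intro finite_subset[OF _ finite_near_active[of \<delta> w \<tau>]]) (auto simp: active_def)
qed

lemma barrier_superset:
  assumes "admissible w \<tau>" "finite F" "active w \<tau> \<subseteq> F"
  shows "barrier w \<tau> = (\<Sum>i\<in>F. persp (excess i w \<tau>) (slack i w \<tau>))"
  unfolding barrier_def
  by (rule sum.mono_neutral_left[OF assms(2,3)])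
    (use slack_pos[OF assms(1)] persp_nonpos in \<open>auto simp: active_def not_less\<close>)

lemma barrier_antimono:
  assumes "admissible w \<tau>" "\<tau> \<le> \<sigma>" shows "barrier w \<sigma> \<le> barrier w \<tau>"
proof -
  have "active w \<sigma> \<subseteq> active w \<tau>" using assms(2) by (auto simp: active_def excess_def)
  then have "barrier w \<sigma> = (\<Sum>i\<in>active w \<tau>. persp (excess i w \<sigma>) (slack i w \<sigma>))"
    by (rule barrier_superset[OF admissible_mono[OF assms] finite_active[OF assms(1)]])
  also have "\<dots> \<le> barrier w \<tau>"
    unfolding barrier_def
    by (intro sum_mono persp_mono slack_pos[OF assms(1)]) (use assms(2) in \<open>auto simp: excess_def slack_def\<close>)
  finally show ?thesis .
qed

lemma barrier_ge_term:
  assumes "admissible w \<tau>" "excess i w \<tau> > 0"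
  shows "persp (excess i w \<tau>) (slack i w \<tau>) \<le> barrier w \<tau>"
  unfolding barrier_def
  by (rule member_le_sum) (use assms slack_pos finite_active persp_nonneg in \<open>auto simp: active_def\<close>)

lemma barrier_0: "(\<And>i. excess i w \<tau> \<le> 0) \<Longrightarrow> barrier w \<tau> = 0"
  by (simp add: barrier_def active_def not_less[symmetric])

text \<open>Each summand is subadditive, as \<open>persp\<close> is monotone and subadditive: passing to the sum of two pairs can only decrease the excess and increase
the slack, compared with the sums of these quantities.\<close>

lemma barrier_subadditive:
  assumes "admissible w \<tau>" "admissible z \<sigma>"
  shows "admissible (w + z) (\<tau> + \<sigma>)" "barrier (w + z) (\<tau> + \<sigma>) \<le> barrier w \<tau> + barrier z \<sigma>"
proof -
  obtain \<delta> \<delta>' where "\<delta> > 0" "\<And>i. A i w + B i w / 2 + \<delta> \<le> \<tau>" "\<delta>' > 0" "\<And>i. A i z + B i z / 2 + \<delta>' \<le> \<sigma>"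
    using assms unfolding admissible_def by blast
  moreover from this have "A i (w + z) + B i (w + z) / 2 + (\<delta> + \<delta>') \<le> \<tau> + \<sigma>" for i
    using A_add[of i w z] B_add[of i w z] by (smt (verit) field_sum_of_halves)
  ultimately show adm: "admissible (w + z) (\<tau> + \<sigma>)"
    unfolding admissible_def by (intro exI[of _ "\<delta> + \<delta>'"]) auto
  have ex: "excess i (w + z) (\<tau> + \<sigma>) \<le> excess i w \<tau> + excess i z \<sigma>" for i
    using A_add[of i w z] B_add[of i w z] by (simp add: excess_def)
  have sl: "slack i w \<tau> + slack i z \<sigma> \<le> slack i (w + z) (\<tau> + \<sigma>)" for i
    using A_add[of i w z] B_add[of i w z] by (simp add: slack_def field_simps)
  let ?F = "active w \<tau> \<union> active z \<sigma>"
  have F: "finite ?F" using finite_active assms by simp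
  have "active (w + z) (\<tau> + \<sigma>) \<subseteq> ?F"
  proof
    fix i assume "i \<in> active (w + z) (\<tau> + \<sigma>)"
    then show "i \<in> ?F" using ex[of i] by (simp add: active_def) linarith
  qed
  then have "barrier (w + z) (\<tau> + \<sigma>) =
      (\<Sum>i\<in>?F. persp (excess i (w + z) (\<tau> + \<sigma>)) (slack i (w + z) (\<tau> + \<sigma>)))"
    by (rule barrier_superset[OF adm F])
  also have "\<dots> \<le> (\<Sum>i\<in>?F. persp (excess i w \<tau>) (slack i w \<tau>) + persp (excess i z \<sigma>) (slack i z \<sigma>))"
  proof (rule sum_mono)
    fix i
    note pos = slack_pos[OF assms(1), of i] slack_pos[OF assms(2), of i]
    show "persp (excess i (w + z) (\<tau> + \<sigma>)) (slack i (w + z) (\<tau> + \<sigma>)) \<le>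
        persp (excess i w \<tau>) (slack i w \<tau>) + persp (excess i z \<sigma>) (slack i z \<sigma>)"
      by (rule order_trans[OF persp_mono[OF ex _ sl] persp_subadditive[OF pos]])
        (use pos in simp)
  qed
  also have "\<dots> = barrier w \<tau> + barrier z \<sigma>"
    using barrier_superset[OF assms(1) F] barrier_superset[OF assms(2) F] by (simp add: sum.distrib)
  finally show "barrier (w + z) (\<tau> + \<sigma>) \<le> barrier w \<tau> + barrier z \<sigma>" .
qed

lemma barrier_scale:
  assumes "r \<noteq> 0" "admissible w \<tau>"
  shows "admissible (r *\<^sub>R w) (\<bar>r\<bar> * \<tau>)" "barrier (r *\<^sub>R w) (\<bar>r\<bar> * \<tau>) = \<bar>r\<bar> * barrier w \<tau>"
proof -
  obtain \<delta> where \<delta>: "\<delta> > 0" "\<And>i. A i w + B i w / 2 + \<delta> \<le> \<tau>"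
    using assms(2) unfolding admissible_def by blast
  have "A i (r *\<^sub>R w) + B i (r *\<^sub>R w) / 2 + \<bar>r\<bar> * \<delta> \<le> \<bar>r\<bar> * \<tau>" for i
    using mult_left_mono[OF \<delta>(2)[of i], of "\<bar>r\<bar>"] by (simp add: A_scale B_scale algebra_simps)
  then show "admissible (r *\<^sub>R w) (\<bar>r\<bar> * \<tau>)"
    unfolding admissible_def using \<delta>(1) assms(1) by (intro exI[of _ "\<bar>r\<bar> * \<delta>"]) auto
  have ex: "excess i (r *\<^sub>R w) (\<bar>r\<bar> * \<tau>) = \<bar>r\<bar> * excess i w \<tau>" for i
    by (simp add: excess_def A_scale B_scale algebra_simps)
  have sl: "slack i (r *\<^sub>R w) (\<bar>r\<bar> * \<tau>) = \<bar>r\<bar> * slack i w \<tau>" for i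
    by (simp add: slack_def A_scale B_scale algebra_simps)
  have "active (r *\<^sub>R w) (\<bar>r\<bar> * \<tau>) = active w \<tau>"
    using assms(1) by (simp add: active_def ex zero_less_mult_iff)
  moreover have "persp (\<bar>r\<bar> * l) (\<bar>r\<bar> * \<mu>) = \<bar>r\<bar> * persp l \<mu>" for l \<mu>
    using assms(1) by (simp add: persp_def)
  ultimately show "barrier (r *\<^sub>R w) (\<bar>r\<bar> * \<tau>) = \<bar>r\<bar> * barrier w \<tau>"
    by (simp add: barrier_def ex sl sum_distrib_left)
qed

text \<open>Locally the sum is finite with a fixed index set.\<close>

lemma admissible_near:
  assumes "\<delta> > 0" "\<And>i. A i w0 + B i w0 / 2 + \<delta> \<le> \<tau>0"
  obtains r where "r > 0"
    "\<And>w \<tau>. norm (w - w0) < r \<Longrightarrow> \<bar>\<tau> - \<tau>0\<bar> < r \<Longrightarrow> admissible w \<tau>"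
    "\<And>w \<tau>. norm (w - w0) < r \<Longrightarrow> \<bar>\<tau> - \<tau>0\<bar> < r \<Longrightarrow> active w \<tau> \<subseteq> {i. excess i w0 \<tau>0 > - \<delta>}"
proof
  \<comment> \<open>Moving by \<open>r\<close> changes the excess by at most \<open>5 C r + 3 r\<close>, and \<open>A i w + B i w / 2 - \<tau>\<close> by at
    most \<open>3/2 C r + r\<close>; both are at most \<open>\<delta> / 2\<close>.\<close>
  define r where "r = \<delta> / (10 * C + 10)"
  show "r > 0" using assms(1) C_pos by (simp add: r_def)
  have "(10 * C + 10) * r = \<delta>" using C_pos by (simp add: r_def)
  then have r: "10 * (C * r) + 10 * r = \<delta>" by (simp add: algebra_simps)
  fix w \<tau> assume w: "norm (w - w0) < r" and \<tau>: "\<bar>\<tau> - \<tau>0\<bar> < r"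
  have Cr: "C * norm (w - w0) \<le> C * r" "0 \<le> C * r" using w C_pos \<open>r > 0\<close> by auto
  have "A i w + B i w / 2 + \<delta> / 2 \<le> \<tau>" for i
    using A_diff[of i w w0] B_diff[of i w w0] Cr assms(2)[of i] r \<tau> by argo
  then show "admissible w \<tau>"
    unfolding admissible_def using assms(1) by (intro exI[of _ "\<delta> / 2"]) auto
  show "active w \<tau> \<subseteq> {i. excess i w0 \<tau>0 > - \<delta>}"
  proof
    fix i assume "i \<in> active w \<tau>"
    then have "excess i w \<tau> > 0" by (simp add: active_def)
    then have "excess i w0 \<tau>0 > - \<delta>"
      unfolding excess_def using A_diff[of i w w0] B_diff[of i w w0] Cr r \<tau> by argo
    then show "i \<in> {i. excess i w0 \<tau>0 > - \<delta>}" by simp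
  qed
qed

definition admissible_pairs :: "('w \<times> real) set" where
  "admissible_pairs = {(w, \<tau>). w \<noteq> 0 \<and> admissible w \<tau>}"

lemma open_admissible_pairs: "open admissible_pairs"
  unfolding open_dist
proof
  fix p assume p: "p \<in> admissible_pairs"
  obtain w0 \<tau>0 where p0: "p = (w0, \<tau>0)" by fastforce
  with p obtain \<delta> where \<delta>: "\<delta> > 0" "\<And>i. A i w0 + B i w0 / 2 + \<delta> \<le> \<tau>0" and "w0 \<noteq> 0"
    by (auto simp: admissible_pairs_def admissible_def)
  obtain r where r: "r > 0" "\<And>w \<tau>. norm (w - w0) < r \<Longrightarrow> \<bar>\<tau> - \<tau>0\<bar> < r \<Longrightarrow> admissible w \<tau>"
    using admissible_near[OF \<delta>] by metis
  show "\<exists>e>0. \<forall>y. dist y p < e \<longrightarrow> y \<in> admissible_pairs"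
  proof (intro exI[of _ "min r (norm w0)"] conjI allI impI)
    fix y assume y: "dist y p < min r (norm w0)"
    obtain w \<tau> where wt: "y = (w, \<tau>)" by fastforce
    have "dist w w0 \<le> dist y p" "dist \<tau> \<tau>0 \<le> dist y p"
      using dist_fst_le[of y p] dist_snd_le[of y p] by (simp_all add: wt p0)
    with y have w: "norm (w - w0) < r" "norm (w - w0) < norm w0" "\<bar>\<tau> - \<tau>0\<bar> < r"
      by (auto simp: dist_norm)
    then have "w \<noteq> 0" by auto
    then show "y \<in> admissible_pairs" using r(2)[OF w(1,3)] by (simp add: admissible_pairs_def wt)
  qed (use r(1) \<open>w0 \<noteq> 0\<close> in auto)
qed

text \<open>The second half of the gap condition, which excludes \<open>A i w = 0\<close> at active indices.\<close>

lemma B_less: "admissible w \<tau> \<Longrightarrow> B i w < \<tau>"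
proof (cases "w = 0")
  case False
  assume "admissible w \<tau>"
  obtain j \<delta> where "\<delta> > 0" "B i w + \<delta> \<le> A j w + B j w / 2" using gap[OF False] by blast
  then show ?thesis using slack_pos[OF \<open>admissible w \<tau>\<close>, of j] by (simp add: slack_def)
qed (simp add: admissible_pos)

definition regular :: "nat \<Rightarrow> bool" where
  "regular n \<longleftrightarrow> (\<forall>i. equi_C n {w. A i w \<noteq> 0} {A i} \<and> equi_C n {w. B i w \<noteq> 0} {B i})"

lemma regular_0: "regular 0"
  unfolding regular_def equi_C_0_singleton using continuous_on_A continuous_on_B by blast

lemma open_A: "open {p::'w \<times> real. A i (fst p) \<noteq> 0}" and open_B: "open {p::'w \<times> real. B i (fst p) \<noteq> 0}"
  by (intro open_Collect_neq continuous_on_compose2[OF continuous_on_A[of UNIV]]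
      continuous_on_compose2[OF continuous_on_B[of UNIV]] continuous_intros; simp)+

text \<open>If the excess is negative, the summand vanishes nearby.  Otherwise neither \<open>A i\<close> nor \<open>B i\<close> vanishes at
the point, so both are smooth nearby.\<close>

lemma equi_C_term:
  assumes n: "regular n" and adm: "admissible w0 \<tau>0"
  shows "\<exists>U. open U \<and> (w0, \<tau>0) \<in> U \<and>
    equi_C n U {\<lambda>p. persp (excess i (fst p) (snd p)) (slack i (fst p) (snd p))}"
proof -
  note cA = continuous_on_compose2[OF continuous_on_A[of UNIV i] continuous_on_fst[OF continuous_on_id]]
    and cB = continuous_on_compose2[OF continuous_on_B[of UNIV i] continuous_on_fst[OF continuous_on_id]]
  have ce: "continuous_on UNIV (\<lambda>p. excess i (fst p) (snd p))"
    and cs: "continuous_on UNIV (\<lambda>p. slack i (fst p) (snd p))"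
    unfolding excess_def slack_def by (intro continuous_intros cA cB; simp)+
  have os: "open {p. 0 < slack i (fst p) (snd p)}"
    by (rule open_Collect_less[OF continuous_on_const cs])
  show ?thesis
  proof (cases "excess i w0 \<tau>0 < 0")
    case True
    let ?U = "{p. excess i (fst p) (snd p) < 0} \<inter> {p. 0 < slack i (fst p) (snd p)}"
    have "equi_C n ?U {\<lambda>p. persp (excess i (fst p) (snd p)) (slack i (fst p) (snd p))}"
      by (rule equi_C_cong[OF equi_C_const[of n ?U 0]]) (simp add: persp_nonpos)
    moreover have "open ?U" by (intro open_Int os open_Collect_less[OF ce continuous_on_const])
    ultimately show ?thesis using True slack_pos[OF adm] by (intro exI[of _ ?U]) auto
  next
    case False
    then have AB: "A i w0 \<noteq> 0" "B i w0 \<noteq> 0"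
      using B_less[OF adm, of i] slack_pos[OF adm, of i] admissible_pos[OF adm]
      by (auto simp: excess_def slack_def)
    let ?U = "{p::'w \<times> real. A i (fst p) \<noteq> 0} \<inter> {p. B i (fst p) \<noteq> 0} \<inter> {p. 0 < slack i (fst p) (snd p)}"
    have "equi_C n ?U {\<lambda>p. A i (fst p)}" "equi_C n ?U {\<lambda>p. B i (fst p)}"
      using n by (auto simp: regular_def intro!: equi_C_compose_linear[OF bounded_linear_fst] simp del: equi_C.simps)
    moreover have "equi_C n ?U {\<lambda>p. snd p}" by (rule equi_C_bounded_linear[OF bounded_linear_snd])
    ultimately have "equi_C n ?U {\<lambda>p. persp (excess i (fst p) (snd p)) (slack i (fst p) (snd p))}"
      unfolding excess_def slack_def divide_inverse mult.commute[of _ "inverse 2"]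
      by (intro equi_C_persp equi_C_diff2 equi_C_add2 equi_C_mult2 equi_C_const) auto
    moreover have "open ?U" by (intro open_Int os open_A open_B)
    ultimately show ?thesis using AB slack_pos[OF adm] by (intro exI[of _ ?U]) auto
  qed
qed

lemma equi_C_barrier:
  assumes n: "regular n"
  shows "equi_C n admissible_pairs {\<lambda>p. barrier (fst p) (snd p)}"
proof (rule equi_C_local[OF open_admissible_pairs])
  fix p assume p: "p \<in> admissible_pairs"
  obtain w0 \<tau>0 where p0: "p = (w0, \<tau>0)" by fastforce
  with p have adm: "admissible w0 \<tau>0" by (simp add: admissible_pairs_def)
  then obtain \<delta> where \<delta>: "\<delta> > 0" "\<And>i. A i w0 + B i w0 / 2 + \<delta> \<le> \<tau>0"
    by (auto simp: admissible_def)
  define F where "F = {i. excess i w0 \<tau>0 > - \<delta>}"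
  have F: "finite F" unfolding F_def by (rule finite_near_active[OF \<delta>])
  obtain r where r: "r > 0"
    "\<And>w \<tau>. norm (w - w0) < r \<Longrightarrow> \<bar>\<tau> - \<tau>0\<bar> < r \<Longrightarrow> active w \<tau> \<subseteq> F"
    unfolding F_def using admissible_near[OF \<delta>] by metis
  have "\<forall>i. \<exists>U. open U \<and> (w0, \<tau>0) \<in> U \<and>
      equi_C n U {\<lambda>p. persp (excess i (fst p) (snd p)) (slack i (fst p) (snd p))}"
    using equi_C_term[OF n adm] by (rule allI)
  from choice[OF this] obtain U where U0: "\<forall>i. open (U i) \<and> (w0, \<tau>0) \<in> U i \<and>
      equi_C n (U i) {\<lambda>p. persp (excess i (fst p) (snd p)) (slack i (fst p) (snd p))}"
    by (rule exE)
  note U = U0[rule_format, THEN conjunct1] U0[rule_format, THEN conjunct2, THEN conjunct1]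
    U0[rule_format, THEN conjunct2, THEN conjunct2]
  let ?W = "admissible_pairs \<inter> ball w0 r \<times> ball \<tau>0 r \<inter> (\<Inter>i\<in>F. U i)"
  have "equi_C n ?W {\<lambda>p. \<Sum>i\<in>F. persp (excess i (fst p) (snd p)) (slack i (fst p) (snd p))}"
    by (intro equi_C_sum equi_C_on_subset[OF U(3)]) auto
  then have "equi_C n ?W {\<lambda>p. barrier (fst p) (snd p)}"
  proof (rule equi_C_cong)
    have "barrier (fst q) (snd q) = (\<Sum>i\<in>F. persp (excess i (fst q) (snd q)) (slack i (fst q) (snd q)))"
      if "q \<in> ?W" for q
    proof (rule barrier_superset[OF _ F])
      show "admissible (fst q) (snd q)" using that by (auto simp: admissible_pairs_def)
      show "active (fst q) (snd q) \<subseteq> F"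
        using that by (intro r(2)) (auto simp: dist_norm norm_minus_commute)
    qed
    then show "\<exists>f\<in>{\<lambda>p. \<Sum>i\<in>F. persp (excess i (fst p) (snd p)) (slack i (fst p) (snd p))}.
        \<forall>x\<in>?W. f x = g x" if "g \<in> {\<lambda>p. barrier (fst p) (snd p)}" for g
      using that by auto
  qed
  moreover have "open ?W"
    by (intro open_Int open_admissible_pairs open_Times open_ball open_INT F ballI U(1))
  moreover have "p \<in> ?W" using p U(2) r(1) by (auto simp: p0)
  ultimately show "\<exists>W. open W \<and> p \<in> W \<and> W \<subseteq> admissible_pairs \<and> equi_C n W {\<lambda>p. barrier (fst p) (snd p)}"
    by (intro exI[of _ ?W]) auto
qed

text \<open>Just above the maximum \<open>m\<close> of \<open>A i w + B i w / 2\<close>, the summand at a maximising index is large; for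
large \<open>\<tau>\<close> all summands vanish.  The intermediate value theorem does the rest.\<close>

lemma barrier_root:
  assumes w: "w \<noteq> 0" obtains \<tau> where "admissible w \<tau>" "barrier w \<tau> = \<tau>"
proof -
  let ?q = "\<lambda>i. A i w + B i w / 2"
  obtain s \<delta> where \<delta>: "\<delta> > 0" "\<And>j. A j w + \<delta> \<le> ?q s" using gap[OF w] by blast
  \<comment> \<open>The maximum is attained, because competitors of \<open>s\<close> have \<open>B j w \<ge> \<delta>\<close>.\<close>
  define J where "J = {j. ?q s \<le> ?q j}"
  have fin: "finite J"
  proof (rule finite_subset[OF _ B_null[OF \<delta>(1), of w]])
    show "J \<subseteq> {j. \<delta> \<le> B j w}"
    proof
      fix j assume "j \<in> J"
      then show "j \<in> {j. \<delta> \<le> B j w}" using \<delta>(2)[of j] \<delta>(1) by (simp add: J_def)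
    qed
  qed
  have "s \<in> J" by (simp add: J_def)
  then have "Max (?q ` J) \<in> ?q ` J" using fin by (intro Max_in) auto
  then obtain t where t: "Max (?q ` J) = ?q t" by (rule imageE)
  have max: "?q j \<le> ?q t" if "j \<in> J" for j
    unfolding t[symmetric] using fin that by (intro Max_ge) auto
  define m where "m = ?q t"
  define b where "b = B t w"
  have m: "?q j \<le> m" for j
  proof (cases "j \<in> J")
    case False
    then have "?q j \<le> ?q s" by (simp add: J_def)
    also have "\<dots> \<le> ?q t" by (rule max[OF \<open>s \<in> J\<close>])
    finally show ?thesis by (simp add: m_def)
  qed (use max in \<open>simp add: m_def\<close>)
  have b: "b > 0" using \<delta>(1) \<delta>(2)[of t] m[of s] unfolding m_def b_def by argo
  have adm: "admissible w \<tau>" if "\<tau> > m" for \<tau>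
    unfolding admissible_def by (rule exI[of _ "\<tau> - m"]) (use that m in \<open>auto simp: algebra_simps\<close>)
  have "m \<ge> 0" using A_nonneg[of t w] B_nonneg[of t w] by (simp add: m_def)
  \<comment> \<open>At \<open>\<tau> = m + e\<close> the index \<open>t\<close> has slack \<open>e\<close> and excess \<open>b / 2 - 3 e \<ge> b / 4\<close>, so by
    \<open>persp_lower\<close> its summand is at least \<open>b\<^sup>2 / (48 e) \<ge> m + b\<close>.\<close>
  define e where "e = min (b / 16) (b\<^sup>2 / (48 * (m + b)))"
  have e: "e > 0" using b \<open>m \<ge> 0\<close> by (simp add: e_def)
  note e = e min.cobounded1[of "b / 16" "b\<^sup>2 / (48 * (m + b))", folded e_def]
    min.cobounded2[of "b / 16" "b\<^sup>2 / (48 * (m + b))", folded e_def]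
  have low: "m + e \<le> barrier w (m + e)"
  proof -
    have ex: "excess t w (m + e) = b / 2 - 3 * e"
      by (simp add: excess_def m_def b_def field_simps)
    have sl: "slack t w (m + e) = e" by (simp add: slack_def m_def)
    have l: "b / 4 \<le> b / 2 - 3 * e" using e(2) b by simp
    have "48 * (m + b) * e \<le> b\<^sup>2" using e(3) b \<open>m \<ge> 0\<close> by (simp add: pos_le_divide_eq mult.commute)
    then have "m + b \<le> b\<^sup>2 / (48 * e)" using e(1) by (simp add: pos_le_divide_eq algebra_simps)
    also have "\<dots> = (b / 4)\<^sup>2 / (3 * e)" by (simp add: power2_eq_square)
    also have "\<dots> \<le> (b / 2 - 3 * e)\<^sup>2 / (3 * e)"
      using l b e(1) by (intro divide_right_mono power_mono) auto
    also have "\<dots> \<le> persp (b / 2 - 3 * e) e" using e(1,2) l by (intro persp_lower) auto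
    also have "\<dots> \<le> barrier w (m + e)"
      using barrier_ge_term[OF adm, of "m + e" t] e(1) l b unfolding ex sl by simp
    finally show ?thesis using e(2) b by simp
  qed
  define M where "M = max (m + e) (2 * C * norm w)"
  have "barrier w M = 0"
  proof (rule barrier_0)
    fix i
    have "C * norm w * 6 \<le> 3 * M" "0 \<le> C * norm w" using C_pos by (auto simp: M_def)
    then show "excess i w M \<le> 0" using A_le[of i w] B_le[of i w] unfolding excess_def by argo
  qed
  moreover have "M \<ge> 0" using \<open>m \<ge> 0\<close> e(1) by (simp add: M_def)
  ultimately have high: "0 \<le> M - barrier w M" by simp
  have "continuous_on {m + e..M} (\<lambda>\<tau>. \<tau> - barrier w \<tau>)"
  proof (intro continuous_on_diff continuous_on_id)
    have "continuous_on {m + e..M} (\<lambda>\<tau>. (\<lambda>p. barrier (fst p) (snd p)) (w, \<tau>))"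
      by (rule continuous_on_compose2[OF equi_C_continuous_on[OF equi_C_barrier[OF regular_0]]])
        (use w adm e(1) in \<open>auto simp: admissible_pairs_def intro!: continuous_intros\<close>)
    then show "continuous_on {m + e..M} (barrier w)" by simp
  qed
  from IVT'[OF _ high _ this] low obtain \<tau> where "m + e \<le> \<tau>" "\<tau> - barrier w \<tau> = 0"
    by (auto simp: M_def)
  then show thesis using adm[of \<tau>] e(1) by (intro that[of \<tau>]) auto
qed

text \<open>The infimum is attained for \<open>w \<noteq> 0\<close>, and it also gives the right value 0 at \<open>w = 0\<close>.\<close>

definition smooth_norm :: "'w \<Rightarrow> real" where
  "smooth_norm w = Inf {\<tau>. admissible w \<tau> \<and> barrier w \<tau> \<le> \<tau>}"

lemma smooth_norm_le: "admissible w \<tau> \<Longrightarrow> barrier w \<tau> \<le> \<tau> \<Longrightarrow> smooth_norm w \<le> \<tau>"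
  unfolding smooth_norm_def
  by (rule cInf_lower) (auto intro!: bdd_belowI[of _ 0] less_imp_le[OF admissible_pos])

text \<open>As the barrier is nonincreasing in \<open>\<tau>\<close>, a solution of \<open>barrier w \<tau> = \<tau>\<close> is unique and minimal.\<close>

lemma smooth_norm_eq:
  assumes "admissible w \<tau>" "barrier w \<tau> = \<tau>" shows "smooth_norm w = \<tau>"
proof (rule order_antisym)
  show "smooth_norm w \<le> \<tau>" using assms by (intro smooth_norm_le) auto
  show "\<tau> \<le> smooth_norm w"
    unfolding smooth_norm_def
  proof (rule cInf_greatest)
    fix \<sigma> assume "\<sigma> \<in> {\<tau>. admissible w \<tau> \<and> barrier w \<tau> \<le> \<tau>}"
    then have \<sigma>: "admissible w \<sigma>" "barrier w \<sigma> \<le> \<sigma>" by auto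
    show "\<tau> \<le> \<sigma>"
    proof (rule ccontr)
      assume "\<not> \<tau> \<le> \<sigma>"
      then show False using barrier_antimono[OF \<sigma>(1), of \<tau>] \<sigma>(2) assms(2) by simp
    qed
  qed (use assms in auto)
qed

lemma smooth_norm_root:
  assumes "w \<noteq> 0" shows "admissible w (smooth_norm w)" "barrier w (smooth_norm w) = smooth_norm w"
  using barrier_root[OF assms] smooth_norm_eq by metis+

lemma smooth_norm_0 [simp]: "smooth_norm 0 = 0"
proof -
  have "admissible 0 \<tau> \<longleftrightarrow> \<tau> > 0" for \<tau>
    by (auto simp: admissible_def)
  moreover have "barrier 0 \<tau> = 0" if "\<tau> > 0" for \<tau>
    using that by (intro barrier_0) (simp add: excess_def)
  ultimately have "{\<tau>. admissible 0 \<tau> \<and> barrier 0 \<tau> \<le> \<tau>} = {0<..}" by auto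
  then show ?thesis by (simp add: smooth_norm_def)
qed

lemma smooth_norm_lower: "c * norm w \<le> smooth_norm w"
proof (cases "w = 0")
  case False
  obtain i where "c * norm w \<le> A i w" using A_lower by blast
  then show ?thesis
    using slack_pos[OF smooth_norm_root(1)[OF False], of i] B_nonneg[of i w] by (simp add: slack_def)
qed simp

lemma smooth_norm_upper: "smooth_norm w \<le> 2 * C * norm w"
proof (cases "w = 0")
  case False
  define t where "t = C * norm w"
  have t: "t > 0" using False C_pos by (simp add: t_def)
  have AB: "A i w \<le> t" "B i w \<le> t" for i using A_le B_le by (auto simp: t_def)
  have "A i w + B i w / 2 + t / 2 \<le> 2 * t" for i using AB[of i] by argo
  then have "admissible w (2 * t)" unfolding admissible_def using t by (intro exI[of _ "t / 2"]) auto
  moreover have "excess i w (2 * t) \<le> 0" for i using AB[of i] t unfolding excess_def by argo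
  ultimately have "smooth_norm w \<le> 2 * t" using t by (intro smooth_norm_le) (auto simp: barrier_0)
  then show ?thesis by (simp add: t_def)
qed simp

lemma smooth_norm_triangle: "smooth_norm (w + z) \<le> smooth_norm w + smooth_norm z"
proof (cases "w = 0 \<or> z = 0")
  case False
  then have wz: "w \<noteq> 0" "z \<noteq> 0" by auto
  note adm = smooth_norm_root(1)[OF wz(1)] smooth_norm_root(1)[OF wz(2)]
  show ?thesis
    by (rule smooth_norm_le[OF barrier_subadditive(1)[OF adm]])
      (use barrier_subadditive(2)[OF adm] smooth_norm_root(2)[OF wz(1)] smooth_norm_root(2)[OF wz(2)] in simp)
qed auto

lemma smooth_norm_scale: "smooth_norm (r *\<^sub>R w) = \<bar>r\<bar> * smooth_norm w"
proof (cases "r = 0 \<or> w = 0")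
  case False
  then have "r \<noteq> 0" "w \<noteq> 0" by auto
  from barrier_scale[OF this(1) smooth_norm_root(1)[OF this(2)]] smooth_norm_root(2)[OF this(2)]
  show ?thesis by (intro smooth_norm_eq) auto
qed auto

lemma equivalent_norm_smooth_norm: "equivalent_norm smooth_norm"
  unfolding equivalent_norm_def
proof (intro conjI allI)
  show "smooth_norm x = 0 \<longleftrightarrow> x = 0" for x
    using smooth_norm_lower[of x] c_pos by (auto simp: mult_le_0_iff)
  show "\<exists>a>0. \<exists>b>0. \<forall>x. a * norm x \<le> smooth_norm x \<and> smooth_norm x \<le> b * norm x"
    by (rule exI[of _ c], intro conjI c_pos, rule exI[of _ "2 * C"])
      (use smooth_norm_lower smooth_norm_upper C_pos in auto)
qed (rule smooth_norm_triangle smooth_norm_scale)+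

lemma smooth_norm_lipschitz: "\<bar>smooth_norm y - smooth_norm w\<bar> \<le> 2 * C * norm (y - w)"
  using smooth_norm_triangle[of "y - w" w] smooth_norm_triangle[of "w - y" y]
    smooth_norm_upper[of "y - w"] smooth_norm_upper[of "w - y"] by (simp add: norm_minus_commute)

text \<open>The norm is the implicit function of \<open>barrier w \<tau> - \<tau> = 0\<close>.  The slope condition holds since the barrier
is nonincreasing in \<open>\<tau>\<close>, and the Lipschitz condition since a norm is involved.  Order 0 is
continuity.\<close>

lemma C_on_smooth_norm:
  assumes n: "regular n" shows "C_on n (UNIV - {0}) smooth_norm"
proof -
  have "equi_C n (UNIV - {0}) {smooth_norm}"
  proof (cases n)
    case 0
    have "(2 * C)-lipschitz_on (UNIV - {0}) smooth_norm"
      by (rule lipschitz_onI) (use smooth_norm_lipschitz C_pos in \<open>auto simp: dist_norm\<close>)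
    then show ?thesis
      unfolding 0 equi_C_0_singleton by (rule lipschitz_on_continuous_on)
  next
    case (Suc k)
    show ?thesis
      unfolding Suc
    proof (rule equi_C_implicit[OF open_admissible_pairs, where H = "\<lambda>p. barrier (fst p) (snd p) - snd p"])
      show "equi_C (Suc k) admissible_pairs {\<lambda>p. barrier (fst p) (snd p) - snd p}"
        using equi_C_barrier[OF n] unfolding Suc
        by (rule equi_C_diff2[OF _ equi_C_bounded_linear[OF bounded_linear_snd]])
      show "barrier (fst (w, t)) (snd (w, t)) - snd (w, t) - (barrier (fst (w, s)) (snd (w, s)) - snd (w, s))
          \<le> - (t - s)" if "(w, s) \<in> admissible_pairs" "s \<le> t" for w s t
        using barrier_antimono[of w s t] that by (simp add: admissible_pairs_def)
      show "\<bar>smooth_norm y - smooth_norm w\<bar> \<le> (2 * C) * norm (y - w)" for w y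
        by (rule smooth_norm_lipschitz)
    qed (use smooth_norm_root in \<open>auto simp: admissible_pairs_def\<close>)
  qed
  then show ?thesis by (intro C_on_if_equi_C) (auto intro: open_Diff)
qed

end

section \<open>Talagrand operators: the space itself\<close>

lemma equi_C_abs: "equi_C k (UNIV - {0}) {\<lambda>x::real. \<bar>x\<bar>}"
proof (rule equi_C_local)
  fix x :: real assume "x \<in> UNIV - {0}"
  then consider "x > 0" | "x < 0" by force
  then show "\<exists>U. open U \<and> x \<in> U \<and> U \<subseteq> UNIV - {0} \<and> equi_C k U {\<lambda>x::real. \<bar>x\<bar>}"
  proof cases
    case 1
    have "equi_C k {0<..} {\<lambda>x::real. \<bar>x\<bar>}"
      by (rule equi_C_cong[OF equi_C_bounded_linear[OF bounded_linear_ident]]) auto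
    then show ?thesis using 1 by (intro exI[of _ "{0<..}"]) auto
  next
    case 2
    have "equi_C k {..<0} {\<lambda>x::real. \<bar>x\<bar>}"
      by (rule equi_C_cong[OF equi_C_bounded_linear[OF bounded_linear_minus[OF bounded_linear_ident]]]) auto
    then show ?thesis using 2 by (intro exI[of _ "{..<0}"]) auto
  qed
qed (auto intro: open_Diff)

lemma embedding_bounded_below:
  fixes S :: "'a::real_normed_vector \<Rightarrow> 'b::real_normed_vector"
  assumes "linear_homeomorphic_embedding S"
  obtains s where "bounded_linear S" "s > 0" "\<And>x. s * norm x \<le> norm (S x)"
proof -
  obtain g where lin: "linear S" and g: "homeomorphism UNIV (range S) S g"
    using assms by (auto simp: linear_homeomorphic_embedding_def)
  have S0: "S 0 = 0" by (rule linear_0[OF lin])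
  have gS: "g (S x) = x" for x using g by (simp add: homeomorphism_def)
  have "continuous_on UNIV S" using g by (simp add: homeomorphism_def)
  then obtain d where d: "d > 0" "\<And>x. dist x 0 < d \<Longrightarrow> dist (S x) (S 0) < 1"
    unfolding continuous_on_iff by (metis UNIV_I zero_less_one)
  have bl: "bounded_linear S"
  proof (rule bounded_linear_intro[where K = "2 / d"])
    fix x
    show "norm (S x) \<le> norm x * (2 / d)"
    proof (cases "x = 0")
      case False
      define r where "r = d / (2 * norm x)"
      have r: "r > 0" using False d(1) by (simp add: r_def)
      have "norm (r *\<^sub>R x) < d" using False d(1) by (simp add: r_def)
      then have "norm (S (r *\<^sub>R x)) < 1" using d(2)[of "r *\<^sub>R x"] by (simp add: S0)
      then have "r * norm (S x) < 1" using r by (simp add: linear_scale[OF lin])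
      then show ?thesis using False d(1) by (simp add: r_def field_simps)
    qed (simp add: S0)
  qed (simp_all add: linear_add[OF lin] linear_scale[OF lin])
  have "continuous_on (range S) g" using g by (simp add: homeomorphism_def)
  then obtain e where e: "e > 0" "\<And>y. y \<in> range S \<Longrightarrow> dist y (S 0) < e \<Longrightarrow> dist (g y) (g (S 0)) < 1"
    unfolding continuous_on_iff by (metis rangeI zero_less_one)
  have "e / 2 * norm x \<le> norm (S x)" for x
  proof (rule ccontr)
    assume "\<not> e / 2 * norm x \<le> norm (S x)"
    then have *: "norm (S x) < e / 2 * norm x" by simp
    then have x: "norm x > 0" using e(1) by (metis mult_zero_right norm_ge_zero not_le zero_less_norm_iff norm_zero)
    define r where "r = 2 / norm x"
    have "norm (S (r *\<^sub>R x)) < e" using * x by (simp add: r_def linear_scale[OF lin] field_simps)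
    then have "norm (r *\<^sub>R x) < 1" using e(2)[of "S (r *\<^sub>R x)"] by (simp add: S0 gS gS[of 0, unfolded S0])
    then show False using x by (simp add: r_def)
  qed
  then show thesis using bl e(1) by (intro that[of "e / 2"]) auto
qed

lemma norm_bfun_attained:
  fixes f :: "'l bfun" assumes "r < norm f" obtains t where "r < \<bar>apply_bcontfun f t\<bar>"
proof -
  have "\<not> (\<forall>t. \<bar>apply_bcontfun f t\<bar> \<le> r)" using norm_bound[of f r] assms by auto
  then show thesis using that by (meson not_le)
qed

text \<open>The index set is the whole type: the functions considered vanish off \<open>L\<close>, so the additional coordinates
change neither the norms nor the finiteness condition.\<close>

locale talagrand_pair =
  fixes S T :: "'a::banach \<Rightarrow> 'l bfun" and s :: real
  assumes S: "bounded_linear S" and T: "bounded_linear T"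
    and s_pos: "s > 0" and S_lower: "s * norm x \<le> norm (S x)"
    and T_null: "\<epsilon> > 0 \<Longrightarrow> finite {t. \<epsilon> \<le> \<bar>T x t\<bar>}"
    and domination: "x \<noteq> 0 \<Longrightarrow> norm (S x) < norm (abs_bfun (S x) + (1/2) *\<^sub>R abs_bfun (T x)) \<and>
      norm (T x) < norm (abs_bfun (S x) + (1/2) *\<^sub>R abs_bfun (T x))"
begin

text \<open>The strict inequalities between norms, witnessed at a single coordinate.\<close>

lemma domination_at:
  assumes "x \<noteq> 0"
  obtains t \<delta> where "\<delta> > 0"
    "norm (S x) + \<delta> < \<bar>S x t\<bar> + \<bar>T x t\<bar> / 2"
    "norm (T x) + \<delta> < \<bar>S x t\<bar> + \<bar>T x t\<bar> / 2"
proof -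
  let ?f = "abs_bfun (S x) + (1/2) *\<^sub>R abs_bfun (T x)"
  define \<delta> where "\<delta> = (norm ?f - max (norm (S x)) (norm (T x))) / 2"
  have \<delta>: "\<delta> > 0" "norm (S x) + \<delta> \<le> norm ?f - \<delta>" "norm (T x) + \<delta> \<le> norm ?f - \<delta>"
    using domination[OF assms] by (auto simp: \<delta>_def max_def field_simps)
  have "norm ?f - \<delta> < norm ?f" using \<delta>(1) by simp
  then obtain t where "norm ?f - \<delta> < \<bar>apply_bcontfun ?f t\<bar>" by (rule norm_bfun_attained)
  then show thesis using \<delta> by (intro that[of \<delta> t]) auto
qed

lemma S_le: "\<bar>S x t\<bar> \<le> onorm S * norm x"
  using norm_bounded[of "S x" t] onorm[OF S, of x] by simp

lemma T_le: "\<bar>T x t\<bar> \<le> onorm T * norm x"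
  using norm_bounded[of "T x" t] onorm[OF T, of x] by simp

lemma bounded_linear_coord:
  fixes F :: "'a \<Rightarrow> 'l bfun"
  assumes "bounded_linear F" shows "bounded_linear (\<lambda>x. F x t)"
proof (rule bounded_linear_intro[where K = "onorm F"])
  show "norm (F x t) \<le> norm x * onorm F" for x
    using norm_bounded[of "F x" t] onorm[OF assms, of x] by (simp add: mult.commute)
qed (simp_all add: linear_add linear_scale bounded_linear.linear[OF assms])

sublocale seminorm_pair "\<lambda>t x. \<bar>S x t\<bar>" "\<lambda>t x. \<bar>T x t\<bar>"
  "max 1 (max (onorm S) (onorm T))" "s / 2"
proof
  let ?C = "max 1 (max (onorm S) (onorm T))"
  note lin = bounded_linear.linear[OF S] bounded_linear.linear[OF T]
  fix i and x y :: 'a and r :: real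
  show "\<bar>S (x + y) i\<bar> \<le> \<bar>S x i\<bar> + \<bar>S y i\<bar>"
    "\<bar>T (x + y) i\<bar> \<le> \<bar>T x i\<bar> + \<bar>T y i\<bar>"
    by (simp_all add: linear_add[OF lin(1)] linear_add[OF lin(2)])
  show "\<bar>S (r *\<^sub>R x) i\<bar> = \<bar>r\<bar> * \<bar>S x i\<bar>"
    "\<bar>T (r *\<^sub>R x) i\<bar> = \<bar>r\<bar> * \<bar>T x i\<bar>"
    by (simp_all add: linear_scale[OF lin(1)] linear_scale[OF lin(2)] abs_mult)
  show "?C > 0" by simp
  show "\<bar>S x i\<bar> \<le> ?C * norm x"
    by (rule order_trans[OF S_le]) (simp add: mult_right_mono)
  show "\<bar>T x i\<bar> \<le> ?C * norm x"
    by (rule order_trans[OF T_le]) (simp add: mult_right_mono)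
  show "s / 2 > 0" using s_pos by simp
  show "\<exists>i. s / 2 * norm x \<le> \<bar>S x i\<bar>"
  proof (cases "x = 0")
    case False
    then have "s / 2 * norm x < s * norm x" using s_pos by simp
    with S_lower[of x] have "s / 2 * norm x < norm (S x)" by linarith
    then show ?thesis by (rule norm_bfun_attained) (auto intro: less_imp_le)
  qed simp
  show "finite {i. \<epsilon> \<le> \<bar>T x i\<bar>}" if "\<epsilon> > 0" for \<epsilon> using T_null[OF that] .
  show "\<exists>i. \<exists>\<delta>>0. \<forall>j. \<bar>S x j\<bar> + \<delta> \<le> \<bar>S x i\<bar> + \<bar>T x i\<bar> / 2 \<and>
      \<bar>T x j\<bar> + \<delta> \<le> \<bar>S x i\<bar> + \<bar>T x i\<bar> / 2"
    if nz: "x \<noteq> 0"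
  proof -
    obtain t \<delta> where t: "\<delta> > 0"
      "norm (S x) + \<delta> < \<bar>S x t\<bar> + \<bar>T x t\<bar> / 2"
      "norm (T x) + \<delta> < \<bar>S x t\<bar> + \<bar>T x t\<bar> / 2"
      by (rule domination_at[OF nz])
    show ?thesis
    proof (intro exI[of _ t] exI[of _ \<delta>] conjI allI t(1))
      fix j
      show "\<bar>S x j\<bar> + \<delta> \<le> \<bar>S x t\<bar> + \<bar>T x t\<bar> / 2"
        "\<bar>T x j\<bar> + \<delta> \<le> \<bar>S x t\<bar> + \<bar>T x t\<bar> / 2"
        using norm_bounded[of "S x" j] norm_bounded[of "T x" j] t by auto
    qed
  qed
qed

lemma regular_abs: "regular n"
  unfolding regular_def
  by (intro allI conjI equi_C_compose_linear[OF bounded_linear_coord[OF S] equi_C_abs]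
      equi_C_compose_linear[OF bounded_linear_coord[OF T] equi_C_abs]) auto

lemma admits_C_infinity_norm: "admits_C_norm \<infinity> TYPE('a)"
  unfolding admits_C_norm_def C_class_on_def
  using equivalent_norm_smooth_norm C_on_smooth_norm[OF regular_abs] by blast

end

section \<open>Slices of injective tensors\<close>

text \<open>The maps \<open>\<xi> \<otimes> id\<close> and \<open>id \<otimes> \<eta>\<close>.\<close>

lift_definition right_slice ::
  "('a::real_normed_vector \<Rightarrow>\<^sub>L real) \<Rightarrow> ('a, 'b::real_normed_vector) alg_tensor \<Rightarrow> 'b"
  is "\<lambda>\<xi> z. \<Sum>(x, e)\<leftarrow>z. blinfun_apply \<xi> x *\<^sub>R e"
proof -
  fix \<xi> :: "'a \<Rightarrow>\<^sub>L real" and z w :: "('a \<times> 'b) list"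
  assume "tensor_eq z w"
  then show "(\<Sum>(x, e)\<leftarrow>z. blinfun_apply \<xi> x *\<^sub>R e) = (\<Sum>(x, e)\<leftarrow>w. blinfun_apply \<xi> x *\<^sub>R e)"
    by (induction rule: tensor_eq.induct) (auto simp: blinfun.bilinear_simps algebra_simps)
qed

lift_definition left_slice ::
  "('b::real_normed_vector \<Rightarrow>\<^sub>L real) \<Rightarrow> ('a::real_normed_vector, 'b) alg_tensor \<Rightarrow> 'a"
  is "\<lambda>\<eta> z. \<Sum>(x, e)\<leftarrow>z. blinfun_apply \<eta> e *\<^sub>R x"
proof -
  fix \<eta> :: "'b \<Rightarrow>\<^sub>L real" and z w :: "('a \<times> 'b) list"
  assume "tensor_eq z w"
  then show "(\<Sum>(x, e)\<leftarrow>z. blinfun_apply \<eta> e *\<^sub>R x) = (\<Sum>(x, e)\<leftarrow>w. blinfun_apply \<eta> e *\<^sub>R x)"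
    by (induction rule: tensor_eq.induct) (auto simp: blinfun.bilinear_simps algebra_simps)
qed

lemma right_slice_tensor [simp]: "right_slice \<xi> (tensor x e) = blinfun_apply \<xi> x *\<^sub>R e"
  by (simp add: tensor.abs_eq right_slice.abs_eq)

lemma left_slice_tensor [simp]: "left_slice \<eta> (tensor x e) = blinfun_apply \<eta> e *\<^sub>R x"
  by (simp add: tensor.abs_eq left_slice.abs_eq)

lemma right_slice_zero [simp]: "right_slice \<xi> 0 = 0"
  by (simp add: zero_alg_tensor_def right_slice.abs_eq)

lemma left_slice_zero [simp]: "left_slice \<eta> 0 = 0"
  by (simp add: zero_alg_tensor_def left_slice.abs_eq)

lemma right_slice_add [simp]: "right_slice \<xi> (z + w) = right_slice \<xi> z + right_slice \<xi> w"
  by (induct z rule: alg_tensor.abs_induct, induct w rule: alg_tensor.abs_induct)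
    (simp add: plus_alg_tensor.abs_eq right_slice.abs_eq)

lemma left_slice_add [simp]: "left_slice \<eta> (z + w) = left_slice \<eta> z + left_slice \<eta> w"
  by (induct z rule: alg_tensor.abs_induct, induct w rule: alg_tensor.abs_induct)
    (simp add: plus_alg_tensor.abs_eq left_slice.abs_eq)

lemma linear_right_slice: "linear (right_slice \<xi>)"
proof (rule linearI)
  show "right_slice \<xi> (c *\<^sub>R z) = c *\<^sub>R right_slice \<xi> z" for c z
    by (induction z rule: alg_tensor_induct)
      (simp_all add: scaleR_add_right blinfun.bilinear_simps flip: tensor_scaleR_left)
qed simp

lemma linear_left_slice: "linear (left_slice \<eta>)"
proof (rule linearI)
  show "left_slice \<eta> (c *\<^sub>R z) = c *\<^sub>R left_slice \<eta> z" for c z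
    by (induction z rule: alg_tensor_induct)
      (simp_all add: scaleR_add_right blinfun.bilinear_simps flip: tensor_scaleR_left)
qed simp

lemma apply_right_slice: "blinfun_apply \<eta> (right_slice \<xi> z) = tensor_pairing \<xi> \<eta> z"
  by (induction z rule: alg_tensor_induct) (simp_all add: blinfun.bilinear_simps)

lemma apply_left_slice: "blinfun_apply \<xi> (left_slice \<eta> z) = tensor_pairing \<xi> \<eta> z"
  by (induction z rule: alg_tensor_induct) (simp_all add: blinfun.bilinear_simps)

text \<open>Bilinearity in the two functionals is read off from the slices, which are linear in them.\<close>

lemma tensor_pairing_le: "\<bar>tensor_pairing \<xi> \<eta> z\<bar> \<le> norm \<xi> * norm \<eta> * injective_norm z"
proof (cases "\<xi> = 0 \<or> \<eta> = 0")
  case True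
  then show ?thesis
    using apply_left_slice[of \<xi> \<eta> z] apply_right_slice[of \<eta> \<xi> z] by auto
next
  case False
  have "tensor_pairing (\<xi> /\<^sub>R norm \<xi>) (\<eta> /\<^sub>R norm \<eta>) z = tensor_pairing \<xi> \<eta> z / (norm \<xi> * norm \<eta>)"
    unfolding apply_left_slice[symmetric, of "\<xi> /\<^sub>R norm \<xi>"] blinfun.scaleR_left
    unfolding apply_left_slice
    unfolding apply_right_slice[symmetric] blinfun.scaleR_left
    by (simp add: field_simps)
  then show ?thesis
    using injective_norm_upper[of "\<xi> /\<^sub>R norm \<xi>" "\<eta> /\<^sub>R norm \<eta>" z] False
    by (simp add: abs_divide abs_mult pos_divide_le_eq mult.commute)
qed

lemma closed_dense_tensor:
  assumes "closed {w. P w}" "\<And>z. P (of_alg_tensor z)" shows "P w"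
proof -
  have "closure (range of_alg_tensor) \<subseteq> {w. P w}"
    by (rule closure_minimal) (use assms in auto)
  then show ?thesis by (simp add: dense_of_alg_tensor subset_iff)
qed

text \<open>The continuous extension to the completion.  The representing Cauchy sequence is arbitrary, because the values on two
sequences with the same limit differ by a null sequence.\<close>

definition tensor_extension ::
  "(('a::real_normed_vector, 'b::real_normed_vector) alg_tensor \<Rightarrow> 'c::banach) \<Rightarrow> ('a, 'b) inj_tensor \<Rightarrow> 'c" where
  "tensor_extension f w = lim (\<lambda>n. f (rep_inj_tensor w n))"

lemma tensor_extension:
  fixes f :: "('a::real_normed_vector, 'b::real_normed_vector) alg_tensor \<Rightarrow> 'c::banach"
  assumes lin: "linear f" and K: "\<And>z. norm (f z) \<le> K * injective_norm z"
  shows tensor_extension_bounded_linear: "bounded_linear (tensor_extension f)"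
    and tensor_extension_of_alg: "tensor_extension f (of_alg_tensor z) = f z"
    and tensor_extension_norm_le: "norm (tensor_extension f w) \<le> K * norm w"
proof -
  let ?g = "tensor_extension f"
  have fdiff: "norm (f z - f z') \<le> K * norm (of_alg_tensor z - of_alg_tensor z')" for z z'
    using K[of "z - z'"]
    by (simp add: linear_diff[OF lin] norm_of_alg_tensor flip: linear_diff[OF linear_of_alg_tensor])
  have rep: "(\<lambda>n. of_alg_tensor (rep_inj_tensor w n)) \<longlonglongrightarrow> w" for w :: "('a, 'b) inj_tensor"
  proof -
    have "inj_Cauchy (rep_inj_tensor w)"
      using Quotient3_rep_reflp[OF Quotient3_inj_tensor, of w] by simp
    from of_alg_tensor_tendsto[OF this] show ?thesis
      by (simp add: Quotient3_abs_rep[OF Quotient3_inj_tensor])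
  qed
  have null: "(\<lambda>n. f (z n) - f (z' n)) \<longlonglongrightarrow> 0"
    if "(\<lambda>n. of_alg_tensor (z n)) \<longlonglongrightarrow> w" "(\<lambda>n. of_alg_tensor (z' n)) \<longlonglongrightarrow> w" for z z' w
  proof (rule Lim_null_comparison[OF always_eventually])
    show "\<forall>n. norm (f (z n) - f (z' n)) \<le> K * norm (of_alg_tensor (z n) - of_alg_tensor (z' n))"
      using fdiff by blast
    have "(\<lambda>n. K * norm (of_alg_tensor (z n) - of_alg_tensor (z' n))) \<longlonglongrightarrow> K * norm (w - w)"
      by (intro tendsto_intros that)
    then show "(\<lambda>n. K * norm (of_alg_tensor (z n) - of_alg_tensor (z' n))) \<longlonglongrightarrow> 0" by simp
  qed
  have conv: "(\<lambda>n. f (rep_inj_tensor w n)) \<longlonglongrightarrow> ?g w" for w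
  proof -
    have "Cauchy (\<lambda>n. f (rep_inj_tensor w n))"
    proof (rule CauchyI)
      fix \<epsilon> :: real assume "\<epsilon> > 0"
      then have "\<epsilon> / (\<bar>K\<bar> + 1) > 0" by (simp add: add_nonneg_pos)
      from CauchyD[OF LIMSEQ_imp_Cauchy[OF rep[of w]] this] obtain M where
        M: "\<And>m n. m \<ge> M \<Longrightarrow> n \<ge> M \<Longrightarrow>
          norm (of_alg_tensor (rep_inj_tensor w m) - of_alg_tensor (rep_inj_tensor w n)) < \<epsilon> / (\<bar>K\<bar> + 1)"
        by blast
      have "norm (f (rep_inj_tensor w m) - f (rep_inj_tensor w n)) < \<epsilon>" if "m \<ge> M" "n \<ge> M" for m n
      proof -
        let ?d = "norm (of_alg_tensor (rep_inj_tensor w m) - of_alg_tensor (rep_inj_tensor w n))"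
        have "norm (f (rep_inj_tensor w m) - f (rep_inj_tensor w n)) \<le> K * ?d" by (rule fdiff)
        also have "\<dots> \<le> (\<bar>K\<bar> + 1) * ?d" by (rule mult_right_mono) auto
        also have "\<dots> < (\<bar>K\<bar> + 1) * (\<epsilon> / (\<bar>K\<bar> + 1))"
          using M[OF that] by (intro mult_strict_left_mono) auto
        also have "\<dots> = \<epsilon>" by (simp add: add_nonneg_eq_0_iff)
        finally show ?thesis .
      qed
      then show "\<exists>M. \<forall>m\<ge>M. \<forall>n\<ge>M. norm (f (rep_inj_tensor w m) - f (rep_inj_tensor w n)) < \<epsilon>" by blast
    qed
    then show ?thesis
      unfolding tensor_extension_def by (simp add: Cauchy_convergent_iff convergent_LIMSEQ_iff)
  qed
  have lim: "(\<lambda>n. f (z n)) \<longlonglongrightarrow> ?g w" if "(\<lambda>n. of_alg_tensor (z n)) \<longlonglongrightarrow> w" for z w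
    using tendsto_add[OF null[OF that rep[of w]] conv[of w]] by simp
  show alg: "?g (of_alg_tensor z) = f z" for z
    using lim[of "\<lambda>_. z" "of_alg_tensor z"] by (simp add: LIMSEQ_const_iff)
  show bound: "norm (?g w) \<le> K * norm w" for w
  proof (rule LIMSEQ_le[OF tendsto_norm[OF conv[of w]] tendsto_mult[OF tendsto_const tendsto_norm[OF rep[of w]]]])
    show "\<exists>N. \<forall>n\<ge>N. norm (f (rep_inj_tensor w n)) \<le> K * norm (of_alg_tensor (rep_inj_tensor w n))"
      using K by (auto simp: norm_of_alg_tensor)
  qed
  show "bounded_linear ?g"
  proof (rule bounded_linear_intro[where K = K])
    fix w v :: "('a, 'b) inj_tensor" and c :: real
    have "(\<lambda>n. f (rep_inj_tensor w n + rep_inj_tensor v n)) \<longlonglongrightarrow> ?g (w + v)"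
      by (rule lim) (use tendsto_add[OF rep[of w] rep[of v]] in \<open>simp add: linear_add[OF linear_of_alg_tensor]\<close>)
    moreover have "(\<lambda>n. f (rep_inj_tensor w n + rep_inj_tensor v n)) \<longlonglongrightarrow> ?g w + ?g v"
      using tendsto_add[OF conv[of w] conv[of v]] by (simp add: linear_add[OF lin])
    ultimately show "?g (w + v) = ?g w + ?g v" by (rule LIMSEQ_unique)
    have "(\<lambda>n. f (c *\<^sub>R rep_inj_tensor w n)) \<longlonglongrightarrow> ?g (c *\<^sub>R w)"
      by (rule lim) (use tendsto_scaleR[OF tendsto_const rep[of w], of c] in \<open>simp add: linear_scale[OF linear_of_alg_tensor]\<close>)
    moreover have "(\<lambda>n. f (c *\<^sub>R rep_inj_tensor w n)) \<longlonglongrightarrow> c *\<^sub>R ?g w"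
      using tendsto_scaleR[OF tendsto_const conv[of w], of c] by (simp add: linear_scale[OF lin])
    ultimately show "?g (c *\<^sub>R w) = c *\<^sub>R ?g w" by (rule LIMSEQ_unique)
    show "norm (?g w) \<le> norm w * K" using bound[of w] by (simp add: mult.commute)
  qed
qed

text \<open>The derivative of \<open>N\<close> at \<open>e\<close> is the functional: difference quotients in direction \<open>v\<close> are bounded by
\<open>N v\<close>, and in direction \<open>e\<close> the norm grows linearly.  A differentiable norm thus supplies its own
norming functionals, without the Hahn-Banach theorem.\<close>

lemma supporting_functional:
  fixes N :: "'e::real_normed_vector \<Rightarrow> real"
  assumes N: "equivalent_norm N" and C: "C_on (Suc k) (UNIV - {0}) N"
  shows "\<exists>\<eta> :: 'e \<Rightarrow>\<^sub>L real. blinfun_apply \<eta> e = N e \<and> (\<forall>v. \<bar>blinfun_apply \<eta> v\<bar> \<le> N v)"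
proof (cases "e = 0")
  case True
  have "0 \<le> N v" for v using N unfolding equivalent_norm_def by (meson mult_nonneg_nonneg norm_ge_zero less_imp_le order_trans)
  moreover have "N 0 = 0" using N by (simp add: equivalent_norm_def)
  ultimately show ?thesis using True by (intro exI[of _ 0]) simp
next
  case False
  have tri: "N (x + y) \<le> N x + N y" and scale: "N (c *\<^sub>R x) = \<bar>c\<bar> * N x" for x y c
    using N by (auto simp: equivalent_norm_def)
  obtain f' :: "'e \<Rightarrow> 'e \<Rightarrow>\<^sub>L real" where
    "\<And>x. x \<in> UNIV - {0} \<Longrightarrow> (N has_derivative blinfun_apply (f' x)) (at x within UNIV - {0})"
    using C_on_SucD[OF C] by blast
  from this[of e] False have "(N has_derivative blinfun_apply (f' e)) (at e within UNIV - {0})" by simp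
  then have hd: "(N has_derivative blinfun_apply (f' e)) (at e)"
    using False by (simp add: at_within_open[of e "UNIV - {0}"] open_Diff)
  have line: "((\<lambda>s. N (e + s *\<^sub>R v)) has_real_derivative blinfun_apply (f' e) v) (at 0)" for v
  proof -
    have "((\<lambda>s. N (e + s *\<^sub>R v)) has_derivative (\<lambda>s. blinfun_apply (f' e) (s *\<^sub>R v))) (at 0)"
    proof (rule has_derivative_compose[where g = N and f = "\<lambda>s. e + s *\<^sub>R v"])
      show "((\<lambda>s. e + s *\<^sub>R v) has_derivative (\<lambda>s. s *\<^sub>R v)) (at 0)"
        by (auto intro!: derivative_eq_intros)
      show "(N has_derivative blinfun_apply (f' e)) (at (e + 0 *\<^sub>R v))" using hd by simp
    qed
    then show ?thesis
      by (simp add: has_field_derivative_def blinfun.scaleR_right mult.commute[of _ "blinfun_apply (f' e) v"])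
  qed
  have "\<bar>blinfun_apply (f' e) v\<bar> \<le> N v" for v
  proof (rule tendsto_upperbound)
    show "((\<lambda>h. \<bar>(N (e + h *\<^sub>R v) - N e) / h\<bar>) \<longlongrightarrow> \<bar>blinfun_apply (f' e) v\<bar>) (at 0)"
      using line[of v] by (intro tendsto_rabs) (simp add: DERIV_def)
    have "\<bar>(N (e + h *\<^sub>R v) - N e) / h\<bar> \<le> N v" if "h \<noteq> 0" for h
    proof -
      have "N (e + h *\<^sub>R v) - N e \<le> \<bar>h\<bar> * N v" using tri[of e "h *\<^sub>R v"] scale[of h v] by simp
      moreover have "N e - N (e + h *\<^sub>R v) \<le> \<bar>h\<bar> * N v"
        using tri[of "e + h *\<^sub>R v" "(- h) *\<^sub>R v"] scale[of "- h" v] by simp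
      ultimately have "\<bar>N (e + h *\<^sub>R v) - N e\<bar> \<le> N v * \<bar>h\<bar>" by (simp add: mult.commute)
      then show ?thesis using that by (simp add: abs_divide pos_divide_le_eq)
    qed
    then show "\<forall>\<^sub>F h in at 0. \<bar>(N (e + h *\<^sub>R v) - N e) / h\<bar> \<le> N v"
      by (simp add: eventually_at_filter)
  qed simp
  moreover have "blinfun_apply (f' e) e = N e"
  proof (rule DERIV_unique[OF line[of e]])
    have "((\<lambda>s. (1 + s) * N e) has_real_derivative N e) (at 0)"
      by (auto intro!: derivative_eq_intros)
    then show "((\<lambda>s. N (e + s *\<^sub>R e)) has_real_derivative N e) (at 0)"
    proof (rule has_field_derivative_transform_within_open[of _ _ _ "{-1<..}"])
      fix s :: real assume "s \<in> {-1<..}"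
      then show "(1 + s) * N e = N (e + s *\<^sub>R e)"
        using scale[of "1 + s" e] by (simp add: scaleR_add_left)
    qed auto
  qed
  ultimately show ?thesis by blast
qed

section \<open>Talagrand operators: the tensor product\<close>

definition right_op ::
  "('a::banach \<Rightarrow>\<^sub>L real) \<Rightarrow> ('a, 'e::banach) inj_tensor \<Rightarrow> 'e" where
  "right_op \<xi> = tensor_extension (right_slice \<xi>)"

definition left_op ::
  "('e::banach \<Rightarrow>\<^sub>L real) \<Rightarrow> ('a::banach, 'e) inj_tensor \<Rightarrow> 'a" where
  "left_op \<eta> = tensor_extension (left_slice \<eta>)"

text \<open>The differentiability of \<open>N\<close> enters through the supporting functionals.\<close>

locale talagrand_tensor = talagrand_pair S T s for S T :: "'a::banach \<Rightarrow> 'l bfun" and s :: real +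
  fixes N :: "'e::banach \<Rightarrow> real" and a b :: real
  assumes N_add: "N (x + y) \<le> N x + N y" and N_scale: "N (c *\<^sub>R x) = \<bar>c\<bar> * N x"
    and a_pos: "a > 0" and b_pos: "b > 0" and N_lower: "a * norm x \<le> N x" and N_upper: "N x \<le> b * norm x"
    and support: "\<exists>\<eta> :: 'e \<Rightarrow>\<^sub>L real. blinfun_apply \<eta> e = N e \<and> (\<forall>v. \<bar>blinfun_apply \<eta> v\<bar> \<le> N v)"
begin

lemma N_nonneg: "0 \<le> N e"
  using N_lower[of e] a_pos by (meson mult_nonneg_nonneg norm_ge_zero less_imp_le order_trans)

definition dual_ball :: "('e \<Rightarrow>\<^sub>L real) set" where
  "dual_ball = {\<eta>. \<forall>v. \<bar>blinfun_apply \<eta> v\<bar> \<le> N v}"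

lemma dual_ball_le: "\<eta> \<in> dual_ball \<Longrightarrow> \<bar>blinfun_apply \<eta> v\<bar> \<le> N v"
  by (simp add: dual_ball_def)

lemma dual_ball_norm: "\<eta> \<in> dual_ball \<Longrightarrow> norm \<eta> \<le> b"
  using b_pos dual_ball_le N_upper by (intro norm_blinfun_bound) (auto intro: order_trans)

lemma dual_ball_attains: obtains \<eta> where "\<eta> \<in> dual_ball" "blinfun_apply \<eta> e = N e"
  using support[of e] by (auto simp: dual_ball_def)

text \<open>A functional that attains \<open>N\<close> at the slice turns the slice into a value of the pairing.\<close>

lemma norm_right_slice: "norm (right_slice \<xi> z :: 'e) \<le> b / a * norm \<xi> * injective_norm z"
proof -
  let ?e = "right_slice \<xi> z :: 'e"
  obtain \<eta> where \<eta>: "\<eta> \<in> dual_ball" "blinfun_apply \<eta> ?e = N ?e" by (rule dual_ball_attains)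
  have "a * norm ?e \<le> \<bar>tensor_pairing \<xi> \<eta> z\<bar>"
    using N_lower[of ?e] \<eta>(2) by (simp add: apply_right_slice)
  also have "\<dots> \<le> norm \<xi> * norm \<eta> * injective_norm z" by (rule tensor_pairing_le)
  also have "\<dots> \<le> norm \<xi> * b * injective_norm z"
    by (intro mult_right_mono mult_left_mono dual_ball_norm \<eta>(1)) auto
  finally show ?thesis using a_pos by (simp add: field_simps)
qed

definition coord :: "('a \<Rightarrow> 'l bfun) \<Rightarrow> 'l discrete \<Rightarrow> ('a \<Rightarrow>\<^sub>L real)" where
  "coord F t = Blinfun (\<lambda>x. F x t)"

lemma apply_coord: "bounded_linear F \<Longrightarrow> blinfun_apply (coord F t) x = apply_bcontfun (F x) t"
  by (simp add: coord_def bounded_linear_Blinfun_apply bounded_linear_coord)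

lemma norm_coord: "bounded_linear F \<Longrightarrow> norm (coord F t) \<le> onorm F"
proof (rule norm_blinfun_bound)
  assume F: "bounded_linear F"
  show "0 \<le> onorm F" by (rule onorm_pos_le[OF F])
  show "norm (blinfun_apply (coord F t) x) \<le> onorm F * norm x" for x
    unfolding apply_coord[OF F] using norm_bounded[of "F x" t] onorm[OF F, of x] by simp
qed

text \<open>On \<open>X\<close> the coordinates of \<open>S\<close> are norming up to the constant \<open>s\<close>, so they take over the role of
the supporting functionals.\<close>

lemma norm_left_slice:
  "norm (left_slice \<eta> z :: 'a) \<le> onorm S / s * norm \<eta> * injective_norm (z :: ('a, 'e) alg_tensor)"
proof -
  let ?x = "left_slice \<eta> z :: 'a"
  have "norm (S ?x) \<le> onorm S * norm \<eta> * injective_norm z"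
  proof (rule norm_bound)
    fix t
    have "norm (S ?x t) = \<bar>tensor_pairing (coord S t) \<eta> z\<bar>"
      using apply_coord[OF S, of t ?x] by (simp add: apply_left_slice)
    also have "\<dots> \<le> norm (coord S t) * norm \<eta> * injective_norm z" by (rule tensor_pairing_le)
    also have "\<dots> \<le> onorm S * norm \<eta> * injective_norm z"
      by (intro mult_right_mono norm_coord S) auto
    finally show "norm (S ?x t) \<le> onorm S * norm \<eta> * injective_norm z" .
  qed
  then have "s * norm ?x \<le> onorm S * norm \<eta> * injective_norm z" using S_lower[of ?x] by simp
  then show ?thesis using s_pos by (simp add: field_simps)
qed

lemma right_op:
  shows bounded_linear_right_op: "bounded_linear (right_op \<xi> :: ('a, 'e) inj_tensor \<Rightarrow> 'e)"
    and right_op_of_alg [simp]: "right_op \<xi> (of_alg_tensor z) = (right_slice \<xi> z :: 'e)"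
    and norm_right_op: "norm (right_op \<xi> w :: 'e) \<le> b / a * norm \<xi> * norm w"
  using tensor_extension[OF linear_right_slice norm_right_slice] by (auto simp: right_op_def)

lemma left_op:
  fixes \<eta> :: "'e \<Rightarrow>\<^sub>L real"
  shows bounded_linear_left_op: "bounded_linear (left_op \<eta> :: ('a, 'e) inj_tensor \<Rightarrow> 'a)"
    and left_op_of_alg [simp]: "left_op \<eta> (of_alg_tensor z) = (left_slice \<eta> z :: 'a)"
    and norm_left_op: "norm (left_op \<eta> w :: 'a) \<le> onorm S / s * norm \<eta> * norm w"
  using tensor_extension[OF linear_left_slice norm_left_slice] by (auto simp: left_op_def)

lemma slices_commute:
  fixes w :: "('a, 'e) inj_tensor"
  shows "blinfun_apply \<eta> (right_op \<xi> w) = blinfun_apply \<xi> (left_op \<eta> w)"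
proof (rule closed_dense_tensor[where P = "\<lambda>w. blinfun_apply \<eta> (right_op \<xi> w) = blinfun_apply \<xi> (left_op \<eta> w)"])
  show "closed {w :: ('a, 'e) inj_tensor. blinfun_apply \<eta> (right_op \<xi> w) = blinfun_apply \<xi> (left_op \<eta> w)}"
    by (intro closed_Collect_eq linear_continuous_on
        bounded_linear_compose[OF blinfun.bounded_linear_right bounded_linear_right_op]
        bounded_linear_compose[OF blinfun.bounded_linear_right bounded_linear_left_op])
qed (simp add: apply_right_slice apply_left_slice)

lemma slices_commute_coord:
  fixes w :: "('a, 'e) inj_tensor"
  assumes "bounded_linear F"
  shows "blinfun_apply \<eta> (right_op (coord F t) w) = F (left_op \<eta> w) t"
  by (simp add: slices_commute apply_coord[OF assms])

text \<open>The seminorms \<open>N ((F\<^sub>t \<otimes> id) w)\<close> for \<open>F\<close> one of \<open>S\<close>, \<open>T\<close>.\<close>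

definition slice_norm :: "('a \<Rightarrow> 'l bfun) \<Rightarrow> 'l discrete \<Rightarrow> ('a, 'e) inj_tensor \<Rightarrow> real" where
  "slice_norm F t w = N (right_op (coord F t) w)"

lemma slice_norm_add: "slice_norm F t (w + z) \<le> slice_norm F t w + slice_norm F t z"
  using N_add by (simp add: slice_norm_def linear_add[OF bounded_linear.linear[OF bounded_linear_right_op]])

lemma slice_norm_scale: "slice_norm F t (r *\<^sub>R w) = \<bar>r\<bar> * slice_norm F t w"
  using N_scale by (simp add: slice_norm_def linear_scale[OF bounded_linear.linear[OF bounded_linear_right_op]])

definition slice_bound :: real where
  "slice_bound = b * (b / a) * max (onorm S) (onorm T) + 1"

lemma slice_bound_pos: "slice_bound > 0"
  using a_pos b_pos onorm_pos_le[OF S] by (auto simp: slice_bound_def max_def intro!: add_nonneg_pos)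

lemma slice_norm_le: "F = S \<or> F = T \<Longrightarrow> slice_norm F t w \<le> slice_bound * norm w"
proof -
  assume F: "F = S \<or> F = T"
  then have bl: "bounded_linear F" and le: "onorm F \<le> max (onorm S) (onorm T)" using S T by auto
  have "slice_norm F t w \<le> b * (b / a * norm (coord F t) * norm w)"
    unfolding slice_norm_def by (rule order_trans[OF N_upper mult_left_mono[OF norm_right_op]]) (use b_pos in auto)
  also have "\<dots> \<le> b * (b / a * max (onorm S) (onorm T) * norm w)"
    using a_pos b_pos norm_coord[OF bl, of t] le
    by (intro mult_left_mono mult_right_mono) auto
  also have "\<dots> \<le> slice_bound * norm w" by (simp add: slice_bound_def algebra_simps)
  finally show ?thesis .
qed

text \<open>Together with the next lemma: \<open>slice_norm F t w\<close> is the maximum of \<open>|F (w\<^sub>\<eta>) t|\<close> over the dual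
ball, which reduces statements about the tensor to statements about elements of \<open>X\<close>.\<close>

lemma slice_norm_ge:
  fixes F :: "'a \<Rightarrow> 'l bfun"
  assumes "bounded_linear F" "\<eta> \<in> dual_ball"
  shows "\<bar>F (left_op \<eta> w) t\<bar> \<le> slice_norm F t w"
  using dual_ball_le[OF assms(2)] by (simp add: slice_norm_def flip: slices_commute_coord[OF assms(1)])

lemma slice_norm_attained:
  fixes F :: "'a \<Rightarrow> 'l bfun"
  assumes "bounded_linear F"
  obtains \<eta> where "\<eta> \<in> dual_ball" "slice_norm F t w = F (left_op \<eta> w) t"
proof -
  obtain \<eta> where "\<eta> \<in> dual_ball" "blinfun_apply \<eta> (right_op (coord F t) w) = N (right_op (coord F t) w)"
    by (rule dual_ball_attains)
  then show thesis by (intro that[of \<eta>]) (simp_all add: slice_norm_def slices_commute_coord[OF assms])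
qed

text \<open>For algebraic tensors, the pairing with \<open>\<xi>\<close> and \<open>\<eta>\<close> is at most the norm of the left slice, which is
controlled by its coordinates under \<open>S\<close>, that is by \<open>\<eta>\<close> applied to right slices.  The bound passes to the
completion because the seminorms are uniformly Lipschitz in \<open>t\<close>.\<close>

lemma norm_le_slice_norm:
  assumes "\<And>t. slice_norm S t w \<le> m" shows "s * a * norm w \<le> m"
proof -
  have m0: "m \<ge> 0" using N_nonneg assms unfolding slice_norm_def by (meson order_trans)
  have alg: "s * a * injective_norm z \<le> m"
    if m: "\<And>t. slice_norm S t (of_alg_tensor z) \<le> m" and "m \<ge> 0" for z :: "('a, 'e) alg_tensor" and m
  proof -
    have "injective_norm z \<le> m / (s * a)"
    proof (rule injective_norm_least)
      fix \<xi> :: "'a \<Rightarrow>\<^sub>L real" and \<eta> :: "'e \<Rightarrow>\<^sub>L real" assume n: "norm \<xi> \<le> 1" "norm \<eta> \<le> 1"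
      let ?x = "left_slice \<eta> z :: 'a"
      have "norm (S ?x) \<le> m / a"
      proof (rule norm_bound)
        fix t
        let ?e = "right_slice (coord S t) z"
        have "norm (S ?x t) = \<bar>blinfun_apply \<eta> ?e\<bar>"
          using slices_commute_coord[OF S, of \<eta> t "of_alg_tensor z"] by simp
        also have "\<dots> \<le> norm ?e"
          using norm_blinfun[of \<eta> ?e] mult_right_mono[OF n(2), of "norm ?e"] by simp
        also have "\<dots> \<le> m / a"
          using N_lower[of ?e] m[of t] a_pos by (simp add: slice_norm_def field_simps)
        finally show "norm (S ?x t) \<le> m / a" .
      qed
      with S_lower[of ?x] have "s * norm ?x \<le> m / a" by linarith
      then have "norm ?x \<le> m / (s * a)" using s_pos a_pos by (simp add: field_simps)
      moreover have "\<bar>tensor_pairing \<xi> \<eta> z\<bar> \<le> norm ?x"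
        using norm_blinfun[of \<xi> ?x] mult_right_mono[OF n(1), of "norm ?x"]
        by (simp add: apply_left_slice)
      ultimately show "\<bar>tensor_pairing \<xi> \<eta> z\<bar> \<le> m / (s * a)" by simp
    qed
    then show ?thesis using s_pos a_pos by (simp add: field_simps)
  qed
  show ?thesis
  proof (rule field_le_epsilon)
    fix e :: real assume e: "e > 0"
    define K where "K = slice_bound + s * a"
    have K: "K > 0" using slice_bound_pos s_pos a_pos by (simp add: K_def add_pos_pos)
    obtain z where z: "norm (w - of_alg_tensor z) < e / K"
      using of_alg_tensor_approx[of "e / K" w] e K by auto
    have "slice_norm S t (of_alg_tensor z) \<le> m + slice_bound * (e / K)" for t
    proof -
      have "slice_norm S t (of_alg_tensor z) \<le> slice_norm S t w + slice_norm S t (of_alg_tensor z - w)"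
        using slice_norm_add[of S t w "of_alg_tensor z - w"] by simp
      also have "slice_norm S t (of_alg_tensor z - w) \<le> slice_bound * (e / K)"
        by (rule order_trans[OF slice_norm_le mult_left_mono]) (use z slice_bound_pos in \<open>auto simp: norm_minus_commute\<close>)
      finally show ?thesis using assms[of t] by simp
    qed
    from alg[OF this] have "s * a * injective_norm z \<le> m + slice_bound * (e / K)"
      using m0 slice_bound_pos e K by (simp add: add_nonneg_nonneg)
    moreover have "s * a * norm w \<le> s * a * (injective_norm z + e / K)"
      using norm_triangle_ineq2[of w "of_alg_tensor z"] z s_pos a_pos
      by (intro mult_left_mono) (auto simp: norm_of_alg_tensor)
    ultimately have "s * a * norm w \<le> m + (slice_bound + s * a) * (e / K)" by (simp add: algebra_simps)
    also have "\<dots> = m + e" using K unfolding K_def[symmetric] by simp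
    finally show "s * a * norm w \<le> m + e" .
  qed
qed

text \<open>For elementary tensors this is the hypothesis that \<open>T\<close> maps into \<open>c\<^sub>0\<close>.  It is stable under sums, and
under limits because the seminorms are uniformly Lipschitz in \<open>t\<close>.\<close>

lemma slice_norm_null:
  assumes "\<epsilon> > 0" shows "finite {t. \<epsilon> \<le> slice_norm T t w}"
proof -
  have alg: "finite {t. \<epsilon> \<le> slice_norm T t (of_alg_tensor z)}" if "\<epsilon> > 0" for \<epsilon> and z :: "('a, 'e) alg_tensor"
    using that
  proof (induction z arbitrary: \<epsilon> rule: alg_tensor_induct)
    case zero
    have "slice_norm T t (of_alg_tensor 0) = 0" for t
      using N_scale[of 0 0] by (simp add: slice_norm_def)
    then show ?case using zero by simp
  next
    case (add x e z)
    have "finite {t. \<epsilon> / (2 * (N e + 1)) \<le> \<bar>T x t\<bar>}"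
      using add.prems N_nonneg[of e] by (intro T_null) (simp add: add_nonneg_pos)
    moreover have "finite {t. \<epsilon> / 2 \<le> slice_norm T t (of_alg_tensor z)}"
      using add.prems by (intro add.IH) simp
    moreover have "{t. \<epsilon> \<le> slice_norm T t (of_alg_tensor (tensor x e + z))} \<subseteq>
        {t. \<epsilon> / (2 * (N e + 1)) \<le> \<bar>T x t\<bar>} \<union> {t. \<epsilon> / 2 \<le> slice_norm T t (of_alg_tensor z)}"
    proof
      fix t assume "t \<in> {t. \<epsilon> \<le> slice_norm T t (of_alg_tensor (tensor x e + z))}"
      moreover have "slice_norm T t (of_alg_tensor (tensor x e + z)) \<le>
          \<bar>T x t\<bar> * N e + slice_norm T t (of_alg_tensor z)"
        using N_add[of "T x t *\<^sub>R e" "right_slice (coord T t) z"]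
        by (simp add: slice_norm_def apply_coord[OF T] N_scale)
      moreover have "\<bar>T x t\<bar> * N e \<le> \<bar>T x t\<bar> * (N e + 1)"
        by (simp add: mult_left_mono)
      ultimately have "\<epsilon> / 2 \<le> \<bar>T x t\<bar> * (N e + 1) \<or> \<epsilon> / 2 \<le> slice_norm T t (of_alg_tensor z)"
        by (smt (verit) field_sum_of_halves mem_Collect_eq)
      then show "t \<in> {t. \<epsilon> / (2 * (N e + 1)) \<le> \<bar>T x t\<bar>} \<union> {t. \<epsilon> / 2 \<le> slice_norm T t (of_alg_tensor z)}"
        using N_nonneg[of e] by (auto simp: pos_divide_le_eq add_nonneg_pos algebra_simps)
    qed
    ultimately show ?case by (meson finite_UnI finite_subset)
  qed
  define d where "d = \<epsilon> / (2 * slice_bound)"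
  have d: "d > 0" using assms slice_bound_pos by (simp add: d_def)
  obtain z where z: "norm (w - of_alg_tensor z) < d" using of_alg_tensor_approx[OF d] by blast
  have "{t. \<epsilon> \<le> slice_norm T t w} \<subseteq> {t. \<epsilon> / 2 \<le> slice_norm T t (of_alg_tensor z)}"
  proof
    fix t assume "t \<in> {t. \<epsilon> \<le> slice_norm T t w}"
    moreover have "slice_norm T t w \<le> slice_norm T t (of_alg_tensor z) + slice_norm T t (w - of_alg_tensor z)"
      using slice_norm_add[of T t "of_alg_tensor z" "w - of_alg_tensor z"] by simp
    moreover have "slice_norm T t (w - of_alg_tensor z) \<le> slice_bound * d"
      by (rule order_trans[OF slice_norm_le mult_left_mono]) (use z slice_bound_pos in auto)
    moreover have "slice_bound * d = \<epsilon> / 2" using slice_bound_pos by (simp add: d_def)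
    ultimately show "t \<in> {t. \<epsilon> / 2 \<le> slice_norm T t (of_alg_tensor z)}" by simp
  qed
  then show ?thesis using alg[of "\<epsilon> / 2" z] assms finite_subset by auto
qed

text \<open>For an elementary tensor the slices fill a bounded segment.\<close>

lemma compact_left_slices: "\<exists>K. compact K \<and> (\<forall>\<eta>\<in>dual_ball. left_slice \<eta> z \<in> (K :: 'a set))"
proof (induction z rule: alg_tensor_induct)
  case zero
  show ?case by (intro exI[of _ "{0}"]) simp
next
  case (add x e z)
  then obtain K where K: "compact K" "\<And>\<eta>. \<eta> \<in> dual_ball \<Longrightarrow> left_slice \<eta> z \<in> K" by blast
  let ?L = "(\<lambda>r. r *\<^sub>R x) ` {- N e..N e}"
  have "compact ?L" by (intro compact_continuous_image continuous_intros compact_Icc)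
  then have "compact {u + v | u v. u \<in> ?L \<and> v \<in> K}" by (rule compact_sums[OF _ K(1)])
  moreover have "left_slice \<eta> (tensor x e + z) \<in> {u + v | u v. u \<in> ?L \<and> v \<in> K}" if "\<eta> \<in> dual_ball" for \<eta>
  proof -
    have "blinfun_apply \<eta> e *\<^sub>R x \<in> ?L"
      using dual_ball_le[OF that, of e] by (intro imageI) (simp add: abs_le_iff)
    then show ?thesis using K(2)[OF that] by auto
  qed
  ultimately show ?case by blast
qed

text \<open>Uniformly over the dual ball, the slices of \<open>w\<close> are close to those of an algebraic tensor, which lie in a
compact set; so they are totally bounded.\<close>

lemma compact_closure_left_ops: "compact (closure ((\<lambda>\<eta>. left_op \<eta> w) ` dual_ball) :: 'a set)"
proof -
  let ?X = "(\<lambda>\<eta>. left_op \<eta> w :: 'a) ` dual_ball"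
  have "\<exists>k. finite k \<and> closure ?X \<subseteq> (\<Union>x\<in>k. ball x \<epsilon>)" if eps: "\<epsilon> > 0" for \<epsilon>
  proof -
    define M where "M = onorm S / s * b + 1"
    have M: "M > 0" using onorm_pos_le[OF S] s_pos b_pos by (simp add: M_def add_nonneg_pos)
    obtain z where z: "norm (w - of_alg_tensor z) < \<epsilon> / (4 * M)"
      using of_alg_tensor_approx[of "\<epsilon> / (4 * M)" w] eps M by auto
    obtain K where K: "compact K" "\<forall>\<eta>\<in>dual_ball. left_slice \<eta> z \<in> (K :: 'a set)"
      using compact_left_slices[of z] by (elim exE conjE)
    from K(1) have "\<exists>k. finite k \<and> K \<subseteq> (\<Union>x\<in>k. ball x (\<epsilon> / 4))"
      unfolding compact_eq_totally_bounded using eps by simp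
    then obtain k where k: "finite k" "K \<subseteq> (\<Union>x\<in>k. ball x (\<epsilon> / 4))" by blast
    have "?X \<subseteq> (\<Union>x\<in>k. cball x (\<epsilon> / 2))"
    proof
      fix y assume "y \<in> ?X"
      then obtain \<eta> where \<eta>: "\<eta> \<in> dual_ball" and y: "y = left_op \<eta> w" by blast
      obtain x where x: "x \<in> k" "dist x (left_slice \<eta> z) < \<epsilon> / 4"
        using bspec[OF K(2) \<eta>] k(2) by auto
      have "norm (y - left_slice \<eta> z) = norm (left_op \<eta> (w - of_alg_tensor z) :: 'a)"
        by (simp add: y linear_diff[OF bounded_linear.linear[OF bounded_linear_left_op]])
      also have "\<dots> \<le> onorm S / s * norm \<eta> * norm (w - of_alg_tensor z)" by (rule norm_left_op)
      also have "\<dots> \<le> M * norm (w - of_alg_tensor z)"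
      proof (rule mult_right_mono)
        have "onorm S / s * norm \<eta> \<le> onorm S / s * b"
          using onorm_pos_le[OF S] s_pos by (intro mult_left_mono dual_ball_norm[OF \<eta>]) auto
        then show "onorm S / s * norm \<eta> \<le> M" by (simp add: M_def)
      qed simp
      also have "\<dots> \<le> M * (\<epsilon> / (4 * M))" using z M by (intro mult_left_mono) auto
      also have "\<dots> = \<epsilon> / 4" using M by simp
      finally have "dist (left_slice \<eta> z) y \<le> \<epsilon> / 4" by (simp add: dist_norm norm_minus_commute)
      with x(2) have "dist x y \<le> \<epsilon> / 2" using dist_triangle[of x y "left_slice \<eta> z"] by simp
      then show "y \<in> (\<Union>x\<in>k. cball x (\<epsilon> / 2))" using x(1) by auto
    qed
    moreover have "closed (\<Union>x\<in>k. cball x (\<epsilon> / 2))" using k(1) by (intro closed_UN) auto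
    ultimately have "closure ?X \<subseteq> (\<Union>x\<in>k. cball x (\<epsilon> / 2))" by (rule closure_minimal)
    also have "\<dots> \<subseteq> (\<Union>x\<in>k. ball x \<epsilon>)" using eps by (intro UN_mono order_refl) auto
    finally show ?thesis using k(1) by blast
  qed
  moreover have "complete (closure ?X)" by (simp add: complete_eq_closed)
  ultimately show ?thesis by (simp add: compact_eq_totally_bounded)
qed

text \<open>Let \<open>u\<close> be a point of the compact closure of the slices with \<open>norm (F u)\<close> maximal.  This maximum bounds
all \<open>slice_norm F j w\<close>.  The domination inequality at \<open>u\<close> is an open condition, so it persists for an
actual slice of \<open>w\<close>, and there \<open>slice_norm_ge\<close> carries it over to \<open>w\<close>.\<close>

lemma slice_norm_maximiser:
  assumes F: "F = S \<or> F = T" and pos: "\<exists>t. slice_norm F t w > 0"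
  obtains t \<delta> where "\<delta> > 0" "\<And>j. slice_norm F j w + \<delta> \<le> slice_norm S t w + slice_norm T t w / 2"
proof -
  let ?X = "(\<lambda>\<eta>. left_op \<eta> w :: 'a) ` dual_ball"
  have bl: "bounded_linear F" using F S T by auto
  obtain t0 where t0: "slice_norm F t0 w > 0" using pos by blast
  obtain \<eta>0 where \<eta>0: "\<eta>0 \<in> dual_ball" "slice_norm F t0 w = F (left_op \<eta>0 w) t0"
    by (rule slice_norm_attained[OF bl])
  have "closure ?X \<noteq> {}" using \<eta>0(1) by auto
  moreover have "continuous_on (closure ?X) (\<lambda>x. norm (F x))"
    by (intro continuous_on_norm linear_continuous_on bl)
  ultimately obtain u where u: "u \<in> closure ?X" "\<And>y. y \<in> closure ?X \<Longrightarrow> norm (F y) \<le> norm (F u)"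
    using continuous_attains_sup[OF compact_closure_left_ops] by blast
  have le: "slice_norm F j w \<le> norm (F u)" for j
  proof -
    obtain \<eta> where \<eta>: "\<eta> \<in> dual_ball" "slice_norm F j w = F (left_op \<eta> w) j"
      by (rule slice_norm_attained[OF bl])
    have "slice_norm F j w \<le> norm (F (left_op \<eta> w))"
      using norm_bounded[of "F (left_op \<eta> w)" j] \<eta>(2) by simp
    also have "\<dots> \<le> norm (F u)" using \<eta>(1) by (intro u(2) closure_subset[THEN subsetD]) auto
    finally show ?thesis .
  qed
  have "u \<noteq> 0" using le[of t0] t0 linear_0[OF bounded_linear.linear[OF bl]] by auto
  then obtain t \<delta> where t: "\<delta> > 0"
    "norm (S u) + \<delta> < \<bar>S u t\<bar> + \<bar>T u t\<bar> / 2"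
    "norm (T u) + \<delta> < \<bar>S u t\<bar> + \<bar>T u t\<bar> / 2"
    by (rule domination_at)
  let ?q = "\<lambda>x. \<bar>S x t\<bar> + \<bar>T x t\<bar> / 2"
  have op: "open {x. norm (F u) + \<delta> < ?q x}"
    by (intro open_Collect_less continuous_intros linear_continuous_on bounded_linear_coord S T) auto
  have "{x. norm (F u) + \<delta> < ?q x} \<inter> ?X \<noteq> {}"
  proof
    have "norm (F u) + \<delta> < ?q u" using t(2,3) F by auto
    then have mem: "u \<in> {x. norm (F u) + \<delta> < ?q x} \<inter> closure ?X" using u(1) by simp
    assume "{x. norm (F u) + \<delta> < ?q x} \<inter> ?X = {}"
    with open_Int_closure_eq_empty[OF op, of ?X]
    have "{x. norm (F u) + \<delta> < ?q x} \<inter> closure ?X = {}" by (rule iffD2)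
    from mem[unfolded this] show False by (rule emptyE)
  qed
  then obtain \<eta> where \<eta>: "\<eta> \<in> dual_ball" "norm (F u) + \<delta> < ?q (left_op \<eta> w)" by auto
  have "slice_norm F j w + \<delta> \<le> slice_norm S t w + slice_norm T t w / 2" for j
    using le[of j] \<eta>(2) slice_norm_ge[OF S \<eta>(1), of w t] slice_norm_ge[OF T \<eta>(1), of w t] by simp
  then show thesis using t(1) that by blast
qed

text \<open>The maximisers for \<open>S\<close> and for \<open>T\<close> may differ; the index with the larger right-hand side serves both.
If all \<open>slice_norm T j w\<close> vanish, the index found for \<open>S\<close> will do.\<close>

lemma slice_norm_gap:
  assumes "w \<noteq> 0"
  shows "\<exists>i. \<exists>\<delta>>0. \<forall>j. slice_norm S j w + \<delta> \<le> slice_norm S i w + slice_norm T i w / 2 \<and> slice_norm T j w + \<delta> \<le> slice_norm S i w + slice_norm T i w / 2"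
proof -
  let ?q = "\<lambda>t. slice_norm S t w + slice_norm T t w / 2"
  have "\<exists>t. slice_norm S t w > 0"
  proof (rule ccontr)
    assume "\<not> (\<exists>t. slice_norm S t w > 0)"
    then have "\<And>t. slice_norm S t w \<le> 0" by (simp add: not_less)
    then have "s * a * norm w \<le> 0" by (rule norm_le_slice_norm)
    then show False using assms s_pos a_pos by (simp add: mult_le_0_iff)
  qed
  then obtain t \<delta> where t: "\<delta> > 0" "\<And>j. slice_norm S j w + \<delta> \<le> ?q t"
    using slice_norm_maximiser[of S w] by metis
  have nonneg: "0 \<le> slice_norm F t w" for F t by (simp add: slice_norm_def N_nonneg)
  show ?thesis
  proof (cases "\<exists>t. slice_norm T t w > 0")
    case True
    then obtain t' \<delta>' where t': "\<delta>' > 0" "\<And>j. slice_norm T j w + \<delta>' \<le> ?q t'"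
      using slice_norm_maximiser[of T w] by metis
    define i where "i = (if ?q t \<le> ?q t' then t' else t)"
    have i: "?q t \<le> ?q i" "?q t' \<le> ?q i" by (auto simp: i_def)
    show ?thesis
    proof (intro exI[of _ i] exI[of _ "min \<delta> \<delta>'"] conjI allI)
      show "slice_norm S j w + min \<delta> \<delta>' \<le> ?q i" "slice_norm T j w + min \<delta> \<delta>' \<le> ?q i" for j
        using t(2)[of j] t'(2)[of j] i by linarith+
    qed (use t(1) t'(1) in simp)
  next
    case False
    then have z: "slice_norm T j w = 0" for j using nonneg[of T j] by (metis order_antisym not_less)
    show ?thesis
      by (intro exI[of _ t] exI[of _ \<delta>] conjI allI t)
        (use t nonneg[of S t] z in \<open>smt (verit)\<close>)
  qed
qed

sublocale tens: seminorm_pair "slice_norm S" "slice_norm T" slice_bound "s * a / 2"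
proof
  fix i and x y :: "('a, 'e) inj_tensor" and r :: real
  show "slice_norm S i (x + y) \<le> slice_norm S i x + slice_norm S i y" "slice_norm T i (x + y) \<le> slice_norm T i x + slice_norm T i y"
    by (rule slice_norm_add)+
  show "slice_norm S i (r *\<^sub>R x) = \<bar>r\<bar> * slice_norm S i x" "slice_norm T i (r *\<^sub>R x) = \<bar>r\<bar> * slice_norm T i x"
    by (rule slice_norm_scale)+
  show "slice_bound > 0" by (rule slice_bound_pos)
  show "slice_norm S i x \<le> slice_bound * norm x" "slice_norm T i x \<le> slice_bound * norm x" by (rule slice_norm_le; simp)+
  show "s * a / 2 > 0" using s_pos a_pos by simp
  show "\<exists>i. s * a / 2 * norm x \<le> slice_norm S i x"
  proof (rule ccontr)
    assume "\<nexists>i. s * a / 2 * norm x \<le> slice_norm S i x"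
    then have *: "slice_norm S i x < s * a / 2 * norm x" for i by (simp add: not_le)
    then have "s * a * norm x \<le> s * a / 2 * norm x" by (intro norm_le_slice_norm less_imp_le)
    moreover have half: "s * a / 2 * norm x = (s * a * norm x) / 2" by simp
    ultimately have "slice_norm S undefined x < 0" using *[of undefined] unfolding half by linarith
    then show False using N_nonneg by (simp add: slice_norm_def not_less[symmetric])
  qed
  show "finite {i. \<epsilon> \<le> slice_norm T i x}" if "\<epsilon> > 0" for \<epsilon> by (rule slice_norm_null[OF that])
  show "\<exists>i. \<exists>\<delta>>0. \<forall>j. slice_norm S j x + \<delta> \<le> slice_norm S i x + slice_norm T i x / 2 \<and> slice_norm T j x + \<delta> \<le> slice_norm S i x + slice_norm T i x / 2"
    if "x \<noteq> 0" by (rule slice_norm_gap[OF that])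
qed

lemma N_eq_0: "N e = 0 \<longleftrightarrow> e = 0"
  using N_lower[of e] a_pos N_scale[of 0 0] by (auto simp: mult_le_0_iff)

lemma regular_slice_norm:
  assumes "C_on n (UNIV - {0}) N" shows "tens.regular n"
  unfolding tens.regular_def slice_norm_def
  by (intro allI conjI equi_C_compose_linear[OF bounded_linear_right_op equi_C_if_C_on[OF assms]])
    (auto simp: N_eq_0)

lemma admits_C_norm_tensor:
  assumes "C_class_on k (UNIV - {0}) N" shows "admits_C_norm k TYPE(('a, 'e) inj_tensor)"
  unfolding admits_C_norm_def C_class_on_def
proof (intro exI[of _ tens.smooth_norm] conjI allI impI)
  show "equivalent_norm tens.smooth_norm" by (rule tens.equivalent_norm_smooth_norm)
  show "C_on n (UNIV - {0}) tens.smooth_norm" if "enat n \<le> k" for n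
    using assms that by (intro tens.C_on_smooth_norm regular_slice_norm) (simp add: C_class_on_def)
qed

end

theorem corollary1:
  fixes L :: "'l set"
    and S T :: "'a::banach \<Rightarrow> 'l bfun"
  assumes "linear_homeomorphic_embedding S" and "range S \<subseteq> ell_infty L"
    and "bounded_linear T" and "range T \<subseteq> c_zero L"
    and "\<And>x. x \<noteq> 0 \<Longrightarrow> (S x, T x) \<in> U_set L"
  shows "admits_C_norm \<infinity> TYPE('a) \<and>
    (\<forall>k\<ge>1. admits_C_norm k TYPE('e::banach) \<longrightarrow> admits_C_norm k TYPE(('a, 'e) inj_tensor))"
proof -
  obtain s where s: "bounded_linear S" "s > 0" "\<And>x. s * norm x \<le> norm (S x)"
    by (rule embedding_bounded_below[OF assms(1)]) (rule that)
  interpret talagrand_pair S T s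
  proof (rule talagrand_pair.intro)
    show "finite {t. \<epsilon> \<le> \<bar>T x t\<bar>}" if "\<epsilon> > 0" for \<epsilon> x
    proof (rule finite_subset)
      have Tx: "T x \<in> c_zero L" using assms(4) by blast
      then show "finite (discrete ` {t\<in>L. \<epsilon> \<le> \<bar>T x (discrete t)\<bar>})"
        using that by (simp add: c_zero_def)
      show "{t. \<epsilon> \<le> \<bar>T x t\<bar>} \<subseteq>
          discrete ` {t\<in>L. \<epsilon> \<le> \<bar>T x (discrete t)\<bar>}"
      proof
        fix t assume t: "t \<in> {t. \<epsilon> \<le> \<bar>T x t\<bar>}"
        obtain i where i: "t = discrete i" by (cases t) auto
        have "i \<in> L"
          using Tx t that i by (auto simp: c_zero_def ell_infty_def)
        then show "t \<in> discrete ` {t\<in>L. \<epsilon> \<le> \<bar>T x (discrete t)\<bar>}"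
          using t i by auto
      qed
    qed
    show "norm (S x) < norm (abs_bfun (S x) + (1/2) *\<^sub>R abs_bfun (T x)) \<and>
        norm (T x) < norm (abs_bfun (S x) + (1/2) *\<^sub>R abs_bfun (T x))" if "x \<noteq> 0" for x
      using assms(5)[OF that] by (simp add: U_set_def)
  qed (use s assms(3) in auto)
  have "admits_C_norm k TYPE(('a, 'e) inj_tensor)"
    if k: "k \<ge> 1" and E: "admits_C_norm k TYPE('e)" for k
  proof -
    obtain N :: "'e \<Rightarrow> real" where N: "equivalent_norm N" and C: "C_class_on k (UNIV - {0}) N"
      using E by (auto simp: admits_C_norm_def)
    then obtain a b where ab: "a > 0" "b > 0" "\<And>x. a * norm x \<le> N x" "\<And>x. N x \<le> b * norm x"
      unfolding equivalent_norm_def by blast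
    have "C_on (Suc 0) (UNIV - {0}) N"
      using C k by (simp add: C_class_on_def one_enat_def)
    note support = supporting_functional[OF N this]
    have tri: "\<And>x y. N (x + y) \<le> N x + N y" and scale: "\<And>c x. N (c *\<^sub>R x) = \<bar>c\<bar> * N x"
      using N by (simp_all add: equivalent_norm_def)
    interpret talagrand_tensor S T s N a b
      by (rule talagrand_tensor.intro[OF talagrand_pair_axioms talagrand_tensor_axioms.intro])
        (rule tri scale ab support)+
    show ?thesis by (rule admits_C_norm_tensor[OF C])
  qed
  then show ?thesis using admits_C_infinity_norm by blast
qed
end
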